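(* For every integer $n\ge1$, write the Poincaré series of $H^*(W(n),\mathbb{F}_2)$ as $q_n(t)/(1-t^2)^{r}$ with $r=\binom{n+1}{2}$ and $q_n(t)=1+a_1t+a_2t^2+\dots+a_rt^r$. Then $$a_2=\frac{n(n+1)(n-1)}{3}\quad\text{and}\quad a_3=\frac{n(n^2-1)(3n-4)(n+3)}{60}.$$
   Context: $W(n)=F_n/F_n^4[F_n^2,F_n]$, where $F_n$ is the free group of rank $n$ and $F_n^4[F_n^2,F_n]$ is the subgroup generated by fourth powers and commutators $[a^2,b]$; $q_n(t)$ is a polynomial of degree $r$. *)

theory Defs
  imports "HOL-Algebra.Group" "HOL-Library.Z2" "HOL-Computational_Algebra.Formal_Power_Series"
begin

section \<open>The group W(n) = F_n / F_n^4 [F_n^2, F_n]\<close>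

text \<open>Since every element of W(n) has order dividing 4, inverses are positive
words (x^-1 = x^3), so W(n) is the quotient of the free monoid on the letters
0..n-1 (lists over {..<n}) by the monoid congruence generated by
w^4 = 1 and w^2 v = v w^2 for all words w v.\<close>

inductive wrel :: "nat \<Rightarrow> nat list \<Rightarrow> nat list \<Rightarrow> bool" for n :: nat where
  refl: "w \<in> lists {..<n} \<Longrightarrow> wrel n w w"
| sym: "wrel n u v \<Longrightarrow> wrel n v u"
| trans: "wrel n u v \<Longrightarrow> wrel n v w \<Longrightarrow> wrel n u w"
| cong: "wrel n u v \<Longrightarrow> a \<in> lists {..<n} \<Longrightarrow> b \<in> lists {..<n}
          \<Longrightarrow> wrel n (a @ u @ b) (a @ v @ b)"
| fourth: "w \<in> lists {..<n} \<Longrightarrow> wrel n (w @ w @ w @ w) []"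
| sqcomm: "w \<in> lists {..<n} \<Longrightarrow> v \<in> lists {..<n} \<Longrightarrow> wrel n (w @ w @ v) (v @ w @ w)"

definition wclass :: "nat \<Rightarrow> nat list \<Rightarrow> nat list set" where
  "wclass n w = {v. wrel n w v}"

definition W :: "nat \<Rightarrow> nat list set monoid" where
  "W n = \<lparr> carrier = wclass n ` lists {..<n},
           monoid.mult = (\<lambda>A B. {v. \<exists>a\<in>A. \<exists>b\<in>B. wrel n (a @ b) v}),
           one = wclass n [] \<rparr>"

text \<open>Inhomogeneous k-cochains: functions G^k \<rightarrow> F_2, represented as functions on
lists that vanish outside the lists of length k with entries in the carrier.\<close>

definition cochains :: "('a, 'b) monoid_scheme \<Rightarrow> nat \<Rightarrow> ('a list \<Rightarrow> bit) set" where
  "cochains G k = {f. \<forall>gs. f gs \<noteq> 0 \<longrightarrow> length gs = k \<and> set gs \<subseteq> carrier G}"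

text \<open>Standard coboundary (trivial action); signs are irrelevant in characteristic 2.\<close>
definition coboundary :: "('a, 'b) monoid_scheme \<Rightarrow> nat \<Rightarrow> ('a list \<Rightarrow> bit) \<Rightarrow> ('a list \<Rightarrow> bit)" where
  "coboundary G k f gs =
     (if length gs = Suc k \<and> set gs \<subseteq> carrier G then
        f (tl gs)
        + (\<Sum>i<k. f (take i gs @ [gs ! i \<otimes>\<^bsub>G\<^esub> gs ! Suc i] @ drop (Suc (Suc i)) gs))
        + f (take k gs)
      else 0)"

definition cocycles :: "('a, 'b) monoid_scheme \<Rightarrow> nat \<Rightarrow> ('a list \<Rightarrow> bit) set" where
  "cocycles G k = {f \<in> cochains G k. coboundary G k f = (\<lambda>_. 0)}"

definition coboundaries :: "('a, 'b) monoid_scheme \<Rightarrow> nat \<Rightarrow> ('a list \<Rightarrow> bit) set" where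
  "coboundaries G k = (if k = 0 then {\<lambda>_. 0} else coboundary G (k - 1) ` cochains G (k - 1))"

text \<open>dim_{F_2} H^k(G;F_2): H^k = cocycles/coboundaries has 2^dim elements.\<close>
definition cohom_dim :: "('a, 'b) monoid_scheme \<Rightarrow> nat \<Rightarrow> nat" where
  "cohom_dim G k = (THE m. card (cocycles G k) = 2 ^ m * card (coboundaries G k))"

definition poincare_series :: "('a, 'b) monoid_scheme \<Rightarrow> rat fps" where
  "poincare_series G = Abs_fps (\<lambda>k. of_nat (cohom_dim G k))"

end

theory Submission
  imports Defs "HOL-Library.Function_Algebras" "HOL-Combinatorics.Multiset_Permutations"
begin

text \<open>
  W(n) is a central extension of (Z/2)^n by (Z/2)^r whose extension classes are all quadratic
  monomials: it has coordinates x_i (homomorphisms to F_2) and z_v, one for each multiset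
  {a, b} of indices, with z_v(gh) = z_v(g) + z_v(h) + x_a(g) x_b(h).

  Products of monomials in the coordinates form a basis of the inhomogeneous cochains. Up to terms
  of smaller degree in the z_v (the weight) the coboundary only splits one monomial in all
  possible ways, and an acyclic matching on the basis reduces the cochains to a complex with one
  basis vector for each multiset of coordinates. The reduced coboundary lowers the weight, and the
  part lowering it by one is the Koszul differential sending z_v to x_a x_b. In degrees at most
  three the parts that lower the weight further do not change the rank, because everything of
  weight zero is already hit, so the dimension of the cohomology follows from three ranks of the
  Koszul complex.
\<close>

section \<open>Finite vector spaces of bit-valued functions\<close>

text \<open>As functions to F_2 the coordinates are idempotent, so the monomials in one argument are
  square-free. Multisets appear only after the reduction, as the monomials of F_2[x_i, z_v], which
  is the second page of the spectral sequence of the central extension. The obstacle is that the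
  reduced coboundary is known only in its leading weight: z_v^2, for instance, is a Koszul cycle,
  but its reduced coboundary may have a component of weight zero. Ranks are therefore counted along
  the weight filtration of the source: a step adds exactly its Koszul rank if every image that loses
  its leading part lies in the image of smaller weight. In weight two this holds because the
  extension classes are all quadratic monomials, so weight one already hits every form of degree at
  least two in the x_i. In weight three, which in degree three means products of three z_v, it holds
  because the Koszul differential is injective there. If h_k are the dimensions, then h_0 = 1 and
  h_1 = n, so a_2 = h_2 - r and a_3 = h_3 - r n.\<close>

text \<open>By default the simplifier turns the field operations of \<open>bit\<close> into bit operations.\<close>

declare add_bit_eq_xor [simp del] mult_bit_eq_and [simp del]

definition bscale :: "bit \<Rightarrow> ('a \<Rightarrow> bit) \<Rightarrow> 'a \<Rightarrow> bit" where
  "bscale c f = (\<lambda>x. c * f x)"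

lemma bscale_simps [simp]: "bscale 0 f = 0" "bscale 1 f = f"
  by (auto simp: bscale_def fun_eq_iff)

interpretation bv: vector_space bscale
  by unfold_locales (auto simp: bscale_def fun_eq_iff algebra_simps)

interpretation bvp: vector_space_pair bscale bscale
  by unfold_locales

abbreviation blinear :: "(('a \<Rightarrow> bit) \<Rightarrow> 'b \<Rightarrow> bit) \<Rightarrow> bool" where
  "blinear \<equiv> Vector_Spaces.linear bscale bscale"

lemma bit_double [simp]: "a + a = (0 :: bit)"
  by (cases a) auto

lemma bit_fun_double [simp]: "f + f = (0 :: 'a \<Rightarrow> bit)"
  by (auto simp: fun_eq_iff)

lemma bit_add_left [simp]: "a + (a + b) = (b :: bit)"
  by (simp add: add.assoc[symmetric])

lemma bit_fun_add_left [simp]: "f + (f + g) = (g :: 'a \<Rightarrow> bit)"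
  by (simp add: add.assoc[symmetric])

lemma bit_fun_diff [simp]: "f - g = f + (g :: 'a \<Rightarrow> bit)"
  by (auto simp: fun_eq_iff)

lemma blinearI: "(\<And>x y. f (x + y) = f x + f y) \<Longrightarrow> blinear f"
proof -
  assume add: "\<And>x y. f (x + y) = f x + f y"
  have "f 0 = 0" using add[of 0 0] by simp
  have "f (bscale c x) = bscale c (f x)" for c x by (cases c) (auto simp: \<open>f 0 = 0\<close>)
  then show ?thesis using add by unfold_locales
qed

lemma blinear_add: "blinear f \<Longrightarrow> f (x + y) = f x + f y"
  by (rule bvp.linear_add)

lemma blinear_span: "blinear f \<Longrightarrow> bv.span (f ` S) = f ` bv.span S"
  by (metis bvp.linear_span_image)

lemma bspan_insert: "bv.span (insert a S) = bv.span S \<union> (+) a ` bv.span S"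
proof -
  have "x \<in> bv.span (insert a S) \<longleftrightarrow> x \<in> bv.span S \<or> a + x \<in> bv.span S" for x
  proof -
    have "(\<exists>k. x - bscale k a \<in> bv.span S) \<longleftrightarrow> x \<in> bv.span S \<or> a + x \<in> bv.span S"
    proof -
      have "(\<exists>k. P k) \<longleftrightarrow> P 0 \<or> P 1" for P :: "bit \<Rightarrow> bool"
        by (metis bit.exhaust)
      then show ?thesis by (simp add: add.commute)
    qed
    then show ?thesis by (simp only: bv.span_breakdown_eq)
  qed
  moreover have "x \<in> (+) a ` T \<longleftrightarrow> a + x \<in> T" for x T
  proof
    assume "a + x \<in> T"
    moreover have "x = a + (a + x)" by (simp add: add.assoc[symmetric])
    ultimately show "x \<in> (+) a ` T" by blast
  qed (auto simp: add.assoc[symmetric])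
  ultimately show ?thesis by auto
qed

lemma card_bspan_insert_le:
  assumes "finite (bv.span S)"
  shows "finite (bv.span (insert a S))" "card (bv.span (insert a S)) \<le> 2 * card (bv.span S)"
proof -
  show "finite (bv.span (insert a S))" using assms by (simp add: bspan_insert)
  have "card (bv.span (insert a S)) \<le> card (bv.span S) + card ((+) a ` bv.span S)"
    unfolding bspan_insert by (rule card_Un_le)
  also have "card ((+) a ` bv.span S) \<le> card (bv.span S)" using assms by (rule card_image_le)
  finally show "card (bv.span (insert a S)) \<le> 2 * card (bv.span S)" by simp
qed

lemma card_bspan_le:
  assumes "finite S"
  shows "finite (bv.span S) \<and> card (bv.span S) \<le> 2 ^ card S"
  using assms
proof (induction S)
  case (insert a S)
  then show ?case using card_bspan_insert_le[of S a] by auto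
qed auto

lemmas finite_bspan = card_bspan_le[THEN conjunct1]

lemma independent_of_card_bspan:
  assumes "finite S" "card (bv.span S) \<ge> 2 ^ card S"
  shows "\<not> bv.dependent S"
proof
  assume "bv.dependent S"
  then obtain a where a: "a \<in> S" "a \<in> bv.span (S - {a})" by (auto simp: bv.dependent_def)
  have "bv.span S = bv.span (S - {a})" using a by (metis bv.span_redundant insert_Diff)
  moreover have "card (bv.span (S - {a})) \<le> 2 ^ card (S - {a})"
    using assms(1) by (intro card_bspan_le[THEN conjunct2]) auto
  moreover have "card S = Suc (card (S - {a}))" using a assms(1) by (metis card.remove)
  ultimately have "(2::nat) ^ card (S - {a}) = 0" using assms(2) by (simp only: power_Suc)
  then show False by simp
qed

lemma card_bspan_independent:
  assumes "finite S" "\<not> bv.dependent S"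
  shows "card (bv.span S) = 2 ^ card S"
  using assms
proof (induction S)
  case (insert a S)
  have ind: "\<not> bv.dependent S" and a: "a \<notin> bv.span S"
    using insert.prems insert.hyps bv.independent_insert[of a S] by (simp_all split: if_splits)
  have "x \<notin> bv.span S" if "x \<in> (+) a ` bv.span S" for x
  proof
    assume "x \<in> bv.span S"
    moreover obtain y where "y \<in> bv.span S" "x = a + y"
      using \<open>x \<in> (+) a ` bv.span S\<close> by auto
    ultimately show False using a by (metis bv.span_add_eq2)
  qed
  then have "bv.span S \<inter> (+) a ` bv.span S = {}" by auto
  moreover have "card ((+) a ` bv.span S) = card (bv.span S)" by (intro card_image) (auto simp: inj_on_def)
  ultimately have "card (bv.span (insert a S)) = 2 * card (bv.span S)"
    unfolding bspan_insert using finite_bspan[OF insert.hyps(1)] by (subst card_Un_disjoint) auto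
  then show ?case using insert ind by simp
qed auto

text \<open>Rank plus nullity, written with orders: the fibres are translates of the kernel. Orders
  are used throughout because \<open>cohom_dim\<close> is defined by comparing orders.\<close>

lemma card_blinear_image:
  assumes f: "blinear f" and A: "bv.subspace A" "finite A"
  shows "card A = card (f ` A) * card {x \<in> A. f x = 0}"
proof -
  have fib: "card {x \<in> A. f x = y} = card {x \<in> A. f x = 0}" if y: "y \<in> f ` A" for y
  proof -
    obtain a where a: "a \<in> A" "y = f a" using y by auto
    have "bij_betw ((+) a) {x \<in> A. f x = 0} {x \<in> A. f x = y}"
    proof (rule bij_betwI[where g = "(+) a"])
      show "(+) a \<in> {x \<in> A. f x = 0} \<rightarrow> {x \<in> A. f x = y}"
        using a A(1) by (auto simp: blinear_add[OF f] bv.subspace_add)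
      show "(+) a \<in> {x \<in> A. f x = y} \<rightarrow> {x \<in> A. f x = 0}"
        using a A(1) by (auto simp: blinear_add[OF f] bv.subspace_add)
    qed (simp_all add: add.assoc[symmetric])
    then show ?thesis by (rule bij_betw_same_card[symmetric])
  qed
  have "card A = (\<Sum>y\<in>f ` A. card {x \<in> A. f x = y})"
    using sum.image_gen[OF A(2), of "\<lambda>_. 1 :: nat" f] by simp
  then show ?thesis using fib by simp
qed

section \<open>Functions supported on a set and their standard basis\<close>

definition bsupp :: "'a set \<Rightarrow> ('a \<Rightarrow> bit) set" where
  "bsupp A = {f. \<forall>x. x \<notin> A \<longrightarrow> f x = 0}"

definition bunit :: "'a \<Rightarrow> 'a \<Rightarrow> bit" where
  "bunit x y = of_bool (y = x)"

lemma subspace_bsupp: "bv.subspace (bsupp A)"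
  by (auto simp: bv.subspace_def bsupp_def bscale_def)

lemma sum_fun_apply: "(\<Sum>i\<in>I. f i) x = (\<Sum>i\<in>I. f i x)" for f :: "'i \<Rightarrow> 'a \<Rightarrow> 'b::comm_monoid_add"
  by (induction I rule: infinite_finite_induct) auto

lemma bsupp_sum_bunit:
  assumes "finite A" "f \<in> bsupp A"
  shows "f = (\<Sum>x\<in>A. bscale (f x) (bunit x))"
proof
  fix y
  have "(\<Sum>x\<in>A. bscale (f x) (bunit x)) y = (\<Sum>x\<in>A. f x * of_bool (y = x))"
    by (simp add: sum_fun_apply bscale_def bunit_def)
  also have "\<dots> = (\<Sum>x\<in>A. if y = x then f x else 0)" by (intro sum.cong) auto
  also have "\<dots> = (if y \<in> A then f y else 0)" using assms(1) by (simp add: sum.delta)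
  also have "\<dots> = f y" using assms(2) by (auto simp: bsupp_def)
  finally show "f y = (\<Sum>x\<in>A. bscale (f x) (bunit x)) y" ..
qed

lemma span_bunit:
  assumes "finite A"
  shows "bv.span (bunit ` A) = bsupp A"
proof (rule bv.span_unique)
  show "bunit ` A \<subseteq> bsupp A" by (auto simp: bsupp_def bunit_def)
  show "bv.subspace (bsupp A)" by (rule subspace_bsupp)
  fix T assume T: "bunit ` A \<subseteq> T" "bv.subspace T"
  show "bsupp A \<subseteq> T"
  proof
    fix f assume "f \<in> bsupp A"
    then have "f = (\<Sum>x\<in>A. bscale (f x) (bunit x))" by (rule bsupp_sum_bunit[OF assms])
    also have "\<dots> \<in> T" using T by (intro bv.subspace_sum bv.subspace_scale) auto
    finally show "f \<in> T" .
  qed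
qed

lemma card_bsupp:
  assumes "finite A"
  shows "card (bsupp A) = 2 ^ card A" "finite (bsupp A)"
proof -
  have 1: "bij_betw (\<lambda>S x. of_bool (x \<in> S)) (Pow A) (bsupp A)"
  proof (rule bij_betwI[where g = "\<lambda>f. {x. f x = 1}"])
    show "(\<lambda>S x. of_bool (x \<in> S)) \<in> Pow A \<rightarrow> bsupp A" by (auto simp: bsupp_def)
    show "(\<lambda>f. {x. f x = (1::bit)}) \<in> bsupp A \<rightarrow> Pow A" by (force simp: bsupp_def)
    show "(\<lambda>x. of_bool (x \<in> {x. f x = 1})) = f" if "f \<in> bsupp A" for f :: "'a \<Rightarrow> bit"
    proof
      show "of_bool (x \<in> {x. f x = 1}) = f x" for x by (cases "f x") auto
    qed
  qed auto
  show "card (bsupp A) = 2 ^ card A" using bij_betw_same_card[OF 1] assms by (simp add: card_Pow)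
  show "finite (bsupp A)" using bij_betw_finite[OF 1] assms by simp
qed

text \<open>The points \<open>p i\<close> are coordinates on which the family \<open>a\<close> is the identity matrix.\<close>

lemma card_bspan_of_dual_points:
  assumes I: "finite I" and d: "\<And>i j. i \<in> I \<Longrightarrow> j \<in> I \<Longrightarrow> a i (p j) = of_bool (i = j)"
  shows "card (bv.span (a ` I)) = 2 ^ card I" and "inj_on a I"
proof -
  define L :: "('b \<Rightarrow> bit) \<Rightarrow> 'a \<Rightarrow> bit" where "L f = (\<lambda>i. if i \<in> I then f (p i) else 0)" for f
  have L: "blinear L" by (rule blinearI) (auto simp: L_def fun_eq_iff)
  have La: "L (a i) = bunit i" if "i \<in> I" for i using d that by (auto simp: L_def fun_eq_iff bunit_def)
  then have "L ` a ` I = bunit ` I" by force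
  then have "L ` bv.span (a ` I) = bsupp I" using blinear_span[OF L] span_bunit[OF I] by metis
  then have "card (bsupp I) \<le> card (bv.span (a ` I))"
    using finite_bspan[of "a ` I"] I by (metis card_image_le finite_imageI)
  moreover have "card (bv.span (a ` I)) \<le> 2 ^ card (a ` I)" using I card_bspan_le[of "a ` I"] by simp
  moreover have "(2::nat) ^ card (a ` I) \<le> 2 ^ card I"
    using I by (intro power_increasing) (auto simp: card_image_le)
  ultimately show "card (bv.span (a ` I)) = 2 ^ card I" using card_bsupp(1)[OF I] by linarith
  show "inj_on a I"
  proof (rule inj_onI)
    fix i j assume "i \<in> I" "j \<in> I" "a i = a j"
    then have "bunit i = (bunit j :: 'a \<Rightarrow> bit)" using La by metis
    then show "i = j" by (metis bunit_def of_bool_eq_iff)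
  qed
qed

section \<open>An acyclic matching on lists of sets\<close>

text \<open>The kinds of discrete Morse theory: unmatched, matched with a cell one degree higher,
  matched with a cell one degree lower.\<close>

datatype kind = Crit | Up | Down

abbreviation empties :: "nat set list \<Rightarrow> nat" where
  "empties \<sigma> \<equiv> length (takeWhile (\<lambda>B. B = {}) \<sigma>)"

text \<open>\<open>p\<close> is the last letter of the word read so far; the start value
  \<open>N\<close> bounds nothing, since all letters are below \<open>N\<close>. For an empty block
  \<open>empties \<sigma>\<close> does not count that block itself, so a leading run of odd length
  is \<open>Up\<close> and one of even length is \<open>Down\<close>.\<close>

fun cls :: "nat \<Rightarrow> nat set list \<Rightarrow> kind" where
  "cls p [] = Crit"
| "cls p (B # \<sigma>) =
     (if B = {} then (if even (empties \<sigma>) then Up else Down)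
      else if p < Min B then Down
      else if card B = 1 then cls (Min B) \<sigma>
      else Up)"

fun mu :: "nat set list \<Rightarrow> nat set list" where
  "mu [] = []"
| "mu (B # \<sigma>) =
     (if B = {} then {} # B # \<sigma>
      else if card B = 1 then B # mu \<sigma>
      else {Min B} # (B - {Min B}) # \<sigma>)"

text \<open>
  A cell is a list of blocks. Its longest prefix that is a weakly decreasing word of singletons is
  kept, and the next block decides: a block with at least two elements, whose minimum would continue
  the word, is split into its minimum and the rest, which inverts the merging of the last letter of
  the word with a block of larger elements. Empty blocks, the degenerate cells of the unnormalised
  complex, are matched by the parity of the first run.
\<close>

definition cells :: "nat \<Rightarrow> nat \<Rightarrow> nat set list set" where
  "cells N k = {\<sigma>. length \<sigma> = k \<and> set \<sigma> \<subseteq> Pow {..<N}}"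

definition kcells :: "nat \<Rightarrow> nat \<Rightarrow> kind \<Rightarrow> nat set list set" where
  "kcells N k t = {\<sigma> \<in> cells N k. cls N \<sigma> = t}"

lemma cells_Nil [simp]: "[] \<in> cells N k \<longleftrightarrow> k = 0"
  by (auto simp: cells_def)

lemma cells_Cons: "B # \<sigma> \<in> cells N k \<longleftrightarrow> B \<subseteq> {..<N} \<and> (\<exists>j. k = Suc j \<and> \<sigma> \<in> cells N j)"
  by (auto simp: cells_def)

lemma cells_Cons_Suc [simp]: "B # \<sigma> \<in> cells N (Suc k) \<longleftrightarrow> B \<subseteq> {..<N} \<and> \<sigma> \<in> cells N k"
  by (auto simp: cells_def)

lemma finite_cells [simp]: "finite (cells N k)"
  and card_cells: "card (cells N k) = (2 ^ N) ^ k"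
proof -
  have eq: "cells N k = {\<sigma>. set \<sigma> \<subseteq> Pow {..<N} \<and> length \<sigma> = k}"
    by (auto simp: cells_def)
  show "finite (cells N k)" unfolding eq by (rule finite_lists_length_eq) auto
  show "card (cells N k) = (2 ^ N) ^ k" unfolding eq by (subst card_lists_length_eq) (auto simp: card_Pow)
qed

lemma finite_block: "B \<subseteq> {..<N} \<Longrightarrow> finite (B :: nat set)"
  by (rule finite_subset) auto

lemma card_one_eq: "finite B \<Longrightarrow> card B = 1 \<Longrightarrow> B = {Min (B :: nat set)}"
  by (metis Min_singleton card_1_singletonE One_nat_def)

lemma Min_remove_Min:
  assumes "finite B" "B \<noteq> {}" "card B \<noteq> 1"
  shows "B - {Min B} \<noteq> {}" "Min B < Min (B - {Min (B :: nat set)})"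
proof -
  show ne: "B - {Min B} \<noteq> {}"
  proof
    assume "B - {Min B} = {}"
    then have "B = {Min B}" using assms(2) by blast
    then have "card B = 1" by (metis is_singletonI is_singleton_altdef)
    with assms(3) show False ..
  qed
  then have "Min (B - {Min B}) \<in> B - {Min B}" using assms(1) by (intro Min_in) auto
  then show "Min B < Min (B - {Min B})" using assms(1) by (simp add: order.not_eq_order_implies_strict)
qed

lemma mu_cells:
  "\<sigma> \<in> cells N k \<Longrightarrow> cls p \<sigma> = Up \<Longrightarrow> mu \<sigma> \<in> cells N (Suc k)"
proof (induction \<sigma> arbitrary: p k)
  case (Cons B \<sigma>)
  from Cons.prems obtain j where j: "k = Suc j" "\<sigma> \<in> cells N j" "B \<subseteq> {..<N}"
    by (auto simp: cells_Cons)
  have fin: "finite B" using j(3) by (rule finite_block)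
  show ?case
  proof (cases "B = {} \<or> card B = 1")
    case True
    then show ?thesis using Cons.IH[OF j(2)] Cons.prems j by (auto split: if_splits)
  next
    case False
    then have "Min B \<in> B" using fin by auto
    with False show ?thesis using j by auto
  qed
qed simp

lemma cls_mu: "set \<sigma> \<subseteq> Collect finite \<Longrightarrow> cls p \<sigma> = Up \<Longrightarrow> cls p (mu \<sigma>) = Down"
proof (induction \<sigma> arbitrary: p)
  case (Cons B \<sigma>)
  have fin: "finite B" using Cons.prems by auto
  consider "B = {}" | "B \<noteq> {}" "card B = 1" | "B \<noteq> {}" "card B \<noteq> 1"
    by blast
  then show ?case
  proof cases
    case 3
    let ?l = "Min B"
    have "?l \<le> p" using 3 Cons.prems by (simp split: if_splits del: Min_gr_iff)
    with 3 Min_remove_Min[OF fin 3] show ?thesis by (simp del: Min_gr_iff Min_less_iff)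
  qed (use Cons in \<open>auto split: if_splits\<close>)
qed simp

text \<open>The second alternative is what the induction needs: a block whose minimum exceeds the
  preceding letter \<open>p\<close> has no preimage of its own, but is the rest of a split block,
  and the caller merges it with that letter. For \<open>p = N\<close> this alternative cannot
  occur.\<close>

lemma mu_surj:
  "\<tau> \<in> cells N (Suc k) \<Longrightarrow> cls p \<tau> = Down \<Longrightarrow>
    (\<exists>\<sigma> \<in> cells N k. cls p \<sigma> = Up \<and> mu \<sigma> = \<tau>) \<or> (hd \<tau> \<noteq> {} \<and> p < Min (hd \<tau>))"
proof (induction \<tau> arbitrary: p k)
  case (Cons B \<rho>)
  have B: "B \<subseteq> {..<N}" "\<rho> \<in> cells N k" "finite B"
    using Cons.prems(1) by (auto intro: finite_block)
  show ?case
  proof (cases "B = {}")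
    case True
    then have "odd (empties \<rho>)" using Cons.prems(2) by (auto split: if_splits)
    then obtain \<rho>' where \<rho>': "\<rho> = {} # \<rho>'" by (cases \<rho>) (auto split: if_splits)
    with \<open>odd (empties \<rho>)\<close> B True show ?thesis by (intro disjI1 bexI[of _ \<rho>]) auto
  next
    case ne: False
    show ?thesis
    proof (cases "p < Min B")
      case False
      then have c1: "card B = 1" and D: "cls (Min B) \<rho> = Down"
        using ne Cons.prems(2) by (auto split: if_splits)
      have Bs: "B = {Min B}" using c1 B(3) by (simp add: card_one_eq)
      obtain j where j: "k = Suc j" using D B(2) by (cases k; cases \<rho>) (auto simp: cells_def)
      from Cons.IH[of j "Min B"] B(2) D j
      consider \<sigma> where "\<sigma> \<in> cells N j" "cls (Min B) \<sigma> = Up" "mu \<sigma> = \<rho>"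
        | "hd \<rho> \<noteq> {}" "Min B < Min (hd \<rho>)"
        by auto
      then show ?thesis
      proof cases
        case 1
        then show ?thesis using B c1 ne False j by (intro disjI1 bexI[of _ "B # \<sigma>"]) auto
      next
        case 2
        obtain C \<rho>' where \<rho>: "\<rho> = C # \<rho>'" using D by (cases \<rho>) auto
        let ?l = "Min B"
        have C: "C \<noteq> {}" "finite C" "C \<subseteq> {..<N}" "?l < Min C" "\<rho>' \<in> cells N j"
          using 2 B(2) \<rho> j by (auto intro: finite_block)
        have lC: "?l \<notin> C" using C by auto
        have mn: "Min (insert ?l C) = ?l" using C by (auto simp: Min_insert)
        have cd: "card (insert ?l C) \<noteq> 1" using C lC by (auto simp: card_eq_0_iff)
        have "mu (insert ?l C # \<rho>') = {?l} # C # \<rho>'" using mn cd lC by simp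
        also have "\<dots> = B # \<rho>" using Bs \<rho> by simp
        finally have "mu (insert ?l C # \<rho>') = B # \<rho>" .
        moreover have "cls p (insert ?l C # \<rho>') = Up" using mn cd False by simp
        moreover have "insert ?l C # \<rho>' \<in> cells N k" using C B Bs j by (auto simp: cells_Cons)
        ultimately show ?thesis by blast
      qed
    qed (use ne in simp)
  qed
qed simp

text \<open>This separates the two nonempty cases of \<open>mu\<close>: after a kept letter the
  image continues with a block that is empty or has minimum at most that letter, whereas splitting a
  block leaves a rest with larger minimum.\<close>

lemma hd_mu: "cls p \<sigma> = Up \<Longrightarrow> set \<sigma> \<subseteq> Collect finite \<Longrightarrow>
    \<exists>B \<rho>. mu \<sigma> = B # \<rho> \<and> (B = {} \<or> Min B \<le> p)"
  by (cases \<sigma>) (auto simp del: Min_gr_iff split: if_splits)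

lemma mu_inj:
  "cls p \<sigma> = Up \<Longrightarrow> cls p \<sigma>' = Up \<Longrightarrow> set \<sigma> \<subseteq> Collect finite \<Longrightarrow> set \<sigma>' \<subseteq> Collect finite \<Longrightarrow>
    mu \<sigma> = mu \<sigma>' \<Longrightarrow> \<sigma> = \<sigma>'"
proof (induction \<sigma> arbitrary: \<sigma>' p)
  case (Cons B \<rho>)
  obtain B' \<rho>' where \<sigma>': "\<sigma>' = B' # \<rho>'" using Cons.prems(2) by (cases \<sigma>') auto
  have fin: "finite B" "finite B'" using Cons.prems \<sigma>' by auto
  have split_single: False
    if X: "finite X" "X \<noteq> {}" "card X \<noteq> 1" and Y: "finite Y" "card Y = 1" "cls (Min Y) \<tau> = Up"
      "set \<tau> \<subseteq> Collect finite" and eq: "{Min X} # (X - {Min X}) # \<upsilon> = Y # mu \<tau>"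
    for X Y :: "nat set" and \<tau> \<upsilon>
  proof -
    have "Min X < Min (X - {Min X})" using Min_remove_Min[OF X] by simp
    moreover have "Min Y = Min X" using eq by auto
    moreover obtain C \<nu> where "mu \<tau> = C # \<nu>" "C = {} \<or> Min C \<le> Min Y"
      using hd_mu[OF Y(3,4)] by blast
    ultimately show False
      using eq Min_remove_Min(1)[OF X] by (auto simp del: Min_gr_iff Min_less_iff Min_le_iff)
  qed
  show ?case
  proof (cases "B = {} \<or> B' = {}")
    case True
    then show ?thesis using Cons.prems \<sigma>' fin by (auto split: if_splits)
  next
    case False
    consider "card B = 1" "card B' = 1" | "card B \<noteq> 1" "card B' \<noteq> 1"
      | "card B = 1" "card B' \<noteq> 1" | "card B \<noteq> 1" "card B' = 1"
      by blast
    then show ?thesis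
    proof cases
      case 1
      then have "B = B'" "mu \<rho> = mu \<rho>'" "cls (Min B) \<rho> = Up" "cls (Min B') \<rho>' = Up"
        using False Cons.prems \<sigma>' by (auto split: if_splits)
      then show ?thesis using Cons.IH[of "Min B" \<rho>'] Cons.prems \<sigma>' by auto
    next
      case 2
      then have "Min B = Min B'" "B - {Min B} = B' - {Min B'}" "\<rho> = \<rho>'"
        using False Cons.prems(5) \<sigma>' by auto
      moreover have "Min B \<in> B" "Min B' \<in> B'" using False fin by auto
      ultimately show ?thesis using \<sigma>' by (metis insert_Diff)
    next
      case 3
      have eq: "{Min B'} # (B' - {Min B'}) # \<rho>' = B # mu \<rho>"
        using 3 False Cons.prems(5) \<sigma>' by simp
      have up: "cls (Min B) \<rho> = Up"
        using 3 False Cons.prems(1) by (simp split: if_splits del: Min_gr_iff)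
      have False using split_single[OF fin(2) _ 3(2) fin(1) 3(1) up _ eq] False Cons.prems(3) by simp
      then show ?thesis ..
    next
      case 4
      have eq: "{Min B} # (B - {Min B}) # \<rho> = B' # mu \<rho>'"
        using 4 False Cons.prems(5) unfolding \<sigma>' by (auto simp del: One_nat_def)
      have up: "cls (Min B') \<rho>' = Up"
        using 4 False Cons.prems(2) \<sigma>' by (simp split: if_splits del: Min_gr_iff)
      have False
        using split_single[OF fin(1) _ 4(1) fin(2) 4(2) up _ eq] False Cons.prems(4) \<sigma>' by simp
      then show ?thesis ..
    qed
  qed
qed simp

lemma cells_finite_blocks: "\<sigma> \<in> cells N k \<Longrightarrow> set \<sigma> \<subseteq> Collect finite"
  unfolding cells_def using finite_block by blast

lemma mu_bij: "bij_betw mu (kcells N k Up) (kcells N (Suc k) Down)"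
proof (rule bij_betw_imageI)
  show "inj_on mu (kcells N k Up)"
  proof (rule inj_onI)
    fix \<sigma> \<sigma>' assume "\<sigma> \<in> kcells N k Up" "\<sigma>' \<in> kcells N k Up" "mu \<sigma> = mu \<sigma>'"
    then show "\<sigma> = \<sigma>'"
      using mu_inj[of N \<sigma> \<sigma>'] cells_finite_blocks[of _ N k] by (simp add: kcells_def)
  qed
  show "mu ` kcells N k Up = kcells N (Suc k) Down"
  proof
    show "mu ` kcells N k Up \<subseteq> kcells N (Suc k) Down"
      using mu_cells cls_mu cells_finite_blocks unfolding kcells_def by blast
    show "kcells N (Suc k) Down \<subseteq> mu ` kcells N k Up"
    proof
      fix \<tau> assume \<tau>: "\<tau> \<in> kcells N (Suc k) Down"
      have "Min (hd \<tau>) < N" if "hd \<tau> \<noteq> {}"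
      proof -
        have "hd \<tau> \<subseteq> {..<N}" using \<tau> by (cases \<tau>) (auto simp: kcells_def cells_def)
        then show ?thesis using that by (metis Min_in finite_block lessThan_iff subsetD)
      qed
      then show "\<tau> \<in> mu ` kcells N k Up"
        using mu_surj[of \<tau> N k N] \<tau> by (force simp: kcells_def)
    qed
  qed
qed

lemma card_cells_kinds:
  "card (kcells N (Suc k) Crit) + card (kcells N (Suc k) Up) + card (kcells N k Up) = card (cells N (Suc k))"
proof -
  have "cells N (Suc k) = kcells N (Suc k) Crit \<union> kcells N (Suc k) Up \<union> kcells N (Suc k) Down"
    by (auto simp: kcells_def intro: kind.exhaust)
  moreover have "finite (kcells N j t)" for j t by (simp add: kcells_def)
  moreover have "card (kcells N k Up) = card (kcells N (Suc k) Down)" by (rule bij_betw_same_card[OF mu_bij])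
  moreover have "kcells N (Suc k) Crit \<inter> kcells N (Suc k) Up = {}"
    "(kcells N (Suc k) Crit \<union> kcells N (Suc k) Up) \<inter> kcells N (Suc k) Down = {}"
    by (auto simp: kcells_def)
  ultimately show ?thesis by (simp add: card_Un_disjoint)
qed

lemma Crit_cell_iff:
  "\<sigma> \<in> cells N k \<Longrightarrow> cls p \<sigma> = Crit \<longleftrightarrow>
     (\<exists>u. \<sigma> = map (\<lambda>v. {v}) u \<and> sorted_wrt (\<ge>) (p # u))"
proof (induction \<sigma> arbitrary: p k)
  case (Cons B \<sigma>)
  then obtain j where j: "\<sigma> \<in> cells N j" "B \<subseteq> {..<N}" by (auto simp: cells_Cons)
  have fin: "finite B" using j(2) by (rule finite_block)
  have "cls p (B # \<sigma>) = Crit \<longleftrightarrow> (\<exists>v. B = {v} \<and> v \<le> p \<and> cls v \<sigma> = Crit)"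
  proof (cases "B \<noteq> {} \<and> card B = 1")
    case True
    then obtain v where "B = {v}" by (auto simp: card_1_singleton_iff)
    then show ?thesis by auto
  qed auto
  also have "\<dots> \<longleftrightarrow> (\<exists>u. B # \<sigma> = map (\<lambda>v. {v}) u \<and> sorted_wrt (\<ge>) (p # u))"
  proof
    assume "\<exists>v. B = {v} \<and> v \<le> p \<and> cls v \<sigma> = Crit"
    then obtain v u where "B = {v}" "v \<le> p" "\<sigma> = map (\<lambda>v. {v}) u" "sorted_wrt (\<ge>) (v # u)"
      using Cons.IH[OF j(1)] by blast
    then show "\<exists>u. B # \<sigma> = map (\<lambda>v. {v}) u \<and> sorted_wrt (\<ge>) (p # u)"
      by (intro exI[of _ "v # u"]) auto
  next
    assume "\<exists>u. B # \<sigma> = map (\<lambda>v. {v}) u \<and> sorted_wrt (\<ge>) (p # u)"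
    then obtain v u where "B = {v}" "v \<le> p" "\<sigma> = map (\<lambda>v. {v}) u" "sorted_wrt (\<ge>) (v # u)"
      by (auto simp: Cons_eq_map_conv)
    then show "\<exists>v. B = {v} \<and> v \<le> p \<and> cls v \<sigma> = Crit"
      using Cons.IH[OF j(1)] by blast
  qed
  finally show ?case .
qed simp

text \<open>The lexicographic order by reversed minima, coded in base \<open>N + 1\<close>.\<close>

fun enc :: "nat \<Rightarrow> nat set list \<Rightarrow> nat" where
  "enc N [] = 0"
| "enc N (B # \<sigma>) = (if B = {} then 0 else N - Min B) * (N + 1) ^ length \<sigma> + enc N \<sigma>"

lemma enc_less: "enc N \<sigma> < (N + 1) ^ length \<sigma>"
proof (induction \<sigma>)
  case (Cons B \<sigma>)
  let ?d = "if B = {} then 0 else N - Min B"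
  have "?d * (N + 1) ^ length \<sigma> \<le> N * (N + 1) ^ length \<sigma>" by (intro mult_right_mono) auto
  then have "enc N (B # \<sigma>) < N * (N + 1) ^ length \<sigma> + (N + 1) ^ length \<sigma>"
    using Cons unfolding enc.simps by linarith
  then show ?case by (simp add: algebra_simps)
qed simp

lemma enc_Cons_less:
  assumes "A \<noteq> {}" "B \<noteq> {}" "Min B < Min A" "Min A < N" "length \<sigma> = length \<tau>"
  shows "enc N (A # \<sigma>) < enc N (B # \<tau>)"
proof -
  have "enc N (A # \<sigma>) < (N - Min A) * (N + 1) ^ length \<sigma> + (N + 1) ^ length \<sigma>"
    using assms(1) enc_less[of N \<sigma>] by simp
  also have "\<dots> = Suc (N - Min A) * (N + 1) ^ length \<tau>" by (simp add: assms(5))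
  also have "\<dots> \<le> (N - Min B) * (N + 1) ^ length \<tau>"
    using assms(3,4) by (intro mult_right_mono) auto
  also have "\<dots> \<le> enc N (B # \<tau>)" using assms(2) by simp
  finally show ?thesis .
qed

text \<open>The coordinates from \<open>n\<close> on are the z_v, those below \<open>n\<close> are
  the x_i.\<close>

definition zw :: "nat \<Rightarrow> nat set \<Rightarrow> nat" where
  "zw n B = card (B \<inter> {n..})"

definition wt :: "nat \<Rightarrow> nat set list \<Rightarrow> nat" where
  "wt n \<sigma> = (\<Sum>B\<leftarrow>\<sigma>. zw n B)"

lemma wt_simps [simp]: "wt n [] = 0" "wt n (B # \<sigma>) = zw n B + wt n \<sigma>"
  by (simp_all add: wt_def)

section \<open>Inhomogeneous cochains and the Leibniz rule\<close>

lemma bit_mult_eq_1_iff [simp]: "a * b = (1 :: bit) \<longleftrightarrow> a = 1 \<and> b = 1"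
  by (cases a; cases b) auto

lemma coboundary_0: "coboundary G 0 f = 0"
  by (auto simp: coboundary_def fun_eq_iff length_Suc_conv)

lemma blinear_coboundary: "blinear (coboundary G k)"
  by (rule blinearI) (auto simp: coboundary_def fun_eq_iff sum.distrib)

lemma coboundary_outside:
  "\<not> (length gs = Suc k \<and> set gs \<subseteq> carrier G) \<Longrightarrow> coboundary G k f gs = 0"
  by (auto simp: coboundary_def)

text \<open>A recursion on the first argument, on which all later inductions rest. The summand
  \<open>f (g # gs)\<close> cancels the first face of the smaller coboundary, which is not a face of
  the larger one.\<close>

lemma coboundary_Suc:
  assumes "length gs = k" "g \<in> carrier G" "h \<in> carrier G" "set gs \<subseteq> carrier G"
  shows "coboundary G (Suc k) f (g # h # gs) =
    f (h # gs) + f ((g \<otimes>\<^bsub>G\<^esub> h) # gs) + f (g # gs) + coboundary G k (\<lambda>x. f (g # x)) (h # gs)"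
  using assms by (simp add: coboundary_def sum.lessThan_Suc_shift ac_simps del: sum.lessThan_Suc)

lemma coboundary_cong:
  assumes "\<And>gs. length gs = k \<Longrightarrow> set gs \<subseteq> carrier G \<Longrightarrow> f gs = f' gs"
    and "\<And>x y. x \<in> carrier G \<Longrightarrow> y \<in> carrier G \<Longrightarrow> x \<otimes>\<^bsub>G\<^esub> y \<in> carrier G"
  shows "coboundary G k f = coboundary G k f'"
proof
  fix gs
  show "coboundary G k f gs = coboundary G k f' gs"
  proof (cases "length gs = Suc k \<and> set gs \<subseteq> carrier G")
    case True
    have "f (take i gs @ [gs ! i \<otimes>\<^bsub>G\<^esub> gs ! Suc i] @ drop (Suc (Suc i)) gs) =
        f' (take i gs @ [gs ! i \<otimes>\<^bsub>G\<^esub> gs ! Suc i] @ drop (Suc (Suc i)) gs)" if "i < k" for i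
    proof (rule assms(1))
      show "set (take i gs @ [gs ! i \<otimes>\<^bsub>G\<^esub> gs ! Suc i] @ drop (Suc (Suc i)) gs) \<subseteq> carrier G"
        using True that nth_mem[of i gs] nth_mem[of "Suc i" gs] set_take_subset[of i gs]
          set_drop_subset[of "Suc (Suc i)" gs]
        by (auto intro!: assms(2))
    qed (use True that in auto)
    moreover have "f (tl gs) = f' (tl gs)"
      using True by (intro assms(1)) (auto dest: list.set_sel(2)[rotated])
    moreover have "f (take k gs) = f' (take k gs)" using True by (intro assms(1)) (auto dest: in_set_takeD)
    ultimately show ?thesis using True by (simp add: coboundary_def)
  qed (simp add: coboundary_outside)
qed

lemma coboundary_coboundary:
  assumes closed: "\<And>x y. x \<in> carrier G \<Longrightarrow> y \<in> carrier G \<Longrightarrow> x \<otimes>\<^bsub>G\<^esub> y \<in> carrier G"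
    and assoc: "\<And>x y z. x \<in> carrier G \<Longrightarrow> y \<in> carrier G \<Longrightarrow> z \<in> carrier G \<Longrightarrow>
      (x \<otimes>\<^bsub>G\<^esub> y) \<otimes>\<^bsub>G\<^esub> z = x \<otimes>\<^bsub>G\<^esub> (y \<otimes>\<^bsub>G\<^esub> z)"
  shows "coboundary G (Suc k) (coboundary G k f) = 0"
proof (induction k arbitrary: f)
  case 0
  show ?case unfolding coboundary_0 by (rule bvp.linear_0[OF blinear_coboundary])
next
  case (Suc k)
  define E where "E = coboundary G (Suc k) f"
  have "coboundary G (Suc (Suc k)) E gs = 0" for gs
  proof (cases "length gs = Suc (Suc (Suc k)) \<and> set gs \<subseteq> carrier G")
    case True
    then obtain g h l xs where gs: "gs = g # h # l # xs" by (auto simp: length_Suc_conv)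
    with True have len: "length xs = k"
      and mem: "g \<in> carrier G" "h \<in> carrier G" "l \<in> carrier G" "set xs \<subseteq> carrier G"
      by auto
    \<comment> \<open>\<open>P g\<close> collects the two middle summands of the recursion, so
      \<open>E (g # _)\<close> is \<open>f + P g\<close> plus the coboundary of
      \<open>f (g # _)\<close>, and the induction hypothesis kills the coboundary of the last
      term.\<close>
    define P where "P x y = (case y of [] \<Rightarrow> 0 | a # z \<Rightarrow> f ((x \<otimes>\<^bsub>G\<^esub> a) # z) + f (x # z))" for x y
    have Eg: "coboundary G (Suc k) (\<lambda>x. E (g # x)) =
        coboundary G (Suc k) (f + P g + coboundary G k (\<lambda>x. f (g # x)))"
    proof (rule coboundary_cong)
      fix ys assume ys: "length ys = Suc k" "set ys \<subseteq> carrier G"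
      then obtain a zs where "ys = a # zs" by (auto simp: length_Suc_conv)
      with ys show "E (g # ys) = (f + P g + coboundary G k (\<lambda>x. f (g # x))) ys"
        using mem by (simp add: E_def coboundary_Suc P_def ac_simps)
    qed (rule closed)
    have Pg: "coboundary G k (\<lambda>x. P g (h # x)) (l # xs) =
      coboundary G k (\<lambda>x. f ((g \<otimes>\<^bsub>G\<^esub> h) # x)) (l # xs) + coboundary G k (\<lambda>x. f (g # x)) (l # xs)"
    proof -
      have "(\<lambda>x. P g (h # x)) = (\<lambda>x. f ((g \<otimes>\<^bsub>G\<^esub> h) # x)) + (\<lambda>x. f (g # x))"
        by (auto simp: P_def fun_eq_iff)
      then show ?thesis by (simp add: blinear_add[OF blinear_coboundary])
    qed
    have "coboundary G (Suc k) (\<lambda>x. E (g # x)) (h # l # xs) =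
        E (h # l # xs) + coboundary G (Suc k) (P g) (h # l # xs)"
      unfolding Eg by (simp add: blinear_add[OF blinear_coboundary] Suc.IH E_def)
    moreover have "coboundary G (Suc k) (P g) (h # l # xs) =
        P g (l # xs) + P g ((h \<otimes>\<^bsub>G\<^esub> l) # xs) + P g (h # xs) +
        (coboundary G k (\<lambda>x. f ((g \<otimes>\<^bsub>G\<^esub> h) # x)) (l # xs) + coboundary G k (\<lambda>x. f (g # x)) (l # xs))"
      unfolding Pg[symmetric] using len mem by (intro coboundary_Suc)
    moreover have "coboundary G (Suc (Suc k)) E (g # h # l # xs) =
        E (h # l # xs) + E ((g \<otimes>\<^bsub>G\<^esub> h) # l # xs) + E (g # l # xs)
        + coboundary G (Suc k) (\<lambda>x. E (g # x)) (h # l # xs)"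
      using len mem by (intro coboundary_Suc) auto
    moreover have "E ((g \<otimes>\<^bsub>G\<^esub> h) # l # xs) = f (l # xs) + f ((g \<otimes>\<^bsub>G\<^esub> (h \<otimes>\<^bsub>G\<^esub> l)) # xs)
        + f ((g \<otimes>\<^bsub>G\<^esub> h) # xs) + coboundary G k (\<lambda>x. f ((g \<otimes>\<^bsub>G\<^esub> h) # x)) (l # xs)"
      using len mem closed by (simp add: E_def coboundary_Suc assoc)
    moreover have "E (g # l # xs) = f (l # xs) + f ((g \<otimes>\<^bsub>G\<^esub> l) # xs)
        + f (g # xs) + coboundary G k (\<lambda>x. f (g # x)) (l # xs)"
      using len mem by (simp add: E_def coboundary_Suc)
    ultimately show ?thesis unfolding gs by (simp add: P_def ac_simps)
  qed (simp add: coboundary_outside)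
  then show ?case by (auto simp: E_def fun_eq_iff)
qed

definition tuples :: "('a, 'b) monoid_scheme \<Rightarrow> nat \<Rightarrow> 'a list set" where
  "tuples G k = {gs. length gs = k \<and> set gs \<subseteq> carrier G}"

lemma cochains_eq_bsupp: "cochains G k = bsupp (tuples G k)"
  unfolding cochains_def bsupp_def tuples_def by (intro Collect_cong) blast

lemma finite_tuples: "finite (carrier G) \<Longrightarrow> finite (tuples G k)"
  and card_tuples: "finite (carrier G) \<Longrightarrow> card (tuples G k) = card (carrier G) ^ k"
proof -
  have eq: "tuples G k = {gs. set gs \<subseteq> carrier G \<and> length gs = k}" by (auto simp: tuples_def)
  show "finite (carrier G) \<Longrightarrow> finite (tuples G k)"
    unfolding eq by (rule finite_lists_length_eq)
  show "finite (carrier G) \<Longrightarrow> card (tuples G k) = card (carrier G) ^ k"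
    unfolding eq by (rule card_lists_length_eq)
qed

lemma coboundary_cochains: "coboundary G k f \<in> cochains G (Suc k)"
  by (auto simp: cochains_def coboundary_def)

section \<open>Monomial cochains\<close>

text \<open>\<open>c g\<close> is the set of coordinates of \<open>g\<close> that equal 1, so
  subsets of \<open>{..<N}\<close> describe group elements as well as square-free monomials. By
  \<open>quad_bij\<close> the extension classes are exactly the quadratic monomials in the x_i, each
  once.\<close>

locale coordinates =
  fixes G :: "('a, 'b) monoid_scheme" (structure)
    and c :: "'a \<Rightarrow> nat set" and n N :: nat and \<alpha> \<beta> :: "nat \<Rightarrow> nat"
  assumes closed: "x \<in> carrier G \<Longrightarrow> y \<in> carrier G \<Longrightarrow> x \<otimes> y \<in> carrier G"
    and assoc: "x \<in> carrier G \<Longrightarrow> y \<in> carrier G \<Longrightarrow> z \<in> carrier G \<Longrightarrow> (x \<otimes> y) \<otimes> z = x \<otimes> (y \<otimes> z)"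
    and coord_bij: "bij_betw c (carrier G) (Pow {..<N})"
    and n_le_N: "n \<le> N"
    and coord_x: "x \<in> carrier G \<Longrightarrow> y \<in> carrier G \<Longrightarrow> v < n \<Longrightarrow>
          v \<in> c (x \<otimes> y) \<longleftrightarrow> ((v \<in> c x) \<noteq> (v \<in> c y))"
    and coord_z: "x \<in> carrier G \<Longrightarrow> y \<in> carrier G \<Longrightarrow> n \<le> v \<Longrightarrow> v < N \<Longrightarrow>
          v \<in> c (x \<otimes> y) \<longleftrightarrow> (((v \<in> c x) \<noteq> (v \<in> c y)) \<noteq> (\<alpha> v \<in> c x \<and> \<beta> v \<in> c y))"
    and quad_bij: "bij_betw (\<lambda>v. {#\<alpha> v, \<beta> v#}) {n..<N} (multisets_of_size {..<n} 2)"
begin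

lemma quad_less: "n \<le> v \<Longrightarrow> v < N \<Longrightarrow> \<alpha> v < n \<and> \<beta> v < n"
proof -
  assume "n \<le> v" "v < N"
  then have "{#\<alpha> v, \<beta> v#} \<in> multisets_of_size {..<n} 2" using bij_betwE[OF quad_bij] by auto
  then show ?thesis by (auto simp: multisets_of_size_def)
qed

definition mon :: "nat set \<Rightarrow> 'a \<Rightarrow> bit" where
  "mon S g = of_bool (S \<subseteq> c g)"

text \<open>The cup product with the one-cochain \<open>mon S\<close> on the left;
  \<open>ext2\<close> is the same for a two-cochain \<open>b\<close>.\<close>

definition ext :: "nat set \<Rightarrow> ('a list \<Rightarrow> bit) \<Rightarrow> 'a list \<Rightarrow> bit" where
  "ext S f gs = (case gs of [] \<Rightarrow> 0 | g # hs \<Rightarrow> if g \<in> carrier G then mon S g * f hs else 0)"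

definition ext2 :: "('a \<times> 'a \<Rightarrow> bit) \<Rightarrow> ('a list \<Rightarrow> bit) \<Rightarrow> 'a list \<Rightarrow> bit" where
  "ext2 b f gs = (case gs of g # h # hs \<Rightarrow> if g \<in> carrier G \<and> h \<in> carrier G then b (g, h) * f hs else 0 | _ \<Rightarrow> 0)"

definition mon2 :: "nat set \<Rightarrow> nat set \<Rightarrow> 'a \<times> 'a \<Rightarrow> bit" where
  "mon2 A B p = (if fst p \<in> carrier G \<and> snd p \<in> carrier G then mon A (fst p) * mon B (snd p) else 0)"

definition dmon :: "nat set \<Rightarrow> 'a \<times> 'a \<Rightarrow> bit" where
  "dmon S p = (if fst p \<in> carrier G \<and> snd p \<in> carrier G
     then mon S (fst p \<otimes> snd p) + mon S (fst p) + mon S (snd p) else 0)"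

fun mono :: "nat set list \<Rightarrow> 'a list \<Rightarrow> bit" where
  "mono [] = (\<lambda>gs. of_bool (gs = []))"
| "mono (S # \<sigma>) = ext S (mono \<sigma>)"

abbreviation d :: "nat \<Rightarrow> ('a list \<Rightarrow> bit) \<Rightarrow> 'a list \<Rightarrow> bit" where
  "d \<equiv> coboundary G"

lemma ext_simps [simp]:
  "ext S f [] = 0" "g \<in> carrier G \<Longrightarrow> ext S f (g # gs) = mon S g * f gs"
  "g \<notin> carrier G \<Longrightarrow> ext S f (g # gs) = 0"
  by (auto simp: ext_def)

lemma ext2_simps [simp]:
  "g \<in> carrier G \<Longrightarrow> h \<in> carrier G \<Longrightarrow> ext2 b f (g # h # gs) = b (g, h) * f gs"
  by (auto simp: ext2_def)

lemma blinear_ext: "blinear (ext S)"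
  by (rule blinearI) (auto simp: ext_def fun_eq_iff distrib_left split: list.splits)

lemma blinear_ext2: "blinear (\<lambda>b. ext2 b f)"
  by (rule blinearI) (auto simp: ext2_def fun_eq_iff distrib_right split: list.splits)

lemma ext_cochains: "f \<in> cochains G k \<Longrightarrow> ext S f \<in> cochains G (Suc k)"
  by (auto simp: cochains_def ext_def split: list.splits if_splits)

lemma mono_cochains: "length \<sigma> = k \<Longrightarrow> mono \<sigma> \<in> cochains G k"
proof (induction \<sigma> arbitrary: k)
  case Nil
  then show ?case by (auto simp: cochains_def)
next
  case (Cons S \<sigma>)
  then show ?case using ext_cochains by auto
qed

text \<open>The Leibniz rule for a cup product, where \<open>dmon S\<close> is the coboundary of the
  one-cochain \<open>mon S\<close>.\<close>

lemma d_ext: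
  assumes f: "f \<in> cochains G k"
  shows "d (Suc k) (ext S f) = ext2 (dmon S) f + ext S (d k f)"
proof
  fix gs
  show "d (Suc k) (ext S f) gs = (ext2 (dmon S) f + ext S (d k f)) gs"
  proof (cases "length gs = Suc (Suc k) \<and> set gs \<subseteq> carrier G")
    case True
    then obtain g h hs where gs: "gs = g # h # hs" by (auto simp: length_Suc_conv)
    with True have mem: "length hs = k" "g \<in> carrier G" "h \<in> carrier G" "set hs \<subseteq> carrier G"
      by auto
    have eq: "(\<lambda>x. ext S f (g # x)) = bscale (mon S g) f" using mem by (auto simp: bscale_def)
    have "d k (bscale (mon S g) f) = bscale (mon S g) (d k f)"
      by (rule bvp.linear_scale[OF blinear_coboundary])
    then show ?thesis
      using mem closed by (simp add: gs coboundary_Suc eq dmon_def bscale_def algebra_simps)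
  next
    case False
    have "ext2 (dmon S) f gs = 0"
    proof (rule ccontr)
      assume "ext2 (dmon S) f gs \<noteq> 0"
      then obtain g h hs where "gs = g # h # hs" "g \<in> carrier G" "h \<in> carrier G" "f hs = 1"
        by (auto simp: ext2_def split: list.splits if_splits)
      then show False using f False by (auto simp: cochains_def)
    qed
    moreover have "ext S (d k f) gs = 0"
      using ext_cochains[OF coboundary_cochains[of G k f], of S] False
      unfolding cochains_def by blast
    ultimately show ?thesis using False by (simp add: coboundary_outside)
  qed
qed

lemma mon_insert: "mon (insert v S) g = mon {v} g * mon S g"
  by (auto simp: mon_def)

lemma mon_empty [simp]: "mon {} g = 1"
  by (simp add: mon_def)

lemma ext2_mon2: "ext2 (mon2 A B) (mono \<sigma>) = mono (A # B # \<sigma>)"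
  by (auto simp: ext2_def mon2_def ext_def fun_eq_iff mult.assoc split: list.splits)

text \<open>The constant 1 has coboundary 1 + 1 + 1 = 1. So degenerate cells do not drop out by
  themselves, and the parity of a run of empty blocks decides whether it is lengthened.\<close>

lemma dmon_empty: "dmon {} = mon2 {} {}"
  by (auto simp: dmon_def mon2_def fun_eq_iff)

section \<open>Monomials evaluated at a product of group elements\<close>

definition cross :: "nat \<Rightarrow> 'a \<times> 'a \<Rightarrow> bit" where
  "cross v p = (if n \<le> v then mon {\<alpha> v} (fst p) * mon {\<beta> v} (snd p) else 0)"

lemma mon_single_mult:
  assumes "g \<in> carrier G" "h \<in> carrier G" "v < N"
  shows "mon {v} (g \<otimes> h) = mon {v} g + mon {v} h + cross v (g, h)"
  using coord_x[OF assms(1,2), of v] coord_z[OF assms(1,2), of v] assms(3)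
  by (auto simp: mon_def cross_def not_le)

lemma dmon_single:
  assumes "v < N"
  shows "dmon {v} = (if n \<le> v then mon2 {\<alpha> v} {\<beta> v} else 0)"
  using mon_single_mult assms
  by (auto simp: fun_eq_iff dmon_def mon2_def cross_def ac_simps)

lemma zw_insert_le: "zw n (insert v A) \<le> (if n \<le> v then 1 else 0) + zw n A"
proof (cases "n \<le> v")
  case True
  then have "insert v A \<inter> {n..} = insert v (A \<inter> {n..})" by auto
  then show ?thesis using True by (simp add: zw_def card_insert_le_m1)
next
  case False
  then have "insert v A \<inter> {n..} = A \<inter> {n..}" by auto
  then show ?thesis using False by (simp add: zw_def)
qed

lemma zw_insert: "finite A \<Longrightarrow> v \<notin> A \<Longrightarrow> zw n (insert v A) = (if n \<le> v then 1 else 0) + zw n A"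
proof (cases "n \<le> v")
  case True
  assume "finite A" "v \<notin> A"
  moreover have "insert v A \<inter> {n..} = insert v (A \<inter> {n..})" using True by auto
  ultimately show ?thesis using True by (simp add: zw_def)
next
  case False
  then have "insert v A \<inter> {n..} = A \<inter> {n..}" by auto
  then show ?thesis using False by (simp add: zw_def)
qed

lemma zw_Diff: "finite S \<Longrightarrow> A \<subseteq> S \<Longrightarrow> zw n A + zw n (S - A) = zw n S"
proof -
  assume "finite S" "A \<subseteq> S"
  then have "card (A \<inter> {n..} \<union> (S - A) \<inter> {n..}) = zw n A + zw n (S - A)"
    unfolding zw_def by (intro card_Un_disjoint) (auto intro: finite_subset)
  moreover have "A \<inter> {n..} \<union> (S - A) \<inter> {n..} = S \<inter> {n..}"
    using \<open>A \<subseteq> S\<close> by auto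
  ultimately show ?thesis by (simp add: zw_def)
qed

definition lower2 :: "nat \<Rightarrow> ('a \<times> 'a \<Rightarrow> bit) set" where
  "lower2 w = bv.span {mon2 A B | A B. A \<subseteq> {..<N} \<and> B \<subseteq> {..<N} \<and> zw n A + zw n B < w}"

definition mulbit :: "('c \<Rightarrow> bit) \<Rightarrow> ('c \<Rightarrow> bit) \<Rightarrow> 'c \<Rightarrow> bit" where
  "mulbit \<phi> b = (\<lambda>p. \<phi> p * b p)"

lemma blinear_mulbit: "blinear (mulbit \<phi>)"
  by (rule blinearI) (auto simp: mulbit_def fun_eq_iff distrib_left)

lemma mon2_insert_left: "mulbit (\<lambda>p. mon {v} (fst p)) (mon2 A B) = mon2 (insert v A) B"
  by (auto simp: mulbit_def mon2_def fun_eq_iff mon_insert[of v A] mult.assoc)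

lemma mon2_insert_right: "mulbit (\<lambda>p. mon {v} (snd p)) (mon2 A B) = mon2 A (insert v B)"
  by (auto simp: mulbit_def mon2_def fun_eq_iff mon_insert[of v B] ac_simps)

lemma lower2_mono: "w \<le> w' \<Longrightarrow> lower2 w \<subseteq> lower2 w'"
  unfolding lower2_def by (intro bv.span_mono) force

lemma lower2_mulbit:
  assumes v: "v < N" and b: "b \<in> lower2 w"
  shows "mulbit (\<lambda>p. mon {v} (fst p)) b \<in> lower2 ((if n \<le> v then 1 else 0) + w)"
    and "mulbit (\<lambda>p. mon {v} (snd p)) b \<in> lower2 ((if n \<le> v then 1 else 0) + w)"
proof -
  let ?X = "{mon2 A B | A B. A \<subseteq> {..<N} \<and> B \<subseteq> {..<N} \<and> zw n A + zw n B < w}"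
  let ?w = "(if n \<le> v then 1 else 0) + w"
  let ?Y = "{mon2 A B | A B. A \<subseteq> {..<N} \<and> B \<subseteq> {..<N} \<and> zw n A + zw n B < ?w}"
  have *: "mulbit \<phi> b \<in> lower2 ?w" if "\<And>x. x \<in> ?X \<Longrightarrow> mulbit \<phi> x \<in> ?Y" for \<phi> :: "'a \<times> 'a \<Rightarrow> bit"
  proof -
    have "mulbit \<phi> b \<in> mulbit \<phi> ` bv.span ?X" using b by (auto simp: lower2_def)
    also have "\<dots> = bv.span (mulbit \<phi> ` ?X)" by (rule blinear_span[OF blinear_mulbit, symmetric])
    also have "\<dots> \<subseteq> bv.span ?Y" using that by (intro bv.span_mono) blast
    finally show ?thesis by (simp only: lower2_def)
  qed
  show "mulbit (\<lambda>p. mon {v} (fst p)) b \<in> lower2 ?w"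
  proof (rule *)
    fix x assume "x \<in> ?X"
    then obtain A B where "x = mon2 A B" "A \<subseteq> {..<N}" "B \<subseteq> {..<N}" "zw n A + zw n B < w"
      by blast
    moreover have "zw n (insert v A) + zw n B < ?w"
      using zw_insert_le[of v A] \<open>zw n A + zw n B < w\<close> by linarith
    ultimately show "mulbit (\<lambda>p. mon {v} (fst p)) x \<in> ?Y"
      using v by (auto simp only: mon2_insert_left insert_subset lessThan_iff)
  qed
  show "mulbit (\<lambda>p. mon {v} (snd p)) b \<in> lower2 ?w"
  proof (rule *)
    fix x assume "x \<in> ?X"
    then obtain A B where "x = mon2 A B" "A \<subseteq> {..<N}" "B \<subseteq> {..<N}" "zw n A + zw n B < w"
      by blast
    moreover have "zw n A + zw n (insert v B) < ?w"
      using zw_insert_le[of v B] \<open>zw n A + zw n B < w\<close> by linarith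
    ultimately show "mulbit (\<lambda>p. mon {v} (snd p)) x \<in> ?Y"
      using v by (auto simp only: mon2_insert_right insert_subset lessThan_iff)
  qed
qed

definition prodmon :: "nat set \<Rightarrow> 'a \<times> 'a \<Rightarrow> bit" where
  "prodmon S p = (if fst p \<in> carrier G \<and> snd p \<in> carrier G then mon S (fst p \<otimes> snd p) else 0)"

text \<open>Each coordinate of a product is the sum of a left, a right and a cross term. Choosing
  left or right for every element of \<open>S\<close> gives the sum over splits. A cross term puts
  two coordinates of weight zero in place of some z_v, and repeated coordinates merge by
  idempotence, which can only lower the weight further.\<close>

lemma prodmon_expand:
  assumes "finite S" "S \<subseteq> {..<N}"
  shows "prodmon S + (\<Sum>A\<in>Pow S. mon2 A (S - A)) \<in> lower2 (zw n S)"
  using assms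
proof (induction S)
  case empty
  have "prodmon {} = mon2 {} {}" by (auto simp: prodmon_def mon2_def fun_eq_iff)
  then have "prodmon {} + (\<Sum>A\<in>Pow {}. mon2 A ({} - A)) = 0"
    by (simp only: Pow_empty sum.insert sum.empty finite.emptyI empty_iff Diff_empty) simp
  then show ?case unfolding lower2_def by (simp only: bv.span_zero)
next
  case (insert v S)
  let ?\<Sigma> = "\<Sum>A\<in>Pow S. mon2 A (S - A)"
  let ?R = "prodmon S + ?\<Sigma>"
  let ?l = "\<lambda>p. mon {v} (fst p)" and ?r = "\<lambda>p. mon {v} (snd p)"
  have v: "v < N" "v \<notin> S" and S: "S \<subseteq> {..<N}" "finite S" using insert by auto
  have IH: "?R \<in> lower2 (zw n S)" using S(1) by (rule insert.IH)
  have zwS: "zw n (insert v S) = (if n \<le> v then 1 else 0) + zw n S" using v S by (simp add: zw_insert)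
  have PowEq: "(\<Sum>A\<in>Pow (insert v S). mon2 A (insert v S - A)) = mulbit ?r ?\<Sigma> + mulbit ?l ?\<Sigma>"
  proof -
    have "(\<Sum>A\<in>Pow (insert v S). mon2 A (insert v S - A)) =
        (\<Sum>A\<in>Pow S. mon2 A (insert v S - A)) + (\<Sum>A\<in>insert v ` Pow S. mon2 A (insert v S - A))"
      unfolding Pow_insert using v S by (intro sum.union_disjoint) auto
    also have "(\<Sum>A\<in>insert v ` Pow S. mon2 A (insert v S - A)) =
        (\<Sum>A\<in>Pow S. mon2 (insert v A) (insert v S - insert v A))"
      using v by (subst sum.reindex) (auto simp: inj_on_def)
    also have "\<dots> = (\<Sum>A\<in>Pow S. mulbit ?l (mon2 A (S - A)))"
      using v by (intro sum.cong refl) (auto simp: mon2_insert_left intro!: arg_cong2[of _ _ _ _ mon2])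
    also have "\<dots> = mulbit ?l ?\<Sigma>" by (rule bvp.linear_sum[OF blinear_mulbit, symmetric])
    also have "(\<Sum>A\<in>Pow S. mon2 A (insert v S - A)) = (\<Sum>A\<in>Pow S. mulbit ?r (mon2 A (S - A)))"
      using v by (intro sum.cong refl) (auto simp: mon2_insert_right intro!: arg_cong2[of _ _ _ _ mon2])
    also have "\<dots> = mulbit ?r ?\<Sigma>" by (rule bvp.linear_sum[OF blinear_mulbit, symmetric])
    finally show ?thesis .
  qed
  have prodEq: "prodmon (insert v S) = mulbit ?l (prodmon S) + mulbit ?r (prodmon S) + mulbit (cross v) (prodmon S)"
    using v by (auto simp: fun_eq_iff prodmon_def mulbit_def mon_insert[of v S] mon_single_mult algebra_simps)
  have eq: "prodmon (insert v S) + (\<Sum>A\<in>Pow (insert v S). mon2 A (insert v S - A)) =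
      mulbit ?l ?R + mulbit ?r ?R + mulbit (cross v) ?R + mulbit (cross v) ?\<Sigma>"
    unfolding PowEq prodEq by (simp add: blinear_add[OF blinear_mulbit] ac_simps)
  have l: "mulbit ?l ?R \<in> lower2 (zw n (insert v S))" and r: "mulbit ?r ?R \<in> lower2 (zw n (insert v S))"
    unfolding zwS using lower2_mulbit[OF v(1) IH] by auto
  have cr: "mulbit (cross v) ?R \<in> lower2 (zw n (insert v S)) \<and> mulbit (cross v) ?\<Sigma> \<in> lower2 (zw n (insert v S))"
  proof (cases "n \<le> v")
    case False
    then have "mulbit (cross v) b = 0" for b by (auto simp: mulbit_def cross_def fun_eq_iff)
    then show ?thesis unfolding lower2_def by (simp only: bv.span_zero simp_thms)
  next
    case True
    have ab: "\<alpha> v < n" "\<beta> v < n" using quad_less[OF True v(1)] by auto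
    have cm: "mulbit (cross v) b = mulbit (\<lambda>p. mon {\<alpha> v} (fst p)) (mulbit (\<lambda>p. mon {\<beta> v} (snd p)) b)" for b
      using True by (auto simp: mulbit_def cross_def fun_eq_iff mult.assoc)
    have up: "b \<in> lower2 w \<Longrightarrow> mulbit (cross v) b \<in> lower2 w" for b w
      using lower2_mulbit(1)[of "\<alpha> v" "mulbit (\<lambda>p. mon {\<beta> v} (snd p)) b" w] lower2_mulbit(2)[of "\<beta> v" b w]
        ab n_le_N unfolding cm by auto
    have "?\<Sigma> \<in> lower2 (Suc (zw n S))"
      unfolding lower2_def
    proof (intro bv.span_sum bv.span_base CollectI exI conjI)
      fix A assume A: "A \<in> Pow S"
      show "mon2 A (S - A) = mon2 A (S - A)" ..
      show "A \<subseteq> {..<N}" "S - A \<subseteq> {..<N}" using A S by auto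
      show "zw n A + zw n (S - A) < Suc (zw n S)" using A S by (simp add: zw_Diff)
    qed
    moreover have "?R \<in> lower2 (Suc (zw n S))" using IH lower2_mono[of "zw n S" "Suc (zw n S)"] by auto
    ultimately show ?thesis using True by (auto simp: zwS intro: up)
  qed
  show ?case unfolding eq using l r cr unfolding lower2_def by (intro bv.span_add) auto
qed

text \<open>The two improper splits of \<open>S\<close> cancel against the values of
  \<open>mon S\<close> at the two factors.\<close>

lemma dmon_expand:
  assumes S: "S \<subseteq> {..<N}" "S \<noteq> {}"
  shows "dmon S + (\<Sum>A\<in>Pow S - {{}, S}. mon2 A (S - A)) \<in> lower2 (zw n S)"
proof -
  have fin: "finite S" using S(1) by (rule finite_block)
  have "(\<Sum>A\<in>Pow S. mon2 A (S - A)) = (\<Sum>A\<in>Pow S - {{}, S}. mon2 A (S - A)) + (\<Sum>A\<in>{{}, S}. mon2 A (S - A))"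
    using fin by (intro sum.subset_diff) auto
  moreover have "(\<Sum>A\<in>{{}, S}. mon2 A (S - A)) = mon2 {} S + mon2 S {}"
    using S(2) by (subst sum.insert) auto
  moreover have "dmon S = prodmon S + (mon2 {} S + mon2 S {})"
    by (auto simp: dmon_def prodmon_def mon2_def fun_eq_iff ac_simps)
  ultimately have "dmon S + (\<Sum>A\<in>Pow S - {{}, S}. mon2 A (S - A)) = prodmon S + (\<Sum>A\<in>Pow S. mon2 A (S - A))"
    by (simp add: ac_simps)
  then show ?thesis using prodmon_expand[OF fin S(1)] by simp
qed


section \<open>The matching is triangular for the coboundary\<close>

abbreviation mspan :: "nat set list set \<Rightarrow> ('a list \<Rightarrow> bit) set" where
  "mspan X \<equiv> bv.span (mono ` X)"

lemma mspan_base: "\<sigma> \<in> X \<Longrightarrow> mono \<sigma> \<in> mspan X"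
  by (intro bv.span_base imageI)

lemma mspan_mono: "X \<subseteq> Y \<Longrightarrow> f \<in> mspan X \<Longrightarrow> f \<in> mspan Y"
  using bv.span_mono[of "mono ` X" "mono ` Y"] by (auto intro: image_mono)

lemma ext_mspan:
  assumes "f \<in> mspan X" "\<And>\<tau>. \<tau> \<in> X \<Longrightarrow> S # \<tau> \<in> Y"
  shows "ext S f \<in> mspan Y"
proof -
  have "ext S f \<in> bv.span (ext S ` mono ` X)" using assms(1) by (simp add: blinear_span[OF blinear_ext])
  also have "ext S ` mono ` X \<subseteq> mono ` Y"
  proof
    fix x assume "x \<in> ext S ` mono ` X"
    then obtain \<tau> where "\<tau> \<in> X" "x = mono (S # \<tau>)" by auto
    then show "x \<in> mono ` Y" using assms(2) by blast
  qed
  then have "bv.span (ext S ` mono ` X) \<subseteq> mspan Y" by (rule bv.span_mono)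
  finally show ?thesis .
qed

lemma ext2_lower2:
  assumes "b \<in> lower2 w"
    and "\<And>A B. A \<subseteq> {..<N} \<Longrightarrow> B \<subseteq> {..<N} \<Longrightarrow> zw n A + zw n B < w \<Longrightarrow> A # B # \<sigma> \<in> Y"
  shows "ext2 b (mono \<sigma>) \<in> mspan Y"
proof -
  let ?X = "{mon2 A B | A B. A \<subseteq> {..<N} \<and> B \<subseteq> {..<N} \<and> zw n A + zw n B < w}"
  let ?L = "\<lambda>b. ext2 b (mono \<sigma>)"
  have "?L b \<in> ?L ` bv.span ?X" using assms(1) by (auto simp: lower2_def)
  also have "\<dots> = bv.span (?L ` ?X)" by (rule blinear_span[OF blinear_ext2, symmetric])
  also have "\<dots> \<subseteq> mspan Y"
  proof (rule bv.span_mono)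
    show "?L ` ?X \<subseteq> mono ` Y"
    proof
      fix x assume "x \<in> ?L ` ?X"
      then obtain A B where AB: "x = mono (A # B # \<sigma>)" "A \<subseteq> {..<N}" "B \<subseteq> {..<N}" "zw n A + zw n B < w"
        by (auto simp only: ext2_mon2)
      then show "x \<in> mono ` Y" using assms(2) by blast
    qed
  qed
  finally show ?thesis .
qed

lemma ext2_dmon:
  assumes S: "S \<subseteq> {..<N}" "S \<noteq> {}"
    and "\<And>A B. A \<subseteq> {..<N} \<Longrightarrow> B \<subseteq> {..<N} \<Longrightarrow> zw n A + zw n B < zw n S \<Longrightarrow> A # B # \<sigma> \<in> Y"
  shows "ext2 (dmon S) (mono \<sigma>) + (\<Sum>A\<in>Pow S - {{}, S}. mono (A # (S - A) # \<sigma>)) \<in> mspan Y"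
proof -
  let ?L = "\<lambda>b. ext2 b (mono \<sigma>)"
  have "?L (dmon S + (\<Sum>A\<in>Pow S - {{}, S}. mon2 A (S - A))) \<in> mspan Y"
    using dmon_expand[OF S] assms(3) by (rule ext2_lower2)
  also have "?L (dmon S + (\<Sum>A\<in>Pow S - {{}, S}. mon2 A (S - A))) =
      ?L (dmon S) + ?L (\<Sum>A\<in>Pow S - {{}, S}. mon2 A (S - A))"
    by (rule blinear_add[OF blinear_ext2])
  also have "?L (\<Sum>A\<in>Pow S - {{}, S}. mon2 A (S - A)) = (\<Sum>A\<in>Pow S - {{}, S}. mono (A # (S - A) # \<sigma>))"
    unfolding bvp.linear_sum[OF blinear_ext2] by (simp only: ext2_mon2)
  finally show ?thesis .
qed

lemma mono_cell_cochains: "\<sigma> \<in> cells N k \<Longrightarrow> mono \<sigma> \<in> cochains G k"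
  by (rule mono_cochains) (simp add: cells_def)

lemma d_mono_Cons:
  "\<sigma> \<in> cells N k \<Longrightarrow> d (Suc k) (mono (S # \<sigma>)) = ext2 (dmon S) (mono \<sigma>) + ext S (d k (mono \<sigma>))"
  using d_ext[OF mono_cell_cochains] by simp

lemma mspan_add_iff: "g \<in> mspan X \<Longrightarrow> f + g \<in> mspan X \<longleftrightarrow> f \<in> mspan X"
  by (rule bv.span_add_eq2)

lemma if_mem_bspan: "(P \<Longrightarrow> f \<in> bv.span X) \<Longrightarrow> (if P then f else 0) \<in> bv.span X"
  by (cases P) (simp_all only: if_True if_False bv.span_zero simp_thms)

text \<open>A run of \<open>j\<close> empty blocks between nonempty ones is lengthened \<open>j + 2\<close> times.\<close>

lemma d_mono_empties:
  assumes "\<sigma> \<in> cells N k"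
  shows "d k (mono \<sigma>) + (if odd (empties \<sigma>) then mono ({} # \<sigma>) else 0) \<in>
    mspan {\<tau> \<in> cells N (Suc k). wt n \<tau> < wt n \<sigma> \<or> wt n \<tau> \<le> wt n \<sigma> \<and> empties \<tau> = empties \<sigma>}"
  using assms
proof (induction \<sigma> arbitrary: k)
  case Nil
  then have "d k (mono []) + (if odd (empties []) then mono ({} # []) else 0) = 0" by (simp add: coboundary_0)
  then show ?case by (metis bv.span_zero)
next
  case (Cons S \<sigma>)
  then obtain j where j: "k = Suc j" "\<sigma> \<in> cells N j" "S \<subseteq> {..<N}"
    by (auto simp: cells_Cons)
  let ?e = "if odd (empties \<sigma>) then mono ({} # \<sigma>) else 0"
  let ?X = "{\<tau> \<in> cells N (Suc j). wt n \<tau> < wt n \<sigma> \<or> wt n \<tau> \<le> wt n \<sigma> \<and> empties \<tau> = empties \<sigma>}"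
  let ?Y = "{\<tau> \<in> cells N (Suc (Suc j)). wt n \<tau> < wt n (S # \<sigma>) \<or> wt n \<tau> \<le> wt n (S # \<sigma>) \<and> empties \<tau> = empties (S # \<sigma>)}"
  have IH: "d j (mono \<sigma>) + ?e \<in> mspan ?X"
    using Cons.IH[OF j(2)] .
  show ?case
  proof (cases "S = {}")
    case True
    have mem: "ext {} (d j (mono \<sigma>) + ?e) \<in> mspan ?Y"
      using IH by (rule ext_mspan) (auto simp: True zw_def)
    \<comment> \<open>The coboundary of 1 contributes one more copy of the lengthened run, so the
      coefficient flips with each further leading empty block.\<close>
    have eq: "ext {} (d j (mono \<sigma>) + ?e) =
        d (Suc j) (mono (S # \<sigma>)) + (if odd (empties (S # \<sigma>)) then mono ({} # S # \<sigma>) else 0)"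
    proof -
      have "ext {} 0 = 0" by (rule bvp.linear_0[OF blinear_ext])
      then show ?thesis
        unfolding d_mono_Cons[OF j(2)] True dmon_empty ext2_mon2 blinear_add[OF blinear_ext]
        by (simp add: ac_simps)
    qed
    show ?thesis
      using mem unfolding j(1) eq .
  next
    case False
    have ext: "ext S (d j (mono \<sigma>)) \<in> mspan ?Y"
    proof (rule ext_mspan)
      have "?e \<in> mspan {\<tau> \<in> cells N (Suc j). wt n \<tau> \<le> wt n \<sigma>}"
        by (intro if_mem_bspan mspan_base) (simp add: zw_def j(2))
      moreover have "d j (mono \<sigma>) + ?e \<in> mspan {\<tau> \<in> cells N (Suc j). wt n \<tau> \<le> wt n \<sigma>}"
        using IH by (rule mspan_mono[rotated]) auto
      ultimately show "d j (mono \<sigma>) \<in> mspan {\<tau> \<in> cells N (Suc j). wt n \<tau> \<le> wt n \<sigma>}"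
        by (simp only: mspan_add_iff)
    qed (use j False in auto)
    have low: "ext2 (dmon S) (mono \<sigma>) + (\<Sum>A\<in>Pow S - {{}, S}. mono (A # (S - A) # \<sigma>)) \<in> mspan ?Y"
      using j by (intro ext2_dmon False) auto
    have "(\<Sum>A\<in>Pow S - {{}, S}. mono (A # (S - A) # \<sigma>)) \<in> mspan ?Y"
    proof (intro bv.span_sum mspan_base)
      fix A assume A: "A \<in> Pow S - {{}, S}"
      then have "zw n A + zw n (S - A) = zw n S" using j(3) by (intro zw_Diff) (auto intro: finite_block)
      then show "A # (S - A) # \<sigma> \<in> ?Y" using A j False by auto
    qed
    with low have "ext2 (dmon S) (mono \<sigma>) \<in> mspan ?Y" by (simp only: mspan_add_iff)
    then have "ext2 (dmon S) (mono \<sigma>) + ext S (d j (mono \<sigma>)) \<in> mspan ?Y"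
      using ext by (rule bv.span_add)
    moreover have "empties (S # \<sigma>) = 0" using False by simp
    ultimately show ?thesis
      unfolding j(1) d_mono_Cons[OF j(2)] by (simp only: even_zero if_False not_True_eq_False add_0_right)
  qed
qed

lemma d_mono_weight:
  assumes "\<sigma> \<in> cells N k"
  shows "d k (mono \<sigma>) \<in> mspan {\<tau> \<in> cells N (Suc k). wt n \<tau> \<le> wt n \<sigma>}"
proof -
  let ?X = "{\<tau> \<in> cells N (Suc k). wt n \<tau> \<le> wt n \<sigma>}"
  have "(if odd (empties \<sigma>) then mono ({} # \<sigma>) else 0) \<in> mspan ?X"
    by (intro if_mem_bspan mspan_base) (simp add: zw_def assms)
  moreover have "d k (mono \<sigma>) + (if odd (empties \<sigma>) then mono ({} # \<sigma>) else 0) \<in> mspan ?X"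
    using d_mono_empties[OF assms] by (rule mspan_mono[rotated]) auto
  ultimately show ?thesis by (simp only: mspan_add_iff)
qed

text \<open>Triangularity of the matching. If the first block \<open>S\<close> has minimum
  \<open>l\<close> and at least two elements, a split whose first part contains \<open>l\<close> and
  more is again \<open>Up\<close>; a split whose first part omits \<open>l\<close> starts with a
  larger minimum and so has smaller \<open>enc\<close>; terms that leave \<open>S\<close> intact
  stay \<open>Up\<close>. The only split left is \<open>mu\<close>. If \<open>S\<close> is a single
  letter it has no proper split, and the claim passes to the tail. For an initial empty block, an
  odd run that keeps its length stays \<open>Up\<close>.\<close>

lemma d_mono_mu:
  assumes "\<sigma> \<in> cells N k" "cls p \<sigma> = Up"
  shows "d k (mono \<sigma>) + mono (mu \<sigma>) \<in>
    mspan {\<tau> \<in> cells N (Suc k). wt n \<tau> < wt n \<sigma> \<or>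
      wt n \<tau> \<le> wt n \<sigma> \<and> (cls p \<tau> = Up \<or> enc N \<tau> < enc N (mu \<sigma>))}"
  using assms
proof (induction \<sigma> arbitrary: k p)
  case (Cons S \<sigma>)
  then obtain j where j: "k = Suc j" "\<sigma> \<in> cells N j" "S \<subseteq> {..<N}"
    by (auto simp: cells_Cons)
  let ?Y = "{\<tau> \<in> cells N (Suc k). wt n \<tau> < wt n (S # \<sigma>) \<or>
      wt n \<tau> \<le> wt n (S # \<sigma>) \<and> (cls p \<tau> = Up \<or> enc N \<tau> < enc N (mu (S # \<sigma>)))}"
  have fin: "finite S" using j(3) by (rule finite_block)
  consider "S = {}" | "S \<noteq> {}" "card S = 1" | "S \<noteq> {}" "card S \<noteq> 1"
    by blast
  then show ?case
  proof cases
    case 1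
    then have odd: "odd (empties (S # \<sigma>))" using Cons.prems(2) by (auto split: if_splits)
    have "d k (mono (S # \<sigma>)) + (if odd (empties (S # \<sigma>)) then mono ({} # S # \<sigma>) else 0) \<in>
        mspan {\<tau> \<in> cells N (Suc k). wt n \<tau> < wt n (S # \<sigma>) \<or>
          wt n \<tau> \<le> wt n (S # \<sigma>) \<and> empties \<tau> = empties (S # \<sigma>)}"
      by (rule d_mono_empties[OF Cons.prems(1)])
    moreover have "\<dots> \<subseteq> mspan ?Y"
    proof (intro bv.span_mono image_mono Collect_mono impI)
      fix \<tau> assume \<tau>: "\<tau> \<in> cells N (Suc k) \<and> (wt n \<tau> < wt n (S # \<sigma>) \<or>
          wt n \<tau> \<le> wt n (S # \<sigma>) \<and> empties \<tau> = empties (S # \<sigma>))"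
      have "cls p \<tau> = Up" if e: "empties \<tau> = empties (S # \<sigma>)"
      proof (cases \<tau>)
        case Nil
        with e odd show ?thesis by simp
      next
        case (Cons B \<rho>)
        with e odd show ?thesis by (cases "B = {}") (simp_all split: if_splits)
      qed
      with \<tau> show "\<tau> \<in> cells N (Suc k) \<and> (wt n \<tau> < wt n (S # \<sigma>) \<or>
          wt n \<tau> \<le> wt n (S # \<sigma>) \<and> (cls p \<tau> = Up \<or> enc N \<tau> < enc N (mu (S # \<sigma>))))"
        by blast
    qed
    ultimately have "d k (mono (S # \<sigma>)) + (if odd (empties (S # \<sigma>)) then mono ({} # S # \<sigma>) else 0) \<in> mspan ?Y"
      by blast
    moreover have "mu (S # \<sigma>) = {} # S # \<sigma>" using 1 by simp
    ultimately show ?thesis unfolding if_P[OF odd] by (simp only:)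
  next
    case 2
    then obtain l where S: "S = {l}" by (auto simp: card_1_singleton_iff)
    have up: "l \<le> p" "cls l \<sigma> = Up" using Cons.prems(2) by (auto simp: S split: if_splits)
    let ?X = "{\<tau> \<in> cells N (Suc j). wt n \<tau> < wt n \<sigma> \<or>
      wt n \<tau> \<le> wt n \<sigma> \<and> (cls l \<tau> = Up \<or> enc N \<tau> < enc N (mu \<sigma>))}"
    have "d j (mono \<sigma>) + mono (mu \<sigma>) \<in> mspan ?X" by (rule Cons.IH[OF j(2) up(2)])
    then have "ext S (d j (mono \<sigma>) + mono (mu \<sigma>)) \<in> mspan ?Y"
    proof (rule ext_mspan)
      fix \<tau> assume \<tau>: "\<tau> \<in> ?X"
      have "length \<tau> = length (mu \<sigma>)"
        using \<tau> mu_cells[OF j(2) up(2)] by (simp add: cells_def)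
      with \<tau> show "S # \<tau> \<in> ?Y" using up j by (auto simp: S)
    qed
    moreover have "ext2 (dmon S) (mono \<sigma>) + (\<Sum>A\<in>Pow S - {{}, S}. mono (A # (S - A) # \<sigma>)) \<in> mspan ?Y"
      using j by (intro ext2_dmon 2) auto
    then have "ext2 (dmon S) (mono \<sigma>) \<in> mspan ?Y"
    proof -
      assume "ext2 (dmon S) (mono \<sigma>) + (\<Sum>A\<in>Pow S - {{}, S}. mono (A # (S - A) # \<sigma>)) \<in> mspan ?Y"
      moreover have "Pow S - {{}, S} = {}" by (auto simp: S)
      ultimately show ?thesis by (simp only: sum.empty add_0_right)
    qed
    ultimately have "ext2 (dmon S) (mono \<sigma>) + ext S (d j (mono \<sigma>) + mono (mu \<sigma>)) \<in> mspan ?Y"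
      by (simp only: bv.span_add)
    then show ?thesis
      using 2 unfolding j(1) d_mono_Cons[OF j(2)] blinear_add[OF blinear_ext]
      by (simp only: mu.simps if_False if_True mono.simps add.assoc simp_thms)
  next
    case 3
    let ?l = "Min S"
    have l: "?l \<in> S" "?l \<le> p"
      using 3 fin Cons.prems(2) by (auto split: if_splits simp del: Min_gr_iff)
    have lN: "?l < N" using l j(3) by auto
    have neS: "S \<noteq> {?l}" using 3(2) by (metis is_singletonI is_singleton_altdef)
    have mu: "mu (S # \<sigma>) = {?l} # (S - {?l}) # \<sigma>" using 3 by simp
    have ext: "ext S (d j (mono \<sigma>)) \<in> mspan ?Y"
      by (rule ext_mspan[OF d_mono_weight[OF j(2)]]) (use j 3 l in \<open>auto simp: not_less[symmetric] simp del: Min_gr_iff Min_le_iff\<close>)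
    have low: "ext2 (dmon S) (mono \<sigma>) + (\<Sum>A\<in>Pow S - {{}, S}. mono (A # (S - A) # \<sigma>)) \<in> mspan ?Y"
      using j by (intro ext2_dmon 3) auto
    have "(\<Sum>A\<in>Pow S - {{}, S} - {{?l}}. mono (A # (S - A) # \<sigma>)) \<in> mspan ?Y"
    proof (intro bv.span_sum mspan_base)
      fix A assume A: "A \<in> Pow S - {{}, S} - {{?l}}"
      then have finA: "finite A" using fin by (auto intro: finite_subset)
      have zw: "zw n A + zw n (S - A) = zw n S" using A fin by (intro zw_Diff) auto
      have cell: "A # (S - A) # \<sigma> \<in> cells N (Suc k)" using A j by auto
      show "A # (S - A) # \<sigma> \<in> ?Y"
      proof (cases "?l \<in> A")
        case True
        have "Min A = ?l" using True A finA fin by (intro Min_eqI) auto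
        moreover have "card A \<noteq> 1" using True A by (auto simp: card_1_singleton_iff)
        ultimately have "cls p (A # (S - A) # \<sigma>) = Up"
          using True l(2) A by (simp add: not_less[symmetric] del: Min_gr_iff)
        with cell zw show ?thesis by simp
      next
        case False
        have "Min A \<in> A" using A finA by auto
        then have "?l < Min A" "Min A < N" using False A fin j(3) by (auto simp: order.strict_iff_order)
        then have "enc N (A # (S - A) # \<sigma>) < enc N (mu (S # \<sigma>))"
          unfolding mu using A by (intro enc_Cons_less) auto
        with cell zw show ?thesis by simp
      qed
    qed
    moreover have "(\<Sum>A\<in>Pow S - {{}, S}. mono (A # (S - A) # \<sigma>)) =
        mono (mu (S # \<sigma>)) + (\<Sum>A\<in>Pow S - {{}, S} - {{?l}}. mono (A # (S - A) # \<sigma>))"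
      unfolding mu using l neS fin by (intro sum.remove) auto
    ultimately have "ext2 (dmon S) (mono \<sigma>) + mono (mu (S # \<sigma>)) \<in> mspan ?Y"
      using low by (simp only: add.assoc[symmetric] mspan_add_iff)
    then have "ext2 (dmon S) (mono \<sigma>) + mono (mu (S # \<sigma>)) + ext S (d j (mono \<sigma>)) \<in> mspan ?Y"
      using ext by (rule bv.span_add)
    then show ?thesis unfolding j(1) d_mono_Cons[OF j(2)] by (simp only: ac_simps)
  qed
qed simp


section \<open>A basis of the cochains adapted to the coboundary\<close>

text \<open>Moebius inversion on the subset lattice modulo 2: an interval of subsets has
  \<open>2 ^ m\<close> elements, which is odd only for \<open>m = 0\<close>. Hence the monomials
  span all functions on the group.\<close>

lemma mon_sum_supersets:
  assumes "g \<in> carrier G" "T \<subseteq> {..<N}"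
  shows "(\<Sum>S | T \<subseteq> S \<and> S \<subseteq> {..<N}. mon S g) = of_bool (c g = T)"
proof -
  let ?F = "{S. T \<subseteq> S \<and> S \<subseteq> c g}"
  have cg: "c g \<subseteq> {..<N}" "finite (c g)"
    using bij_betwE[OF coord_bij] assms(1) by (auto intro: finite_block)
  have "(\<Sum>S | T \<subseteq> S \<and> S \<subseteq> {..<N}. mon S g) = (\<Sum>S\<in>?F. mon S g)"
    using cg by (intro sum.mono_neutral_right) (auto simp: mon_def)
  also have "\<dots> = of_nat (card ?F)" by (simp add: mon_def)
  also have "\<dots> = of_bool (c g = T)"
  proof (cases "T \<subseteq> c g")
    case True
    have "bij_betw (\<lambda>S. S - T) ?F (Pow (c g - T))"
      by (rule bij_betwI[where g = "\<lambda>S. S \<union> T"]) (use True in auto)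
    then have "card ?F = 2 ^ card (c g - T)" using cg(2) by (simp add: bij_betw_same_card card_Pow)
    moreover have "card (c g - T) = 0 \<longleftrightarrow> c g = T" using True cg(2) by auto
    ultimately show ?thesis by (cases "card (c g - T)") auto
  next
    case False
    then have "?F = {}" "c g \<noteq> T" by auto
    then show ?thesis by (simp only: card.empty of_nat_0 of_bool_eq(1))
  qed
  finally show ?thesis .
qed

lemma bunit_mspan:
  "length gs = k \<Longrightarrow> set gs \<subseteq> carrier G \<Longrightarrow> bunit gs \<in> mspan (cells N k)"
proof (induction gs arbitrary: k)
  case Nil
  have "bunit [] = mono []" by (auto simp: bunit_def)
  then show ?case using Nil by (simp only:) (rule mspan_base, simp)
next
  case (Cons g gs)
  then obtain j where j: "k = Suc j" "length gs = j" by auto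
  let ?T = "c g"
  have T: "?T \<subseteq> {..<N}" using bij_betwE[OF coord_bij] Cons.prems by auto
  have eq: "bunit (g # gs) = (\<Sum>S | ?T \<subseteq> S \<and> S \<subseteq> {..<N}. ext S (bunit gs))"
  proof
    fix hs
    show "bunit (g # gs) hs = (\<Sum>S | ?T \<subseteq> S \<and> S \<subseteq> {..<N}. ext S (bunit gs)) hs"
    proof (cases "\<exists>h hs'. hs = h # hs' \<and> h \<in> carrier G")
      case True
      then obtain h hs' where hs: "hs = h # hs'" "h \<in> carrier G" by auto
      have "c h = c g \<longleftrightarrow> h = g"
        using coord_bij hs(2) Cons.prems(2) by (auto simp: bij_betw_def inj_on_def)
      then have "of_bool (c h = ?T) * bunit gs hs' = bunit (g # gs) hs" by (auto simp: hs bunit_def)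
      then show ?thesis using hs T by (simp add: sum_fun_apply sum_distrib_right[symmetric] mon_sum_supersets)
    next
      case False
      then have "ext S (bunit gs) hs = 0" for S by (cases hs) auto
      moreover have "hs \<noteq> g # gs" using False Cons.prems(2) by auto
      ultimately show ?thesis by (simp add: sum_fun_apply bunit_def)
    qed
  qed
  show ?case
    unfolding eq
  proof (rule bv.span_sum)
    fix S assume "S \<in> {S. ?T \<subseteq> S \<and> S \<subseteq> {..<N}}"
    then show "ext S (bunit gs) \<in> mspan (cells N k)"
      using Cons.IH[OF j(2)] Cons.prems(2) j(1) by (intro ext_mspan[where X = "cells N j"]) auto
  qed
qed

lemma finite_carrier: "finite (carrier G)"
  and card_carrier: "card (carrier G) = 2 ^ N"
  using bij_betw_finite[OF coord_bij] bij_betw_same_card[OF coord_bij] by (simp_all add: card_Pow)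

lemma card_cochains: "card (cochains G k) = 2 ^ card (cells N k)"
  and finite_cochains: "finite (cochains G k)"
  by (simp_all add: cochains_eq_bsupp card_bsupp finite_tuples card_tuples finite_carrier
      card_carrier card_cells)

lemma subspace_cochains: "bv.subspace (cochains G k)"
  unfolding cochains_eq_bsupp by (rule subspace_bsupp)

lemma mspan_cells: "mspan (cells N k) = cochains G k"
proof
  show "mspan (cells N k) \<subseteq> cochains G k"
    using mono_cell_cochains by (intro bv.span_minimal subspace_cochains) auto
  have "bunit ` tuples G k \<subseteq> mspan (cells N k)" using bunit_mspan by (auto simp: tuples_def)
  then have "bv.span (bunit ` tuples G k) \<subseteq> mspan (cells N k)"
    by (intro bv.span_minimal bv.subspace_span)
  then show "cochains G k \<subseteq> mspan (cells N k)"
    by (simp add: span_bunit finite_tuples finite_carrier cochains_eq_bsupp)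
qed

text \<open>In \<open>gen\<close> and \<open>idx\<close> the tag \<open>Down\<close> marks a cell one degree lower, replaced by its coboundary.\<close>

definition gen :: "nat \<Rightarrow> kind \<times> nat set list \<Rightarrow> 'a list \<Rightarrow> bit" where
  "gen k = (\<lambda>(t, \<sigma>). if t = Down then d (k - 1) (mono \<sigma>) else mono \<sigma>)"

definition idx :: "nat \<Rightarrow> (kind \<times> nat set list) set" where
  "idx k = {Crit} \<times> kcells N k Crit \<union> {Up} \<times> kcells N k Up \<union> {Down} \<times> kcells N (k - 1) Up"

lemma finite_kcells [simp]: "finite (kcells N k t)"
  by (simp add: kcells_def)

lemma finite_idx [simp]: "finite (idx k)"
  by (simp add: idx_def)

lemma kcells_0: "kcells N 0 Up = {}" "kcells N 0 Crit = {[]}" "cells N 0 = {[]}"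
  by (auto simp: kcells_def cells_def)

lemma card_idx: "card (idx k) = card (cells N k)"
proof -
  have "card (idx k) = card (kcells N k Crit) + card (kcells N k Up) + card (kcells N (k - 1) Up)"
    unfolding idx_def by (subst card_Un_disjoint, (auto)[3])+ (simp add: card_cartesian_product)
  also have "\<dots> = card (cells N k)" by (cases k) (simp_all add: kcells_0 card_cells_kinds)
  finally show ?thesis .
qed

lemma wt_mu:
  assumes "\<sigma> \<in> cells N k" "cls p \<sigma> = Up"
  shows "wt n (mu \<sigma>) = wt n \<sigma>"
  using assms
proof (induction \<sigma> arbitrary: p k)
  case (Cons B \<sigma>)
  then obtain j where j: "k = Suc j" "\<sigma> \<in> cells N j" "B \<subseteq> {..<N}"
    by (auto simp: cells_Cons)
  show ?case
  proof (cases "B = {} \<or> card B = 1")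
    case True
    then show ?thesis using Cons.IH[OF j(2)] Cons.prems by (auto simp: zw_def split: if_splits)
  next
    case False
    then have "Min B \<in> B" using j(3) by (intro Min_in) (auto intro: finite_block)
    then have "zw n {Min B} + zw n (B - {Min B}) = zw n B"
      using j(3) by (intro zw_Diff) (auto intro: finite_block)
    with False show ?thesis by simp
  qed
qed simp

text \<open>By \<open>d_mono_mu\<close> a \<open>Down\<close> cell can be traded for the coboundary
  of its partner, up to \<open>Up\<close> cells and cells that are smaller in the order by weight
  and then \<open>enc\<close>. The bound on the weight is carried along because
  \<open>proj_leading\<close> needs a change of basis that respects the weight filtration.\<close>

lemma mono_span_gen:
  "\<tau> \<in> cells N k \<Longrightarrow> mono \<tau> \<in> bv.span (gen k ` {i \<in> idx k. wt n (snd i) \<le> wt n \<tau>})"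
proof (induction \<tau> rule: wf_induct_rule[OF wf_measures[of "[wt n, enc N]"]])
  case (1 \<tau>)
  let ?I = "\<lambda>\<tau>. {i \<in> idx k. wt n (snd i) \<le> wt n \<tau>}"
  have sub: "bv.span (gen k ` ?I \<rho>) \<subseteq> bv.span (gen k ` ?I \<tau>)" if "wt n \<rho> \<le> wt n \<tau>" for \<rho>
    using that by (intro bv.span_mono image_mono) auto
  have basic: "mono \<rho> \<in> bv.span (gen k ` ?I \<tau>)"
    if "\<rho> \<in> cells N k" "wt n \<rho> \<le> wt n \<tau>" "cls N \<rho> \<noteq> Down" for \<rho>
  proof -
    have "(cls N \<rho>, \<rho>) \<in> ?I \<tau>"
      using that by (cases "cls N \<rho>") (auto simp: idx_def kcells_def)
    moreover have "mono \<rho> = gen k (cls N \<rho>, \<rho>)" using that by (simp add: gen_def)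
    ultimately show ?thesis
      using bv.span_base[OF imageI, of "(cls N \<rho>, \<rho>)" "?I \<tau>" "gen k"] by (simp only:)
  qed
  show ?case
  proof (cases "cls N \<tau> = Down")
    case False
    then show ?thesis using basic[of \<tau>] "1.prems" by simp
  next
    case True
    have "k \<noteq> 0" using True "1.prems" by (cases k) (auto simp: kcells_0)
    then obtain j where j: "k = Suc j" by (cases k) auto
    have "\<tau> \<in> mu ` kcells N j Up"
      unfolding bij_betw_imp_surj_on[OF mu_bij] using True "1.prems" by (simp add: kcells_def j)
    then obtain \<sigma> where \<sigma>: "\<sigma> \<in> cells N j" "cls N \<sigma> = Up" "mu \<sigma> = \<tau>"
      by (auto simp: kcells_def)
    have wt: "wt n \<tau> = wt n \<sigma>" using wt_mu[OF \<sigma>(1,2)] \<sigma>(3) by simp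
    let ?Y = "{\<tau>' \<in> cells N k. wt n \<tau>' < wt n \<tau> \<or> wt n \<tau>' \<le> wt n \<tau> \<and> (cls N \<tau>' = Up \<or> enc N \<tau>' < enc N \<tau>)}"
    have "d j (mono \<sigma>) + mono \<tau> \<in> mspan ?Y"
      using d_mono_mu[OF \<sigma>(1,2)] by (simp only: \<sigma>(3) wt j)
    moreover have "mspan ?Y \<subseteq> bv.span (gen k ` ?I \<tau>)"
    proof (intro bv.span_minimal bv.subspace_span image_subsetI)
      fix \<rho> assume "\<rho> \<in> ?Y"
      then have \<rho>: "\<rho> \<in> cells N k" and wt_le: "wt n \<rho> \<le> wt n \<tau>"
        and "cls N \<rho> = Up \<or> wt n \<rho> < wt n \<tau> \<or> enc N \<rho> < enc N \<tau>"
        by auto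
      then consider "cls N \<rho> = Up" | "(\<rho>, \<tau>) \<in> measures [wt n, enc N]"
        by fastforce
      then show "mono \<rho> \<in> bv.span (gen k ` ?I \<tau>)"
      proof cases
        case 1
        then show ?thesis using basic \<rho> wt_le by simp
      next
        case 2
        then show ?thesis using "1.IH"[OF 2 \<rho>] sub[OF wt_le] by blast
      qed
    qed
    ultimately have "d j (mono \<sigma>) + mono \<tau> \<in> bv.span (gen k ` ?I \<tau>)" by blast
    moreover have "d j (mono \<sigma>) \<in> bv.span (gen k ` ?I \<tau>)"
    proof -
      have "(Down, \<sigma>) \<in> ?I \<tau>" using \<sigma> wt by (auto simp: idx_def kcells_def j)
      moreover have "d j (mono \<sigma>) = gen k (Down, \<sigma>)" by (simp add: gen_def j)
      ultimately show ?thesis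
        using bv.span_base[OF imageI, of "(Down, \<sigma>)" "?I \<tau>" "gen k"] by (simp only:)
    qed
    ultimately show ?thesis by (simp only: bv.span_add_eq)
  qed
qed

lemma gen_cochains: "i \<in> idx k \<Longrightarrow> gen k i \<in> cochains G k"
  using mono_cell_cochains[of _ k] coboundary_cochains[of G "k - 1"] kcells_0
  by (cases k) (auto simp: idx_def gen_def kcells_def)

lemma span_gen: "bv.span (gen k ` idx k) = cochains G k"
proof
  show "bv.span (gen k ` idx k) \<subseteq> cochains G k"
    using gen_cochains by (intro bv.span_minimal subspace_cochains) auto
  have "mono \<tau> \<in> bv.span (gen k ` idx k)" if "\<tau> \<in> cells N k" for \<tau>
    using mono_span_gen[OF that] bv.span_mono[of "gen k ` {i \<in> idx k. wt n (snd i) \<le> wt n \<tau>}" "gen k ` idx k"]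
    by auto
  then have "mspan (cells N k) \<subseteq> bv.span (gen k ` idx k)"
    by (intro bv.span_minimal bv.subspace_span) auto
  then show "cochains G k \<subseteq> bv.span (gen k ` idx k)" by (simp only: mspan_cells)
qed

text \<open>A spanning family with as many members as the dimension is a basis; the count is right
  because every \<open>Down\<close> cell is represented by its \<open>Up\<close> partner.\<close>

lemma inj_gen: "inj_on (gen k) (idx k)"
  and independent_gen: "\<not> bv.dependent (gen k ` idx k)"
proof -
  have card: "card (bv.span (gen k ` idx k)) = 2 ^ card (idx k)"
    by (simp add: span_gen card_cochains card_idx)
  have "(2::nat) ^ card (idx k) \<le> 2 ^ card (gen k ` idx k)"
    using card_bspan_le[of "gen k ` idx k"] card by simp
  then have "card (idx k) \<le> card (gen k ` idx k)" by simp
  then have eq: "card (gen k ` idx k) = card (idx k)" by (simp add: card_image_le order_antisym)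
  then show "inj_on (gen k) (idx k)" by (simp add: eq_card_imp_inj_on)
  show "\<not> bv.dependent (gen k ` idx k)" using card eq by (intro independent_of_card_bspan) auto
qed

end

section \<open>Critical cells as multisets and the projection to the reduced complex\<close>

lemma blinear_inj_of_card:
  assumes f: "blinear f" and S: "finite S" "2 ^ card S \<le> card (bv.span (f ` S))"
    and x: "x \<in> bv.span S" "f x = 0"
  shows "x = 0"
proof -
  let ?K = "{x \<in> bv.span S. f x = 0}"
  have fin: "finite (bv.span S)" using S(1) by (rule finite_bspan)
  have "card (bv.span S) = card (bv.span (f ` S)) * card ?K"
    using card_blinear_image[OF f bv.subspace_span fin] by (simp only: blinear_span[OF f])
  moreover have "card (bv.span S) \<le> card (bv.span (f ` S))" using card_bspan_le[OF S(1)] S(2) by linarith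
  moreover have "card (bv.span (f ` S)) > 0" using S(2) by (rule less_le_trans[rotated]) simp
  ultimately have "card ?K \<le> 1" using mult_le_cancel1[of "card (bv.span (f ` S))" "card ?K" 1] by simp
  moreover have "0 \<in> ?K" by (simp only: mem_Collect_eq bv.span_zero bvp.linear_0[OF f] simp_thms)
  moreover have "finite ?K" using fin by simp
  ultimately show ?thesis using x card_le_Suc0_iff_eq[of ?K] by auto
qed

definition kcell :: "nat multiset \<Rightarrow> nat set list" where
  "kcell M = map (\<lambda>v. {v}) (rev (sorted_list_of_multiset M))"

lemma inj_map_single: "inj (map (\<lambda>v. {v}))"
  by (intro inj_mapI) (auto simp: inj_def)

lemma kcell_bij: "bij_betw kcell (multisets_of_size {..<N} k) (kcells N k Crit)"
proof (rule bij_betw_imageI)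
  show "inj_on kcell (multisets_of_size {..<N} k)"
  proof (rule inj_onI)
    fix M M' assume "kcell M = kcell M'"
    then have "rev (sorted_list_of_multiset M) = rev (sorted_list_of_multiset M')"
      unfolding kcell_def by (rule injD[OF inj_map_single])
    then have "mset (sorted_list_of_multiset M) = mset (sorted_list_of_multiset M')" by simp
    then show "M = M'" by simp
  qed
  show "kcell ` multisets_of_size {..<N} k = kcells N k Crit"
  proof (intro equalityI subsetI)
    fix \<sigma> assume "\<sigma> \<in> kcell ` multisets_of_size {..<N} k"
    then obtain M where M: "set_mset M \<subseteq> {..<N}" "size M = k" "\<sigma> = kcell M"
      by (auto simp: multisets_of_size_def)
    let ?u = "rev (sorted_list_of_multiset M)"
    have "length ?u = size M" by (metis size_mset mset_rev mset_sorted_list_of_multiset)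
    then have cell: "\<sigma> \<in> cells N k" using M by (auto simp: kcell_def cells_def)
    have "sorted_wrt (\<ge>) ?u" using sorted_sorted_list_of_multiset[of M] by (simp add: sorted_wrt_rev)
    then have "sorted_wrt (\<ge>) (N # ?u)" using M(1) by auto
    then show "\<sigma> \<in> kcells N k Crit"
      using cell Crit_cell_iff[OF cell, of N] M(3) by (auto simp: kcells_def kcell_def)
  next
    fix \<sigma> assume "\<sigma> \<in> kcells N k Crit"
    then have cell: "\<sigma> \<in> cells N k" "cls N \<sigma> = Crit" by (auto simp: kcells_def)
    then obtain u where u: "\<sigma> = map (\<lambda>v. {v}) u" "sorted_wrt (\<ge>) (N # u)"
      using Crit_cell_iff[of \<sigma> N k N] by auto
    have "sorted (rev u)" using u(2) by (simp add: sorted_wrt_rev)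
    then have "sorted_list_of_multiset (mset u) = rev u" by (simp add: properties_for_sort)
    then have "kcell (mset u) = \<sigma>" by (simp add: kcell_def u(1))
    moreover have "mset u \<in> multisets_of_size {..<N} k"
      using cell(1) by (auto simp: multisets_of_size_def u(1) cells_def)
    ultimately show "\<sigma> \<in> kcell ` multisets_of_size {..<N} k" by blast
  qed
qed

definition zcount :: "nat \<Rightarrow> nat multiset \<Rightarrow> nat" where
  "zcount n M = size (filter_mset (\<lambda>v. n \<le> v) M)"

lemma zcount_simps [simp]: "zcount n {#} = 0"
  "zcount n (add_mset v M) = (if n \<le> v then 1 else 0) + zcount n M"
  "zcount n (M + M') = zcount n M + zcount n M'"
  by (simp_all add: zcount_def)

lemma zcount_remove: "v \<in># M \<Longrightarrow> zcount n M = (if n \<le> v then 1 else 0) + zcount n (M - {#v#})"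
  by (metis insert_DiffM zcount_simps(2))

lemma wt_word: "wt n (map (\<lambda>v. {v}) u) = zcount n (mset u)"
  by (induction u) (auto simp: zw_def)

lemma wt_kcell: "wt n (kcell M) = zcount n M"
  unfolding kcell_def wt_word by simp

context coordinates
begin

abbreviation base :: "nat multiset \<Rightarrow> 'a list \<Rightarrow> bit" where
  "base M \<equiv> mono (kcell M)"

abbreviation msets :: "nat \<Rightarrow> nat multiset set" where
  "msets k \<equiv> multisets_of_size {..<N} k"

lemma finite_msets [simp]: "finite (msets k)"
  by (rule finite_multisets_of_size) simp

text \<open>The coordinates along the critical members of the basis \<open>gen k\<close>, that is,
  the projection along \<open>Up\<close> cells and coboundaries of \<open>Up\<close> cells. Only
  these values and linearity are ever used, so any such map will do.\<close>

definition proj :: "nat \<Rightarrow> ('a list \<Rightarrow> bit) \<Rightarrow> nat multiset \<Rightarrow> bit" where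
  "proj k = (SOME f. blinear f \<and> (\<forall>M\<in>msets k. f (base M) = bunit M) \<and>
     (\<forall>\<sigma>\<in>kcells N k Up. f (mono \<sigma>) = 0) \<and> (\<forall>\<sigma>\<in>kcells N (k - 1) Up. f (d (k - 1) (mono \<sigma>)) = 0))"

lemma proj: "blinear (proj k)"
  "M \<in> msets k \<Longrightarrow> proj k (base M) = bunit M"
  "\<sigma> \<in> kcells N k Up \<Longrightarrow> proj k (mono \<sigma>) = 0"
  "\<sigma> \<in> kcells N (k - 1) Up \<Longrightarrow> proj k (d (k - 1) (mono \<sigma>)) = 0"
proof -
  define val :: "kind \<times> nat set list \<Rightarrow> nat multiset \<Rightarrow> bit" where
    "val i = (if fst i = Crit then bunit (the_inv_into (msets k) kcell (snd i)) else 0)" for i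
  obtain f where f: "blinear f" "\<And>x. x \<in> gen k ` idx k \<Longrightarrow> f x = val (the_inv_into (idx k) (gen k) x)"
    using bvp.linear_independent_extend[OF independent_gen, where f = "\<lambda>x. val (the_inv_into (idx k) (gen k) x)"]
    by blast
  have val: "f (gen k i) = val i" if "i \<in> idx k" for i
    using f(2)[of "gen k i"] that by (simp add: the_inv_into_f_f[OF inj_gen])
  have "f (base M) = bunit M" if "M \<in> msets k" for M
  proof -
    have "kcell M \<in> kcells N k Crit" using bij_betwE[OF kcell_bij] that by blast
    moreover have "the_inv_into (msets k) kcell (kcell M) = M"
      using kcell_bij that by (simp add: bij_betw_def the_inv_into_f_f)
    ultimately show ?thesis using val[of "(Crit, kcell M)"] by (simp add: idx_def gen_def val_def)
  qed
  moreover have "f (mono \<sigma>) = 0" if "\<sigma> \<in> kcells N k Up" for \<sigma>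
    using val[of "(Up, \<sigma>)"] that by (simp add: idx_def gen_def val_def)
  moreover have "f (d (k - 1) (mono \<sigma>)) = 0" if "\<sigma> \<in> kcells N (k - 1) Up" for \<sigma>
    using val[of "(Down, \<sigma>)"] that by (simp add: idx_def gen_def val_def)
  ultimately have "\<exists>f. blinear f \<and> (\<forall>M\<in>msets k. f (base M) = bunit M) \<and>
     (\<forall>\<sigma>\<in>kcells N k Up. f (mono \<sigma>) = 0) \<and> (\<forall>\<sigma>\<in>kcells N (k - 1) Up. f (d (k - 1) (mono \<sigma>)) = 0)"
    using f(1) by blast
  from someI_ex[OF this] have *: "blinear (proj k) \<and> (\<forall>M\<in>msets k. proj k (base M) = bunit M) \<and>
     (\<forall>\<sigma>\<in>kcells N k Up. proj k (mono \<sigma>) = 0) \<and> (\<forall>\<sigma>\<in>kcells N (k - 1) Up. proj k (d (k - 1) (mono \<sigma>)) = 0)"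
    unfolding proj_def .
  show "blinear (proj k)"
    "M \<in> msets k \<Longrightarrow> proj k (base M) = bunit M"
    "\<sigma> \<in> kcells N k Up \<Longrightarrow> proj k (mono \<sigma>) = 0"
    "\<sigma> \<in> kcells N (k - 1) Up \<Longrightarrow> proj k (d (k - 1) (mono \<sigma>)) = 0"
    using * by blast+
qed

lemma gen_image: "gen k ` idx k = base ` msets k \<union> mono ` kcells N k Up \<union> d (k - 1) ` mono ` kcells N (k - 1) Up"
proof -
  have "base ` msets k = mono ` kcells N k Crit"
    by (simp add: bij_betw_imp_surj_on[OF kcell_bij, symmetric] image_image)
  moreover have "gen k ` ({Crit} \<times> kcells N k Crit) = mono ` kcells N k Crit"
    "gen k ` ({Up} \<times> kcells N k Up) = mono ` kcells N k Up"
    "gen k ` ({Down} \<times> kcells N (k - 1) Up) = d (k - 1) ` mono ` kcells N (k - 1) Up"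
    by (force simp: gen_def)+
  ultimately show ?thesis by (simp only: idx_def image_Un)
qed

text \<open>The coboundaries of \<open>Up\<close> cells belong to the basis in the next degree, so
  the coboundary is injective on the span of the \<open>Up\<close> cells.\<close>

lemma card_bspan_dUp: "card (bv.span (d k ` mono ` kcells N k Up)) = 2 ^ card (kcells N k Up)"
proof -
  let ?I = "{Down} \<times> kcells N k Up"
  have I: "?I \<subseteq> idx (Suc k)" by (auto simp: idx_def)
  have "gen (Suc k) ` ?I = d k ` mono ` kcells N k Up" by (force simp: gen_def)
  moreover have "\<not> bv.dependent (gen (Suc k) ` ?I)"
    using bv.independent_mono[OF independent_gen] I by blast
  moreover have "card (gen (Suc k) ` ?I) = card (kcells N k Up)"
    using inj_on_subset[OF inj_gen I] by (simp add: card_image card_cartesian_product)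
  ultimately show ?thesis using card_bspan_independent[of "gen (Suc k) ` ?I"] by simp
qed

lemma dd: "d (Suc k) (d k f) = 0"
  by (rule coboundary_coboundary[OF closed assoc])

definition dproj :: "nat \<Rightarrow> nat multiset \<Rightarrow> nat multiset \<Rightarrow> bit" where
  "dproj k M = proj (Suc k) (d k (base M))"

text \<open>The rank of the coboundary is the number of \<open>Up\<close> cells plus the rank of the
  reduced coboundary: \<open>proj\<close> maps the image onto the span of the
  \<open>dproj k M\<close>, and its kernel on the image is spanned by the coboundaries of the
  \<open>Up\<close> cells.\<close>

lemma card_image_d:
  "card (d k ` cochains G k) = 2 ^ card (kcells N k Up) * card (bv.span (dproj k ` msets k))"
proof -
  let ?A = "d k ` cochains G k" and ?p = "proj (Suc k)"
  let ?U = "d k ` mono ` kcells N k Up"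
  have A: "?A = bv.span (d k ` gen k ` idx k)" by (simp only: blinear_span[OF blinear_coboundary] span_gen)
  have fin: "finite ?A" by (simp add: finite_cochains)
  have "card ?A = card (?p ` ?A) * card {x \<in> ?A. ?p x = 0}"
    using fin by (intro card_blinear_image proj) (simp_all only: A bv.subspace_span)
  moreover have "?p ` ?A = bv.span (dproj k ` msets k)"
  proof -
    let ?g = "\<lambda>x. ?p (d k x)"
    have "?p ` ?A = bv.span (?p ` d k ` gen k ` idx k)"
      unfolding A by (rule blinear_span[OF proj(1), symmetric])
    also have "?p ` d k ` gen k ` idx k = ?g ` (base ` msets k) \<union> ?g ` (mono ` kcells N k Up) \<union> ?g ` (d (k - 1) ` mono ` kcells N (k - 1) Up)"
      by (simp only: gen_image image_Un image_image)
    also have "?g ` (base ` msets k) = dproj k ` msets k" by (simp add: dproj_def image_image)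
    also have "bv.span (dproj k ` msets k \<union> ?g ` (mono ` kcells N k Up) \<union> ?g ` (d (k - 1) ` mono ` kcells N (k - 1) Up)) =
        bv.span (dproj k ` msets k)"
    proof (rule bv.span_subspace)
      have 1: "?g x = 0" if "x \<in> mono ` kcells N k Up" for x using that proj(4)[of _ "Suc k"] by auto
      have 2: "?g x = 0" if "x \<in> d (k - 1) ` mono ` kcells N (k - 1) Up" for x
        using that dd[of "k - 1"] bvp.linear_0[OF proj(1)] by (cases k) (auto simp: kcells_0)
      have 3: "bv.span (dproj k ` msets k) \<subseteq> bv.span (dproj k ` msets k \<union> ?g ` (mono ` kcells N k Up) \<union> ?g ` (d (k - 1) ` mono ` kcells N (k - 1) Up))"
        by (intro bv.span_mono) auto
      show "dproj k ` msets k \<union> ?g ` (mono ` kcells N k Up) \<union> ?g ` (d (k - 1) ` mono ` kcells N (k - 1) Up)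
          \<subseteq> bv.span (dproj k ` msets k)"
      proof (intro Un_least image_subsetI)
        show "dproj k x \<in> bv.span (dproj k ` msets k)" if "x \<in> msets k" for x
          using that by (intro bv.span_base imageI)
        show "?g x \<in> bv.span (dproj k ` msets k)" if "x \<in> mono ` kcells N k Up" for x
          unfolding 1[OF that] by (rule bv.span_zero)
        show "?g x \<in> bv.span (dproj k ` msets k)" if "x \<in> d (k - 1) ` mono ` kcells N (k - 1) Up" for x
          unfolding 2[OF that] by (rule bv.span_zero)
      qed
      show "bv.span (dproj k ` msets k) \<subseteq> bv.span (dproj k ` msets k \<union> ?g ` (mono ` kcells N k Up) \<union> ?g ` (d (k - 1) ` mono ` kcells N (k - 1) Up))"
        by (rule 3)
    qed (rule bv.subspace_span)
    finally show ?thesis .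
  qed
  moreover have "{x \<in> ?A. ?p x = 0} = bv.span ?U"
  proof (intro equalityI subsetI)
    fix x assume "x \<in> bv.span ?U"
    moreover have "bv.span ?U \<subseteq> ?A"
      unfolding A by (intro bv.span_mono image_mono) (auto simp: gen_image)
    moreover have "?p ` bv.span ?U = {0}"
    proof -
      have "?p ` bv.span ?U = bv.span (?p ` ?U)" by (rule blinear_span[OF proj(1), symmetric])
      also have "\<dots> = bv.span {0}"
      proof (cases "kcells N k Up = {}")
        case True
        then show ?thesis by simp
      next
        case False
        then have "?p ` ?U = {0}" using proj(4)[of _ "Suc k"] by force
        then show ?thesis by (simp only:)
      qed
      finally show ?thesis by simp
    qed
    ultimately show "x \<in> {x \<in> ?A. ?p x = 0}" by blast
  next
    fix x assume x: "x \<in> {x \<in> ?A. ?p x = 0}"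
    then obtain f where f: "x = d k f" by blast
    have "x \<in> bv.span (gen (Suc k) ` idx (Suc k))" unfolding span_gen f by (rule coboundary_cochains)
    then obtain p y z where xs: "x = p + y + z" "p \<in> bv.span (base ` msets (Suc k))"
        "y \<in> bv.span (mono ` kcells N (Suc k) Up)" "z \<in> bv.span ?U"
      unfolding gen_image bv.span_Un by auto
    have "?p y = 0" "?p z = 0"
    proof -
      have "?p ` bv.span (mono ` kcells N (Suc k) Up) = bv.span (?p ` mono ` kcells N (Suc k) Up)"
        by (rule blinear_span[OF proj(1), symmetric])
      also have "\<dots> \<subseteq> bv.span {0}" using proj(3)[of _ "Suc k"] by (intro bv.span_mono) auto
      finally show "?p y = 0" using xs(3) by auto
      have "?p ` bv.span ?U = bv.span (?p ` ?U)" by (rule blinear_span[OF proj(1), symmetric])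
      also have "\<dots> \<subseteq> bv.span {0}" using proj(4)[of _ "Suc k"] by (intro bv.span_mono) auto
      finally show "?p z = 0" using xs(4) by auto
    qed
    then have pp: "?p p = 0" using x by (simp add: xs(1) blinear_add[OF proj(1)])
    have "2 ^ card (base ` msets (Suc k)) \<le> card (bv.span (?p ` base ` msets (Suc k)))"
    proof -
      have "?p ` base ` msets (Suc k) = bunit ` msets (Suc k)" using proj(2) by force
      then have "card (bv.span (?p ` base ` msets (Suc k))) = 2 ^ card (msets (Suc k))"
        by (simp add: span_bunit card_bsupp)
      then show ?thesis by (simp add: card_image_le)
    qed
    then have "p = 0" by (rule blinear_inj_of_card[OF proj(1) _ _ xs(2) pp, rotated]) simp
    \<comment> \<open>Both \<open>x\<close> and \<open>z\<close> are coboundaries, so the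
      \<open>Up\<close> part \<open>y\<close> is a cocycle, and injectivity of the coboundary on
      \<open>Up\<close> cells forces \<open>y = 0\<close>.\<close>
    have "d (Suc k) z = 0"
    proof -
      have "d (Suc k) ` bv.span ?U = bv.span (d (Suc k) ` ?U)"
        by (rule blinear_span[OF blinear_coboundary, symmetric])
      also have "\<dots> \<subseteq> bv.span {0}" using dd by (intro bv.span_mono) auto
      finally show ?thesis using xs(4) by auto
    qed
    moreover have "d (Suc k) x = 0" unfolding f by (rule dd)
    ultimately have dy: "d (Suc k) y = 0"
      using \<open>p = 0\<close> by (simp add: xs(1) blinear_add[OF blinear_coboundary])
    have "2 ^ card (mono ` kcells N (Suc k) Up) \<le> card (bv.span (d (Suc k) ` mono ` kcells N (Suc k) Up))"
      by (simp add: card_bspan_dUp card_image_le)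
    then have "y = 0" by (rule blinear_inj_of_card[OF blinear_coboundary _ _ xs(3) dy, rotated]) simp
    then show "x \<in> bv.span ?U" using xs \<open>p = 0\<close> by simp
  qed
  ultimately show ?thesis by (simp add: card_bspan_dUp)
qed


section \<open>The leading term of the reduced coboundary\<close>

definition pt :: "nat set \<Rightarrow> 'a" where
  "pt S = inv_into (carrier G) c S"

lemma pt: "S \<subseteq> {..<N} \<Longrightarrow> pt S \<in> carrier G" "S \<subseteq> {..<N} \<Longrightarrow> c (pt S) = S"
  using coord_bij unfolding pt_def by (auto simp: bij_betw_def f_inv_into_f intro!: inv_into_into)

text \<open>For a word \<open>u\<close> this is the coefficient of the cell \<open>map (\<lambda>v. {v}) u\<close> in a polynomial cochain.\<close>

fun coef :: "nat list \<Rightarrow> ('a list \<Rightarrow> bit) \<Rightarrow> bit" where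
  "coef [] f = f []"
| "coef (v # u) f = coef u (\<lambda>gs. f (pt {} # gs) + f (pt {v} # gs))"

lemma coef_add: "coef u (f + g) = coef u f + coef u g"
proof (induction u arbitrary: f g)
  case (Cons v u)
  have "(\<lambda>gs. (f + g) (pt {} # gs) + (f + g) (pt {v} # gs)) =
      (\<lambda>gs. f (pt {} # gs) + f (pt {v} # gs)) + (\<lambda>gs. g (pt {} # gs) + g (pt {v} # gs))"
    by (auto simp: fun_eq_iff ac_simps)
  then show ?case by (simp only: coef.simps Cons.IH)
qed simp

lemma coef_scale: "coef u (bscale b f) = b * coef u f"
proof -
  have "coef u 0 = 0" using coef_add[of u 0 0] by simp
  then show ?thesis by (cases b) auto
qed

lemma coef_ext: "v < N \<Longrightarrow> coef (v # u) (ext S f) = of_bool (S = {v}) * coef u f"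
proof -
  assume v: "v < N"
  have "mon S (pt {}) + mon S (pt {v}) = of_bool (S = {v})"
    using v by (auto simp: mon_def pt(2) subset_singleton_iff)
  moreover have "(\<lambda>gs. ext S f (pt {} # gs) + ext S f (pt {v} # gs)) = bscale (mon S (pt {}) + mon S (pt {v})) f"
    using v by (auto simp: fun_eq_iff bscale_def pt(1) distrib_right)
  ultimately show ?thesis by (simp add: coef_scale)
qed

lemma coef_mono: "set u \<subseteq> {..<N} \<Longrightarrow> coef u (mono \<sigma>) = of_bool (\<sigma> = map (\<lambda>v. {v}) u)"
proof (induction u arbitrary: \<sigma>)
  case Nil
  then show ?case by (cases \<sigma>) auto
next
  case (Cons v u)
  then show ?case
  proof (cases \<sigma>)
    case Nil
    have "(\<lambda>gs. mono [] (pt {} # gs) + mono [] (pt {v} # gs)) = bscale 0 (mono [])"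
      by (auto simp: fun_eq_iff)
    then have "coef (v # u) (mono []) = 0" unfolding coef.simps by (simp only: coef_scale mult_zero_left)
    then show ?thesis by (simp add: Nil del: coef.simps)
  next
    fix S \<rho> assume "\<sigma> = S # \<rho>"
    then show ?thesis using Cons by (simp add: coef_ext del: coef.simps)
  qed
qed

text \<open>Summing over all orderings of \<open>M\<close> makes the coefficient blind to leading
  terms of coboundaries, in which a split and its reversal occur together. This gives an explicit
  formula for the leading part of \<open>proj\<close>, which itself was only obtained
  abstractly.\<close>

definition symcoef :: "('a list \<Rightarrow> bit) \<Rightarrow> nat multiset \<Rightarrow> bit" where
  "symcoef f M = (if set_mset M \<subseteq> {..<N} then \<Sum>u\<in>permutations_of_multiset M. coef u f else 0)"

lemma blinear_symcoef: "blinear symcoef"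
  by (rule blinearI) (auto simp: symcoef_def fun_eq_iff coef_add sum.distrib)

lemma symcoef_add: "symcoef (f + g) M = symcoef f M + symcoef g M"
  unfolding blinear_add[OF blinear_symcoef] by (rule plus_fun_apply)

lemma symcoef_0: "symcoef 0 M = 0"
  by (subst bvp.linear_0[OF blinear_symcoef]) (rule zero_fun_apply)

lemma symcoef_mono:
  assumes "set_mset M \<subseteq> {..<N}"
  shows "symcoef (mono \<sigma>) M = of_bool (\<exists>u. \<sigma> = map (\<lambda>v. {v}) u \<and> mset u = M)"
proof -
  have "symcoef (mono \<sigma>) M = (\<Sum>u\<in>permutations_of_multiset M. of_bool (\<sigma> = map (\<lambda>v. {v}) u))"
    using assms by (auto simp: symcoef_def coef_mono permutations_of_multiset_def intro!: sum.cong)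
  also have "\<dots> = of_bool (\<exists>u. \<sigma> = map (\<lambda>v. {v}) u \<and> mset u = M)"
  proof (cases "\<exists>u. \<sigma> = map (\<lambda>v. {v}) u \<and> mset u = M")
    case True
    then obtain u where u: "\<sigma> = map (\<lambda>v. {v}) u" "u \<in> permutations_of_multiset M"
      by (auto simp: permutations_of_multiset_def)
    have "\<sigma> = map (\<lambda>v. {v}) u' \<longleftrightarrow> u' = u" for u'
      using injD[OF inj_map_single, of u u'] u(1) by auto
    then have "(\<Sum>u\<in>permutations_of_multiset M. of_bool (\<sigma> = map (\<lambda>v. {v}) u)) =
        (\<Sum>u'\<in>permutations_of_multiset M. if u' = u then 1 else (0 :: bit))"
      by (intro sum.cong) auto
    then show ?thesis using True u(2) by simp
  next
    case False
    then have "(\<Sum>u\<in>permutations_of_multiset M. of_bool (\<sigma> = map (\<lambda>v. {v}) u)) = (0 :: bit)"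
      by (intro sum.neutral) (auto simp: permutations_of_multiset_def)
    then show ?thesis using False by (simp only: of_bool_eq(1))
  qed
  finally show ?thesis .
qed

lemma symcoef_word: "set u \<subseteq> {..<N} \<Longrightarrow> symcoef (mono (map (\<lambda>v. {v}) u)) = bunit (mset u)"
proof
  fix M assume u: "set u \<subseteq> {..<N}"
  show "symcoef (mono (map (\<lambda>v. {v}) u)) M = bunit (mset u) M"
  proof (cases "set_mset M \<subseteq> {..<N}")
    case True
    have "(\<exists>u'. map (\<lambda>v. {v}) u = map (\<lambda>v. {v}) u' \<and> mset u' = M) \<longleftrightarrow> M = mset u"
      using injD[OF inj_map_single, of u] by blast
    then show ?thesis by (simp only: symcoef_mono[OF True] bunit_def)
  next
    case False
    then show ?thesis using u by (auto simp: symcoef_def bunit_def)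
  qed
qed

lemma symcoef_ext:
  assumes M: "set_mset M \<subseteq> {..<N}"
  shows "symcoef (ext S f) M = (\<Sum>v\<in>set_mset M. of_bool (S = {v}) * symcoef f (M - {#v#}))"
proof (cases "M = {#}")
  case True
  then show ?thesis by (simp add: symcoef_def)
next
  case False
  have sub: "set_mset (M - X) \<subseteq> {..<N}" for X using M by (meson in_diffD subsetD subsetI)
  have "symcoef (ext S f) M = (\<Sum>u\<in>(\<Union>v\<in>set_mset M. (#) v ` permutations_of_multiset (M - {#v#})). coef u (ext S f))"
    using M by (simp add: symcoef_def permutations_of_multiset_nonempty[OF False])
  also have "\<dots> = (\<Sum>v\<in>set_mset M. \<Sum>u\<in>(#) v ` permutations_of_multiset (M - {#v#}). coef u (ext S f))"
    by (intro sum.UNION_disjoint) auto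
  also have "\<dots> = (\<Sum>v\<in>set_mset M. \<Sum>u\<in>permutations_of_multiset (M - {#v#}). coef (v # u) (ext S f))"
    by (simp only: sum.reindex[OF inj_on_Cons1] o_def)
  also have "\<dots> = (\<Sum>v\<in>set_mset M. of_bool (S = {v}) * symcoef f (M - {#v#}))"
  proof (rule sum.cong[OF HOL.refl])
    fix v assume "v \<in># M"
    then have "v < N" using M by auto
    then show "(\<Sum>u\<in>permutations_of_multiset (M - {#v#}). coef (v # u) (ext S f)) = of_bool (S = {v}) * symcoef f (M - {#v#})"
      by (simp only: coef_ext sum_distrib_left[symmetric] symcoef_def sub if_True)
  qed
  finally show ?thesis .
qed

lemma symcoef_ext_single:
  assumes "set_mset M \<subseteq> {..<N}"
  shows "symcoef (ext {v} f) M = (if v \<in># M then symcoef f (M - {#v#}) else 0)"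
proof -
  have "symcoef (ext {v} f) M = (\<Sum>v'\<in>set_mset M. if v = v' then symcoef f (M - {#v'#}) else 0)"
    unfolding symcoef_ext[OF assms] by (intro sum.cong) auto
  then show ?thesis by simp
qed

lemma symcoef_ext_zero:
  "set_mset M \<subseteq> {..<N} \<Longrightarrow> \<not> (\<exists>v. S = {v} \<and> v \<in># M) \<Longrightarrow> symcoef (ext S f) M = 0"
  using symcoef_ext[of M S f] by (auto intro!: sum.neutral)

lemma symcoef_mspan_zero:
  assumes "f \<in> mspan X" "set_mset M \<subseteq> {..<N}" "\<And>\<sigma>. \<sigma> \<in> X \<Longrightarrow> wt n \<sigma> \<noteq> zcount n M"
  shows "symcoef f M = 0"
proof -
  have "symcoef f \<in> symcoef ` mspan X" using assms(1) by blast
  also have "\<dots> = bv.span (symcoef ` mono ` X)" by (rule blinear_span[OF blinear_symcoef, symmetric])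
  also have "\<dots> \<subseteq> {g. g M = 0}"
  proof (rule bv.span_minimal)
    show "symcoef ` mono ` X \<subseteq> {g. g M = 0}"
    proof (intro image_subsetI CollectI)
      fix x assume "x \<in> mono ` X"
      then obtain \<sigma> where \<sigma>: "\<sigma> \<in> X" "x = mono \<sigma>" by blast
      have "\<not> (\<exists>u. \<sigma> = map (\<lambda>v. {v}) u \<and> mset u = M)"
        using assms(3)[OF \<sigma>(1)] wt_word by auto
      then show "symcoef x M = 0" unfolding \<sigma>(2) symcoef_mono[OF assms(2)] by simp
    qed
    show "bv.subspace {g. g M = 0}" by (auto simp: bv.subspace_def bscale_def)
  qed
  finally show ?thesis by simp
qed

lemma sum_complement_cancel:
  fixes g :: "nat set \<Rightarrow> bit"
  assumes S: "finite S" "S \<noteq> {}" and g: "\<And>A. A \<subseteq> S \<Longrightarrow> g (S - A) = g A"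
  shows "(\<Sum>A\<in>Pow S - {{}, S}. g A) = 0"
proof -
  obtain s where s: "s \<in> S" using S by blast
  let ?X = "{A. A \<subseteq> S \<and> A \<noteq> {} \<and> A \<noteq> S \<and> s \<in> A}" and ?Y = "{A. A \<subseteq> S \<and> A \<noteq> {} \<and> A \<noteq> S \<and> s \<notin> A}"
  have eq: "Pow S - {{}, S} = ?X \<union> ?Y" by auto
  have fin: "finite ?X" "finite ?Y" using S by auto
  have "(\<Sum>A\<in>?Y. g A) = (\<Sum>A\<in>?X. g A)"
    by (rule sum.reindex_bij_witness[of _ "\<lambda>A. S - A" "\<lambda>A. S - A"]) (use s g in auto)
  then show ?thesis unfolding eq using fin by (subst sum.union_disjoint) auto
qed

text \<open>The leading part of \<open>dmon S\<close> is invariant under exchanging \<open>A\<close>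
  and \<open>S - A\<close>, so its symmetrised coefficients cancel in pairs; all remaining terms of
  \<open>dmon S\<close> weigh less than \<open>M\<close>. Coboundaries of the later blocks are
  treated by induction after removing a letter.\<close>

lemma symcoef_d_mono:
  assumes "\<sigma> \<in> cells N k" "set_mset M \<subseteq> {..<N}" "wt n \<sigma> \<le> zcount n M"
  shows "symcoef (d k (mono \<sigma>)) M = 0"
  using assms
proof (induction \<sigma> arbitrary: k M)
  case Nil
  then have "k = 0" by simp
  then show ?case unfolding coboundary_0 by (simp only: coboundary_0 symcoef_0)
next
  case (Cons S \<sigma>)
  then obtain j where j: "k = Suc j" "\<sigma> \<in> cells N j" "S \<subseteq> {..<N}"
    by (auto simp: cells_Cons)
  have fin: "finite S" using j(3) by (rule finite_block)
  have "symcoef (ext S (d j (mono \<sigma>))) M = 0"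
  proof (cases "\<exists>v. S = {v} \<and> v \<in># M")
    case True
    then obtain v where v: "S = {v}" "v \<in># M" by auto
    have "set_mset (M - {#v#}) \<subseteq> {..<N}" using Cons.prems(2) by (meson in_diffD subsetD subsetI)
    moreover have "wt n \<sigma> \<le> zcount n (M - {#v#})"
      using Cons.prems(3) zcount_remove[OF v(2), of n] by (simp add: v(1) zw_def split: if_splits)
    ultimately show ?thesis using Cons.IH[OF j(2)] Cons.prems(2) v by (simp add: symcoef_ext_single)
  next
    case False
    then show ?thesis using symcoef_ext_zero[OF Cons.prems(2)] by blast
  qed
  moreover have "symcoef (ext2 (dmon S) (mono \<sigma>)) M = 0"
  proof (cases "S = {}")
    case True
    have "\<not> (\<exists>u. {} # {} # \<sigma> = map (\<lambda>v. {v}) u \<and> mset u = M)"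
      by (auto simp: Cons_eq_map_conv)
    then show ?thesis unfolding True dmon_empty ext2_mon2 symcoef_mono[OF Cons.prems(2)] by simp
  next
    case False
    let ?\<Sigma> = "\<Sum>A\<in>Pow S - {{}, S}. mono (A # (S - A) # \<sigma>)"
    have "ext2 (dmon S) (mono \<sigma>) + ?\<Sigma> \<in> mspan {\<tau>. wt n \<tau> < wt n (S # \<sigma>)}"
      by (rule ext2_dmon[OF j(3) False]) simp
    then have "symcoef (ext2 (dmon S) (mono \<sigma>) + ?\<Sigma>) M = 0"
      by (rule symcoef_mspan_zero[OF _ Cons.prems(2)]) (use Cons.prems(3) in auto)
    moreover have "symcoef ?\<Sigma> M = 0"
    proof -
      have "symcoef ?\<Sigma> M = (\<Sum>A\<in>Pow S - {{}, S}. symcoef (mono (A # (S - A) # \<sigma>)) M)"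
        unfolding bvp.linear_sum[OF blinear_symcoef] by (rule sum_fun_apply)
      also have "\<dots> = 0"
      proof (rule sum_complement_cancel[OF fin False])
        fix A assume A: "A \<subseteq> S"
        have swap: "(\<exists>u. X # Y # \<sigma> = map (\<lambda>v. {v}) u \<and> mset u = M) \<Longrightarrow>
            (\<exists>u. Y # X # \<sigma> = map (\<lambda>v. {v}) u \<and> mset u = M)" for X Y
        proof -
          assume "\<exists>u. X # Y # \<sigma> = map (\<lambda>v. {v}) u \<and> mset u = M"
          then obtain x y u where "X = {x}" "Y = {y}" "\<sigma> = map (\<lambda>v. {v}) u" "mset (x # y # u) = M"
            by (auto simp: Cons_eq_map_conv)
          then show ?thesis by (intro exI[of _ "y # x # u"]) (auto simp: add_mset_commute)
        qed
        have "S - (S - A) = A" using A by auto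
        moreover have "(\<exists>u. (S - A) # A # \<sigma> = map (\<lambda>v. {v}) u \<and> mset u = M) \<longleftrightarrow>
            (\<exists>u. A # (S - A) # \<sigma> = map (\<lambda>v. {v}) u \<and> mset u = M)"
          by (rule iffI) (erule swap)+
        ultimately show "symcoef (mono ((S - A) # (S - (S - A)) # \<sigma>)) M = symcoef (mono (A # (S - A) # \<sigma>)) M"
          unfolding symcoef_mono[OF Cons.prems(2)] by (simp only:)
      qed
      finally show ?thesis .
    qed
    ultimately show ?thesis by (simp only: symcoef_add add_0_right)
  qed
  ultimately show ?case unfolding j(1) d_mono_Cons[OF j(2)] by (simp only: symcoef_add add_0_right)
qed

section \<open>The Koszul differential as leading term\<close>

definition quad :: "nat \<Rightarrow> nat multiset" where
  "quad v = {#\<alpha> v, \<beta> v#}"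

text \<open>The Koszul differential: each \<open>z\<^sub>v\<close> in the monomial \<open>M\<close> is replaced by \<open>x\<^bsub>\<alpha> v\<^esub> x\<^bsub>\<beta> v\<^esub>\<close>.\<close>

definition koszul :: "nat multiset \<Rightarrow> nat multiset \<Rightarrow> bit" where
  "koszul M M' = (\<Sum>v\<in>#M. of_bool (n \<le> v \<and> M' = M - {#v#} + quad v))"

text \<open>The Leibniz rule: either the new letter \<open>v\<close> is replaced, or it is kept and
  a letter of \<open>M\<close> is replaced.\<close>

lemma koszul_add:
  "koszul (add_mset v M) M' = of_bool (n \<le> v \<and> M' = M + quad v) + (if v \<in># M' then koszul M (M' - {#v#}) else 0)"
proof -
  have "(\<Sum>x\<in>#M. of_bool (n \<le> x \<and> M' = add_mset v M - {#x#} + quad x)) =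
      (if v \<in># M' then koszul M (M' - {#v#}) else 0 :: bit)"
  proof (cases "v \<in># M'")
    case True
    then obtain M'' where M': "M' = add_mset v M''" by (metis insert_DiffM)
    have "(\<Sum>x\<in>#M. of_bool (n \<le> x \<and> M' = add_mset v M - {#x#} + quad x)) = koszul M M''"
      unfolding koszul_def by (intro arg_cong[of _ _ sum_mset] image_mset_cong) (simp add: M' diff_union_swap2)
    then show ?thesis by (simp add: M')
  next
    case False
    have "(\<Sum>x\<in>#M. of_bool (n \<le> x \<and> M' = add_mset v M - {#x#} + quad x)) = (\<Sum>x\<in>#M. 0 :: bit)"
    proof (intro arg_cong[of _ _ sum_mset] image_mset_cong)
      fix x assume "x \<in># M"
      then have "v \<in># add_mset v M - {#x#} + quad x" by (simp add: diff_union_swap2)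
      with False have "M' \<noteq> add_mset v M - {#x#} + quad x" by auto
      then show "of_bool (n \<le> x \<and> M' = add_mset v M - {#x#} + quad x) = (0 :: bit)" by simp
    qed
    with False show ?thesis by simp
  qed
  then show ?thesis by (simp add: koszul_def)
qed

text \<open>On single letters \<open>dmon\<close> is exact, without terms of lower weight: zero for
  an x_i and one product of two letters for a z_v. So the identity with the Koszul differential
  needs no bound on the weight of \<open>M\<close>.\<close>

lemma symcoef_d_word:
  assumes "set u \<subseteq> {..<N}" "set_mset M \<subseteq> {..<N}"
  shows "symcoef (d (length u) (mono (map (\<lambda>v. {v}) u))) M = koszul (mset u) M"
  using assms
proof (induction u arbitrary: M)
  case Nil
  show ?case
    by (simp only: list.size(3) coboundary_0 symcoef_0 koszul_def mset.simps image_mset_empty sum_mset.empty)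
next
  case (Cons v u)
  let ?\<sigma> = "map (\<lambda>v. {v}) u"
  have cell: "?\<sigma> \<in> cells N (length u)" using Cons.prems(1) by (auto simp: cells_def)
  have v: "v < N" using Cons.prems(1) by simp
  have "symcoef (ext2 (dmon {v}) (mono ?\<sigma>)) M = of_bool (n \<le> v \<and> M = mset u + quad v)"
  proof (cases "n \<le> v")
    case True
    have "\<alpha> v < n" "\<beta> v < n" using quad_less[OF True v] by auto
    then have "set (\<alpha> v # \<beta> v # u) \<subseteq> {..<N}" using Cons.prems(1) n_le_N by auto
    from symcoef_word[OF this] show ?thesis
      using True v by (auto simp: dmon_single ext2_mon2 bunit_def quad_def simp del: mono.simps)
  next
    case False
    then have "ext2 (dmon {v}) (mono ?\<sigma>) = 0"
      using v bvp.linear_0[OF blinear_ext2] by (simp only: dmon_single if_False)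
    then show ?thesis using False by (simp only: symcoef_0 simp_thms of_bool_eq)
  qed
  moreover have "symcoef (ext {v} (d (length u) (mono ?\<sigma>))) M = (if v \<in># M then koszul (mset u) (M - {#v#}) else 0)"
  proof -
    have "set_mset (M - {#v#}) \<subseteq> {..<N}" using Cons.prems(2) by (meson in_diffD subsetD subsetI)
    then show ?thesis using Cons.IH Cons.prems by (simp add: symcoef_ext_single)
  qed
  ultimately show ?case
    unfolding list.map(2) list.size(4) add_Suc_right add_0_right d_mono_Cons[OF cell]
    by (simp only: symcoef_add koszul_add mset.simps)
qed

text \<open>Each term puts two letters of weight zero in place of some z_v; a word in the x_i alone
  is a cocycle.\<close>

lemma d_word_mspan:
  assumes "set u \<subseteq> {..<N}"
  shows "d (length u) (mono (map (\<lambda>v. {v}) u)) \<in>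
    mspan {\<tau> \<in> cells N (Suc (length u)). wt n \<tau> < zcount n (mset u)}"
  using assms
proof (induction u)
  case Nil
  show ?case by (simp only: list.size(3) coboundary_0 bv.span_zero)
next
  case (Cons v u)
  let ?\<sigma> = "map (\<lambda>v. {v}) u"
  let ?Y = "{\<tau> \<in> cells N (Suc (length (v # u))). wt n \<tau> < zcount n (mset (v # u))}"
  have cell: "?\<sigma> \<in> cells N (length u)" using Cons.prems by (auto simp: cells_def)
  have v: "v < N" using Cons.prems by simp
  have "ext {v} (d (length u) (mono ?\<sigma>)) \<in> mspan ?Y"
    using Cons.IH Cons.prems by (intro ext_mspan[where X = "{\<tau> \<in> cells N (Suc (length u)). wt n \<tau> < zcount n (mset u)}"])
      (auto simp: zw_def)
  moreover have "ext2 (dmon {v}) (mono ?\<sigma>) \<in> mspan ?Y"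
  proof (cases "n \<le> v")
    case True
    have "\<alpha> v < n" "\<beta> v < n" using quad_less[OF True v] by auto
    then have "{\<alpha> v} # {\<beta> v} # ?\<sigma> \<in> ?Y"
      using Cons.prems n_le_N True cell by (auto simp: zw_def wt_word)
    from mspan_base[OF this] show ?thesis
      using v True by (simp only: dmon_single if_True ext2_mon2)
  next
    case False
    then have "ext2 (dmon {v}) (mono ?\<sigma>) = 0"
      using v bvp.linear_0[OF blinear_ext2] by (simp only: dmon_single if_False)
    then show ?thesis by (simp only: bv.span_zero)
  qed
  ultimately have "ext2 (dmon {v}) (mono ?\<sigma>) + ext {v} (d (length u) (mono ?\<sigma>)) \<in> mspan ?Y"
    by (intro bv.span_add)
  then have "d (Suc (length u)) (mono ({v} # ?\<sigma>)) \<in> mspan ?Y" by (simp only: d_mono_Cons[OF cell])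
  then show ?case by (simp only: list.map(2) list.size(4) add_Suc_right add_0_right)
qed

lemma symcoef_Up: "\<sigma> \<in> kcells N k Up \<Longrightarrow> set_mset M \<subseteq> {..<N} \<Longrightarrow> symcoef (mono \<sigma>) M = 0"
proof -
  assume \<sigma>: "\<sigma> \<in> kcells N k Up" and M: "set_mset M \<subseteq> {..<N}"
  have no: "cls p (map (\<lambda>v. {v}) u) \<noteq> Up" for p u by (induction u arbitrary: p) auto
  have "\<not> (\<exists>u. \<sigma> = map (\<lambda>v. {v}) u \<and> mset u = M)"
    using \<sigma> no unfolding kcells_def by blast
  then show ?thesis unfolding symcoef_mono[OF M] by simp
qed

lemma kcell_word: "M \<in> msets k \<Longrightarrow> \<exists>u. kcell M = map (\<lambda>v. {v}) u \<and> mset u = M \<and> set u \<subseteq> {..<N} \<and> length u = k"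
proof -
  assume "M \<in> msets k"
  moreover have "length (sorted_list_of_multiset M) = size M"
    by (metis size_mset mset_sorted_list_of_multiset)
  ultimately show ?thesis
    by (intro exI[of _ "rev (sorted_list_of_multiset M)"]) (auto simp: kcell_def multisets_of_size_def)
qed

text \<open>Compare \<open>proj\<close> and \<open>symcoef\<close> on the basis elements of weight
  at most \<open>w\<close>. On critical cells both give the unit function, on \<open>Up\<close>
  cells both vanish, and on coboundaries of \<open>Up\<close> cells \<open>proj\<close> vanishes
  everywhere while \<open>symcoef\<close> vanishes at multisets of weight \<open>w\<close>.\<close>

lemma proj_leading:
  assumes f: "f \<in> mspan {\<tau> \<in> cells N k. wt n \<tau> \<le> w}" and M: "M \<in> msets k"
  shows "zcount n M > w \<Longrightarrow> proj k f M = 0" and "zcount n M = w \<Longrightarrow> proj k f M = symcoef f M"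
proof -
  have Msub: "set_mset M \<subseteq> {..<N}" using M by (simp add: multisets_of_size_def)
  let ?I = "{i \<in> idx k. wt n (snd i) \<le> w}"
  have "mspan {\<tau> \<in> cells N k. wt n \<tau> \<le> w} \<subseteq> bv.span (gen k ` ?I)"
  proof (intro bv.span_minimal bv.subspace_span image_subsetI)
    fix \<tau> assume \<tau>: "\<tau> \<in> {\<tau> \<in> cells N k. wt n \<tau> \<le> w}"
    then have "bv.span (gen k ` {i \<in> idx k. wt n (snd i) \<le> wt n \<tau>}) \<subseteq> bv.span (gen k ` ?I)"
      by (intro bv.span_mono image_mono) auto
    with mono_span_gen[of \<tau> k] \<tau> show "mono \<tau> \<in> bv.span (gen k ` ?I)" by blast
  qed
  with f have f': "f \<in> bv.span (gen k ` ?I)" by blast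
  have gens: "(zcount n M > w \<longrightarrow> proj k (gen k i) M = 0) \<and> (zcount n M = w \<longrightarrow> proj k (gen k i) M = symcoef (gen k i) M)"
    if i: "i \<in> ?I" for i
  proof -
    obtain t \<sigma> where ts: "i = (t, \<sigma>)" by (cases i)
    have wt: "wt n \<sigma> \<le> w" using i ts by simp
    consider "t = Crit" "\<sigma> \<in> kcells N k Crit" | "t = Up" "\<sigma> \<in> kcells N k Up" | "t = Down" "\<sigma> \<in> kcells N (k - 1) Up"
      using i ts by (auto simp: idx_def)
    then show ?thesis
    proof cases
      case 1
      then obtain M' where M': "M' \<in> msets k" "\<sigma> = kcell M'"
        using bij_betw_imp_surj_on[OF kcell_bij] by blast
      obtain u where u: "kcell M' = map (\<lambda>v. {v}) u" "mset u = M'" "set u \<subseteq> {..<N}"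
        using kcell_word[OF M'(1)] by blast
      have "symcoef (base M') = bunit M'" using symcoef_word[OF u(3)] u by simp
      moreover have "gen k i = base M'" using ts 1 M' by (simp add: gen_def)
      moreover have "zcount n M' \<le> w" using wt M'(2) wt_kcell by simp
      ultimately show ?thesis using proj(2)[OF M'(1)] by (auto simp: bunit_def)
    next
      case 2
      then show ?thesis using ts proj(3) symcoef_Up[OF _ Msub] by (simp add: gen_def)
    next
      case 3
      then have "\<sigma> \<in> cells N (k - 1)" by (simp add: kcells_def)
      then have "zcount n M = w \<Longrightarrow> symcoef (d (k - 1) (mono \<sigma>)) M = 0"
        using symcoef_d_mono[OF _ Msub] wt by simp
      moreover have "proj k (d (k - 1) (mono \<sigma>)) = 0" using 3 proj(4) by simp
      ultimately show ?thesis using ts 3 by (simp add: gen_def)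
    qed
  qed
  let ?T = "{f. (zcount n M > w \<longrightarrow> proj k f M = 0) \<and> (zcount n M = w \<longrightarrow> proj k f M = symcoef f M)}"
  have "bv.span (gen k ` ?I) \<subseteq> ?T"
  proof (rule bv.span_minimal)
    show "gen k ` ?I \<subseteq> ?T" using gens by auto
    show "bv.subspace ?T"
      unfolding bv.subspace_def
    proof (intro conjI ballI allI)
      show "0 \<in> ?T"
        by (simp only: mem_Collect_eq bvp.linear_0[OF proj(1)] bvp.linear_0[OF blinear_symcoef] zero_fun_apply simp_thms)
      show "x + y \<in> ?T" if "x \<in> ?T" "y \<in> ?T" for x y
        using that unfolding mem_Collect_eq blinear_add[OF proj(1)] blinear_add[OF blinear_symcoef] by simp
      show "bscale b x \<in> ?T" if "x \<in> ?T" for b x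
        using that unfolding mem_Collect_eq bvp.linear_scale[OF proj(1)] bvp.linear_scale[OF blinear_symcoef]
        by (simp add: bscale_def)
    qed
  qed
  with f' have "f \<in> ?T" by blast
  then show "zcount n M > w \<Longrightarrow> proj k f M = 0" and "zcount n M = w \<Longrightarrow> proj k f M = symcoef f M"
    by auto
qed

lemma dproj_zero:
  assumes M: "M \<in> msets k" "M' \<in> msets (Suc k)" "zcount n M \<le> zcount n M'"
  shows "dproj k M M' = 0"
proof -
  obtain u where u: "kcell M = map (\<lambda>v. {v}) u" "mset u = M" "set u \<subseteq> {..<N}" "length u = k"
    using kcell_word[OF M(1)] by blast
  have mem: "d k (base M) \<in> mspan {\<tau> \<in> cells N (Suc k). wt n \<tau> < zcount n M}"
    using d_word_mspan[OF u(3)] u by simp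
  show ?thesis
  \<comment> \<open>Weight zero is separate: no cell is lighter, so the coboundary is zero, while
    \<open>zcount n M - 1\<close> would truncate to 0.\<close>
  proof (cases "zcount n M = 0")
    case True
    have "d k (base M) = 0" using mem by (simp add: True)
    then show ?thesis by (simp add: dproj_def bvp.linear_0[OF proj(1)])
  next
    case False
    have "d k (base M) \<in> mspan {\<tau> \<in> cells N (Suc k). wt n \<tau> \<le> zcount n M - 1}"
      using mem by (rule mspan_mono[rotated]) auto
    moreover have "zcount n M' > zcount n M - 1" using M(3) False by simp
    ultimately show ?thesis unfolding dproj_def using M(2) by (intro proj_leading)
  qed
qed

lemma dproj_leading:
  assumes M: "M \<in> msets k" "M' \<in> msets (Suc k)" "zcount n M = Suc (zcount n M')"
  shows "dproj k M M' = koszul M M'"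
proof -
  obtain u where u: "kcell M = map (\<lambda>v. {v}) u" "mset u = M" "set u \<subseteq> {..<N}" "length u = k"
    using kcell_word[OF M(1)] by blast
  have mem: "d k (base M) \<in> mspan {\<tau> \<in> cells N (Suc k). wt n \<tau> < zcount n M}"
    using d_word_mspan[OF u(3)] u by simp
  have "d k (base M) \<in> mspan {\<tau> \<in> cells N (Suc k). wt n \<tau> \<le> zcount n M'}"
    using mem by (rule mspan_mono[rotated]) (auto simp: M(3))
  then have "dproj k M M' = symcoef (d k (base M)) M'"
    unfolding dproj_def using M(2) by (intro proj_leading(2)) auto
  also have "\<dots> = koszul M M'"
    using symcoef_d_word[OF u(3), of M'] u M(2) by (simp add: multisets_of_size_def)
  finally show ?thesis .
qed

lemma dproj_outside: "M' \<notin> msets (Suc k) \<Longrightarrow> M \<in> msets k \<Longrightarrow> dproj k M M' = 0"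
proof -
  assume M': "M' \<notin> msets (Suc k)" and M: "M \<in> msets k"
  have "d k (base M) \<in> bv.span (gen (Suc k) ` idx (Suc k))"
    unfolding span_gen by (rule coboundary_cochains)
  then have "dproj k M \<in> bv.span (proj (Suc k) ` gen (Suc k) ` idx (Suc k))"
    unfolding dproj_def blinear_span[OF proj(1)] by blast
  also have "\<dots> \<subseteq> bsupp (msets (Suc k))"
  proof (rule bv.span_minimal[OF _ subspace_bsupp])
    show "proj (Suc k) ` gen (Suc k) ` idx (Suc k) \<subseteq> bsupp (msets (Suc k))"
      unfolding gen_image using proj(2)[of _ "Suc k"] proj(3)[of _ "Suc k"] proj(4)[of _ "Suc k"]
      by (auto simp: bsupp_def bunit_def)
  qed
  finally show ?thesis using M' by (simp add: bsupp_def)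
qed


section \<open>Ranks of the reduced coboundary\<close>

definition kz :: "nat \<Rightarrow> nat \<Rightarrow> nat multiset set" where
  "kz k w = {M \<in> msets k. zcount n M = w}"

definition xsets :: "nat \<Rightarrow> nat multiset set" where
  "xsets k = multisets_of_size {..<n} k"

lemma finite_kz [simp]: "finite (kz k w)"
  by (simp add: kz_def)

lemma finite_xsets [simp]: "finite (xsets k)"
  by (simp add: xsets_def finite_multisets_of_size)

lemma zcount_eq_0_iff: "zcount n M = 0 \<longleftrightarrow> set_mset M \<subseteq> {..<n}"
  by (induction M) auto

lemma zcount_le_size: "zcount n M \<le> size M"
  unfolding zcount_def by (rule size_filter_mset_lesseq)

lemma kz_0: "kz k 0 = xsets k"
  using n_le_N by (auto simp: kz_def xsets_def multisets_of_size_def zcount_eq_0_iff)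

lemma kz_Suc_iff: "M \<in> kz (Suc k) (Suc w) \<longleftrightarrow> (\<exists>v M'. M = add_mset v M' \<and> n \<le> v \<and> v < N \<and> M' \<in> kz k w)"
proof
  assume M: "M \<in> kz (Suc k) (Suc w)"
  then have "\<not> set_mset M \<subseteq> {..<n}" by (simp add: kz_def zcount_eq_0_iff[symmetric])
  then obtain v where v: "v \<in># M" "n \<le> v" by force
  then obtain M' where M': "M = add_mset v M'" by (metis insert_DiffM)
  then show "\<exists>v M'. M = add_mset v M' \<and> n \<le> v \<and> v < N \<and> M' \<in> kz k w"
    using M v by (auto simp: kz_def multisets_of_size_def)
qed (auto simp: kz_def multisets_of_size_def)

lemma kz_1_iff: "M \<in> kz (Suc k) (Suc 0) \<longleftrightarrow> (\<exists>v X. M = add_mset v X \<and> n \<le> v \<and> v < N \<and> X \<in> xsets k)"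
  by (simp add: kz_Suc_iff kz_0)

lemma kz_2_iff: "M \<in> kz (Suc (Suc k)) 2 \<longleftrightarrow>
    (\<exists>u v X. M = add_mset u (add_mset v X) \<and> n \<le> u \<and> u < N \<and> n \<le> v \<and> v < N \<and> X \<in> xsets k)"
  unfolding numeral_2_eq_2 kz_Suc_iff kz_0 by blast

lemma quad_xsets: "n \<le> v \<Longrightarrow> v < N \<Longrightarrow> quad v \<in> xsets 2"
  using bij_betwE[OF quad_bij] by (auto simp: quad_def xsets_def)

lemma quad_inj: "n \<le> v \<Longrightarrow> v < N \<Longrightarrow> n \<le> u \<Longrightarrow> u < N \<Longrightarrow> quad v = quad u \<longleftrightarrow> v = u"
  using quad_bij unfolding quad_def bij_betw_def inj_on_def by (metis atLeastLessThan_iff)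

lemma quad_surj:
  assumes "a < n" "b < n"
  obtains v where "n \<le> v" "v < N" "quad v = {#a, b#}"
proof -
  have "{#a, b#} \<in> multisets_of_size {..<n} 2" using assms by (simp add: multisets_of_size_def)
  then have "{#a, b#} \<in> (\<lambda>v. {#\<alpha> v, \<beta> v#}) ` {n..<N}"
    using quad_bij by (simp add: bij_betw_def)
  then show ?thesis using that by (auto simp: quad_def)
qed

lemma xsets_add: "X \<in> xsets j \<Longrightarrow> Y \<in> xsets k \<Longrightarrow> X + Y \<in> xsets (j + k)"
  by (auto simp: xsets_def multisets_of_size_def)

lemma xsets_less: "X \<in> xsets k \<Longrightarrow> x \<in># X \<Longrightarrow> x < n"
  by (auto simp: xsets_def multisets_of_size_def)

text \<open>Any two letters of \<open>Q\<close> form some \<open>quad v\<close>, since all quadratic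
  monomials occur. This is why weight one hits everything of weight zero in degrees at least
  two.\<close>

lemma xsets_quad_split:
  assumes "Q \<in> xsets (Suc (Suc k))"
  obtains v X where "n \<le> v" "v < N" "X \<in> xsets k" "Q = X + quad v"
proof -
  have "size Q = Suc (Suc k)" using assms by (simp add: xsets_def multisets_of_size_def)
  then obtain a Q1 where Q1: "Q = add_mset a Q1" "size Q1 = Suc k"
    using size_eq_Suc_imp_eq_union[of Q "Suc k"] by auto
  then obtain b X where "Q1 = add_mset b X" using size_eq_Suc_imp_eq_union[of Q1 k] by auto
  with Q1 have Q: "Q = add_mset a (add_mset b X)" by simp
  then have "a < n" "b < n" "X \<in> xsets k" using assms by (auto simp: xsets_def multisets_of_size_def)
  moreover obtain v where "n \<le> v" "v < N" "quad v = {#a, b#}"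
    using quad_surj \<open>a < n\<close> \<open>b < n\<close> .
  ultimately show ?thesis using that[of v X] Q by simp
qed

lemma koszul_x: "set_mset X \<subseteq> {..<n} \<Longrightarrow> koszul X M = 0"
proof (induction X arbitrary: M)
  case empty
  show ?case by (simp add: koszul_def)
next
  case (add v X)
  then show ?case by (auto simp: koszul_add)
qed

lemma koszul_1:
  assumes "n \<le> v" "X \<in> xsets k"
  shows "koszul (add_mset v X) = bunit (X + quad v)"
proof -
  have "set_mset X \<subseteq> {..<n}" using assms(2) by (simp add: xsets_def multisets_of_size_def)
  then show ?thesis using assms(1) by (auto simp: fun_eq_iff koszul_add koszul_x bunit_def)
qed

lemma koszul_2:
  assumes "n \<le> u" "n \<le> v" "X \<in> xsets k"
  shows "koszul (add_mset u (add_mset v X)) = bunit (add_mset v (X + quad u)) + bunit (add_mset u (X + quad v))"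
proof
  fix M
  have "(if u \<in># M then koszul (add_mset v X) (M - {#u#}) else 0) = bunit (add_mset u (X + quad v)) M"
  proof -
    have "M = add_mset u (X + quad v) \<longleftrightarrow> u \<in># M \<and> M - {#u#} = X + quad v"
      by (auto dest: insert_DiffM)
    then show ?thesis unfolding koszul_1[OF assms(2,3)] bunit_def by simp
  qed
  then show "koszul (add_mset u (add_mset v X)) M = (bunit (add_mset v (X + quad u)) + bunit (add_mset u (X + quad v))) M"
    using assms(1) by (simp add: koszul_add[of u] bunit_def)
qed

lemma koszul_outside:
  assumes M: "M \<in> kz k w" and M': "M' \<notin> kz (Suc k) (w - 1)"
  shows "koszul M M' = 0"
proof -
  have "M' \<noteq> M - {#v#} + quad v" if v: "v \<in># M" "n \<le> v" for v
  proof
    assume eq: "M' = M - {#v#} + quad v"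
    obtain M0 where M0: "M = add_mset v M0" using v(1) by (metis insert_DiffM)
    have vN: "v < N" using M v by (auto simp: kz_def multisets_of_size_def)
    have "quad v \<in> kz 2 0" using quad_xsets[OF v(2) vN] by (simp add: kz_0)
    then have "M' \<in> kz (Suc k) (w - 1)"
      using M v(2) unfolding eq M0 by (auto simp: kz_def multisets_of_size_def)
    with M' show False ..
  qed
  then have "(\<Sum>v\<in>#M. of_bool (n \<le> v \<and> M' = M - {#v#} + quad v)) = (\<Sum>v\<in>#M. 0 :: bit)"
    by (intro arg_cong[of _ _ sum_mset] image_mset_cong) auto
  then show ?thesis by (simp add: koszul_def)
qed

section \<open>The weight filtration of the image\<close>

definition restr :: "nat \<Rightarrow> (nat multiset \<Rightarrow> bit) \<Rightarrow> nat multiset \<Rightarrow> bit" where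
  "restr w f M = (if zcount n M = w then f M else 0)"

lemma blinear_restr: "blinear (restr w)"
  by (rule blinearI) (auto simp: restr_def fun_eq_iff)

lemma dproj_vanish:
  assumes "M \<in> kz k w" "M' \<notin> msets (Suc k) \<or> w \<le> zcount n M'"
  shows "dproj k M M' = 0"
  using assms dproj_zero[of M k M'] dproj_outside[of M' k M] by (cases "M' \<in> msets (Suc k)") (auto simp: kz_def)

lemma dproj_0: "M \<in> kz k 0 \<Longrightarrow> dproj k M = 0"
  by (rule ext) (simp add: dproj_vanish[of M k 0])

lemma restr_dproj:
  assumes "M \<in> kz k (Suc w)"
  shows "restr w (dproj k M) = koszul M"
proof
  fix M'
  show "restr w (dproj k M) M' = koszul M M'"
  proof (cases "M' \<in> kz (Suc k) w")
    case True
    then show ?thesis using assms dproj_leading[of M k M'] by (simp add: restr_def kz_def)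
  next
    case False
    then show ?thesis
      using koszul_outside[OF assms, of M'] assms dproj_outside[of M' k M] by (auto simp: restr_def kz_def)
  qed
qed

lemma restr_dproj_less:
  assumes "M \<in> kz k w'" "w' \<le> w"
  shows "restr w (dproj k M) = 0"
  using assms by (auto simp: restr_def fun_eq_iff intro!: dproj_vanish[of M k w'])

text \<open>From weight one only weight zero can be reached, so the leading term is the whole
  reduced coboundary.\<close>

lemma dproj_1:
  assumes "n \<le> v" "v < N" "X \<in> xsets k"
  shows "dproj (Suc k) (add_mset v X) = bunit (X + quad v)"
proof -
  have M: "add_mset v X \<in> kz (Suc k) (Suc 0)" using assms by (auto simp: kz_1_iff)
  have "dproj (Suc k) (add_mset v X) = restr 0 (dproj (Suc k) (add_mset v X))"
    using dproj_vanish[OF M] by (auto simp: restr_def fun_eq_iff)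
  also have "\<dots> = koszul (add_mset v X)" by (rule restr_dproj[OF M])
  also have "\<dots> = bunit (X + quad v)" by (rule koszul_1[OF assms(1,3)])
  finally show ?thesis .
qed

abbreviation im :: "nat \<Rightarrow> nat \<Rightarrow> (nat multiset \<Rightarrow> bit) set" where
  "im k w \<equiv> bv.span (dproj k ` {M \<in> msets k. zcount n M \<le> w})"

lemma im_Suc: "{M \<in> msets k. zcount n M \<le> Suc w} = kz k (Suc w) \<union> {M \<in> msets k. zcount n M \<le> w}"
  by (auto simp: kz_def)

lemma im_1: "im (Suc k) 1 = bsupp (xsets (Suc (Suc k)))"
proof (rule bv.span_subspace)
  let ?X = "{M \<in> msets (Suc k). zcount n M \<le> 1}"
  show "dproj (Suc k) ` ?X \<subseteq> bsupp (xsets (Suc (Suc k)))"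
  proof (rule image_subsetI)
    fix M assume "M \<in> ?X"
    then consider "M \<in> kz (Suc k) 0" | "M \<in> kz (Suc k) (Suc 0)"
      by (auto simp: kz_def le_Suc_eq)
    then show "dproj (Suc k) M \<in> bsupp (xsets (Suc (Suc k)))"
    proof cases
      case 1
      show ?thesis unfolding dproj_0[OF 1] by (rule bv.subspace_0[OF subspace_bsupp])
    next
      case 2
      then obtain v X where v: "M = add_mset v X" "n \<le> v" "v < N" "X \<in> xsets k"
        by (auto simp: kz_1_iff)
      have "X + quad v \<in> xsets (k + 2)" using v by (intro xsets_add quad_xsets)
      then show ?thesis using v by (auto simp: dproj_1 bsupp_def bunit_def)
    qed
  qed
  have "bunit ` xsets (Suc (Suc k)) \<subseteq> dproj (Suc k) ` ?X"
  proof (rule image_subsetI)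
    fix Q assume "Q \<in> xsets (Suc (Suc k))"
    then obtain v X where v: "n \<le> v" "v < N" "X \<in> xsets k" "Q = X + quad v" by (rule xsets_quad_split)
    then have "add_mset v X \<in> kz (Suc k) (Suc 0)" by (auto simp: kz_1_iff)
    then have "add_mset v X \<in> ?X" by (auto simp: kz_def)
    moreover have "bunit Q = dproj (Suc k) (add_mset v X)" using v by (simp add: dproj_1)
    ultimately show "bunit Q \<in> dproj (Suc k) ` ?X" by blast
  qed
  then have "bv.span (bunit ` xsets (Suc (Suc k))) \<subseteq> bv.span (dproj (Suc k) ` ?X)"
    by (rule bv.span_mono)
  then show "bsupp (xsets (Suc (Suc k))) \<subseteq> bv.span (dproj (Suc k) ` ?X)"
    by (simp only: span_bunit finite_xsets)
qed (rule subspace_bsupp)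

lemma restr_im: "f \<in> im k w \<Longrightarrow> restr w f = 0"
proof -
  assume f: "f \<in> im k w"
  have "restr w ` im k w = bv.span (restr w ` dproj k ` {M \<in> msets k. zcount n M \<le> w})"
    by (rule blinear_span[OF blinear_restr, symmetric])
  also have "\<dots> \<subseteq> bv.span {0}"
  proof (rule bv.span_mono, safe)
    fix M assume "M \<in> msets k" "zcount n M \<le> w"
    then show "restr w (dproj k M) = 0" by (intro restr_dproj_less[of M k "zcount n M"]) (auto simp: kz_def)
  qed
  finally show ?thesis using f by auto
qed

text \<open>The assumption says that sources of weight \<open>Suc w\<close> add nothing beyond their
  leading terms: an image without component in weight \<open>w\<close> comes already from smaller
  weight. Rank plus nullity for \<open>restr w\<close> then splits off the Koszul rank.\<close>

lemma card_im_Suc: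
  assumes "\<And>f. f \<in> im k (Suc w) \<Longrightarrow> restr w f = 0 \<Longrightarrow> f \<in> im k w"
  shows "card (im k (Suc w)) = card (bv.span (koszul ` kz k (Suc w))) * card (im k w)"
proof -
  let ?S = "{M \<in> msets k. zcount n M \<le> Suc w}"
  have fin: "finite (im k (Suc w))" by (rule finite_bspan) simp
  have "restr w ` im k (Suc w) = bv.span (koszul ` kz k (Suc w))"
  proof -
    have "restr w ` im k (Suc w) = bv.span (restr w ` dproj k ` ?S)"
      by (rule blinear_span[OF blinear_restr, symmetric])
    also have "\<dots> = bv.span (koszul ` kz k (Suc w))"
    proof (rule bv.span_subspace)
      show "restr w ` dproj k ` ?S \<subseteq> bv.span (koszul ` kz k (Suc w))"
      proof (intro image_subsetI, elim imageE)
        fix x M assume M: "M \<in> ?S" and x: "x = dproj k M"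
        show "restr w x \<in> bv.span (koszul ` kz k (Suc w))"
        proof (cases "M \<in> kz k (Suc w)")
          case True
          then show ?thesis unfolding x restr_dproj[OF True] by (intro bv.span_base imageI)
        next
          case False
          then have "restr w x = 0"
            unfolding x using M by (intro restr_dproj_less[of M k "zcount n M"]) (auto simp: kz_def)
          then show ?thesis by (simp only: bv.span_zero)
        qed
      qed
      have "koszul ` kz k (Suc w) \<subseteq> restr w ` dproj k ` ?S"
      proof (rule image_subsetI)
        fix M assume M: "M \<in> kz k (Suc w)"
        then have "M \<in> ?S" by (simp add: kz_def)
        then show "koszul M \<in> restr w ` dproj k ` ?S"
          unfolding restr_dproj[OF M, symmetric] by (intro imageI)
      qed
      then show "bv.span (koszul ` kz k (Suc w)) \<subseteq> bv.span (restr w ` dproj k ` ?S)"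
        by (rule bv.span_mono)
    qed (rule bv.subspace_span)
    finally show ?thesis .
  qed
  moreover have "{f \<in> im k (Suc w). restr w f = 0} = im k w"
  proof -
    have "im k w \<subseteq> im k (Suc w)" by (intro bv.span_mono image_mono) auto
    then show ?thesis using assms restr_im[of _ k w] by auto
  qed
  ultimately show ?thesis using card_blinear_image[OF blinear_restr bv.subspace_span fin, of w] by simp
qed

lemma im_support: "f \<in> im k (Suc w) \<Longrightarrow> f M \<noteq> 0 \<Longrightarrow> M \<in> msets (Suc k) \<and> zcount n M \<le> w"
proof -
  assume f: "f \<in> im k (Suc w)" and M: "f M \<noteq> 0"
  have "im k (Suc w) \<subseteq> bsupp {M \<in> msets (Suc k). zcount n M \<le> w}"
  proof (intro bv.span_minimal subspace_bsupp image_subsetI)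
    fix M assume M: "M \<in> {M \<in> msets k. zcount n M \<le> Suc w}"
    then have "M \<in> kz k (zcount n M)" by (simp add: kz_def)
    show "dproj k M \<in> bsupp {M \<in> msets (Suc k). zcount n M \<le> w}"
      unfolding bsupp_def
    proof (intro CollectI allI impI)
      fix M' assume "M' \<notin> {M \<in> msets (Suc k). zcount n M \<le> w}"
      with M show "dproj k M M' = 0" by (intro dproj_vanish[OF \<open>M \<in> kz k (zcount n M)\<close>]) auto
    qed
  qed
  with f have "f \<in> bsupp {M \<in> msets (Suc k). zcount n M \<le> w}" by blast
  with M show ?thesis unfolding bsupp_def by blast
qed

text \<open>An image from weight at most two lives in weight at most one; if its part of weight one
  vanishes it lives in weight zero, all of which is the image from weight one by
  \<open>im_1\<close>.\<close>

lemma card_im_2: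
  "card (im (Suc k) 2) = card (bv.span (koszul ` kz (Suc k) 2)) * 2 ^ card (xsets (Suc (Suc k)))"
proof -
  have "card (im (Suc k) (Suc 1)) = card (bv.span (koszul ` kz (Suc k) (Suc 1))) * card (im (Suc k) 1)"
  proof (rule card_im_Suc)
    fix f assume f: "f \<in> im (Suc k) (Suc 1)" "restr 1 f = 0"
    have "f M = 0" if "M \<notin> xsets (Suc (Suc k))" for M
    proof (rule ccontr)
      assume nz: "f M \<noteq> 0"
      then have M: "M \<in> msets (Suc (Suc k))" "zcount n M \<le> 1" using im_support[OF f(1)] by auto
      have "zcount n M \<noteq> 1" using fun_cong[OF f(2), of M] nz by (auto simp: restr_def)
      then have "M \<in> kz (Suc (Suc k)) 0" using M by (simp add: kz_def)
      with that show False by (simp add: kz_0)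
    qed
    then show "f \<in> im (Suc k) 1" unfolding im_1 by (simp add: bsupp_def)
  qed
  then show ?thesis unfolding im_1 by (simp only: card_bsupp finite_xsets) (simp add: numeral_2_eq_2)
qed

text \<open>Here the remaining weight could be one, where not everything is hit. Injectivity of the
  Koszul differential helps instead: if the leading part vanishes, the contribution \<open>a\<close>
  of weight three is itself zero.\<close>

lemma card_im_3:
  assumes inj: "card (bv.span (koszul ` kz k 3)) = 2 ^ card (kz k 3)"
  shows "card (im k 3) = 2 ^ card (kz k 3) * card (im k 2)"
proof -
  have "card (im k (Suc 2)) = card (bv.span (koszul ` kz k (Suc 2))) * card (im k 2)"
  proof (rule card_im_Suc)
    fix f assume f: "f \<in> im k (Suc 2)" "restr 2 f = 0"
    then obtain a b where ab: "f = a + b" "a \<in> bv.span (dproj k ` kz k (Suc 2))" "b \<in> im k 2"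
      unfolding im_Suc image_Un bv.span_Un by auto
    have "restr 2 a = 0"
    proof -
      have "restr 2 f = restr 2 a + restr 2 b" unfolding ab(1) by (rule blinear_add[OF blinear_restr])
      then show ?thesis unfolding restr_im[OF ab(3)] f(2) by (simp only: add_0_right)
    qed
    have "restr 2 ` dproj k ` kz k (Suc 2) = koszul ` kz k (Suc 2)"
      unfolding image_image by (rule image_cong[OF HOL.refl]) (rule restr_dproj)
    then have "2 ^ card (dproj k ` kz k (Suc 2)) \<le> card (bv.span (restr 2 ` dproj k ` kz k (Suc 2)))"
      using inj by (simp add: card_image_le numeral_3_eq_3 numeral_2_eq_2)
    then have "a = 0"
      by (rule blinear_inj_of_card[OF blinear_restr _ _ ab(2) \<open>restr 2 a = 0\<close>, rotated]) simp
    then show "f \<in> im k 2" using ab by simp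
  qed
  then show ?thesis using inj by (simp add: numeral_3_eq_3 numeral_2_eq_2)
qed

lemma im_all: "k \<le> w \<Longrightarrow> bv.span (dproj k ` msets k) = im k w"
proof -
  assume "k \<le> w"
  then have "{M \<in> msets k. zcount n M \<le> w} = msets k"
    using zcount_le_size by (auto simp: multisets_of_size_def intro: order_trans)
  then show ?thesis by simp
qed


section \<open>The three Koszul ranks\<close>

lemma x_part: "X \<in> xsets k \<Longrightarrow> filter_mset (\<lambda>x. x < n) X = X"
  "X \<in> xsets k \<Longrightarrow> filter_mset (\<lambda>x. n \<le> x) X = {#}"
  using xsets_less by (auto simp: filter_mset_eq_conv not_le)

lemma z_part: "M \<in> kz k k \<Longrightarrow> filter_mset (\<lambda>x. n \<le> x) M = M" "M \<in> kz k k \<Longrightarrow> filter_mset (\<lambda>x. x < n) M = {#}"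
proof -
  assume M: "M \<in> kz k k"
  have "size (filter_mset (\<lambda>x. n \<le> x) M) = size M"
    using M by (simp add: kz_def multisets_of_size_def zcount_def)
  then show eq: "filter_mset (\<lambda>x. n \<le> x) M = M"
    by (metis multiset_filter_subset mset_subset_size nat_neq_iff subset_mset.le_imp_less_or_eq)
  have "n \<le> x" if "x \<in># M" for x using that eq by (metis mem_Collect_eq set_mset_filter Int_iff)
  then show "filter_mset (\<lambda>x. x < n) M = {#}" by (auto simp: filter_mset_eq_conv dest: leD)
qed

text \<open>The squares z_v^2 are cycles in characteristic 2. For u < v the monomial z_u q_v, with
  q_v the class of z_v, occurs in the boundary of z_u z_v and of no other pair, so the rank is the
  number of pairs.\<close>

lemma bspan_koszul_2_2: "card (bv.span (koszul ` kz 2 2)) = 2 ^ (\<Sum>i<N - n. i)"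
proof -
  define I where "I = (SIGMA v:{n..<N}. {n..<v})"
  define a where "a = (\<lambda>(v, u). koszul {#u, v#})"
  define p where "p = (\<lambda>(v, u). add_mset u (quad v))"
  have kos: "koszul {#u, v#} = bunit (add_mset v (quad u)) + bunit (add_mset u (quad v))"
    if "n \<le> u" "n \<le> v" for u v
    using koszul_2[OF that, of "{#}" 0] by (simp add: xsets_def)
  \<comment> \<open>The letters below \<open>n\<close> recover \<open>quad v\<close> and hence
    \<open>v\<close>; the letter from \<open>n\<close> on is \<open>u\<close>.\<close>
  have sep: "add_mset u (quad v) = add_mset u' (quad v') \<longleftrightarrow> u = u' \<and> v = v'"
    if "n \<le> u" "n \<le> v" "v < N" "n \<le> u'" "n \<le> v'" "v' < N" for u v u' v'
  proof
    assume eq: "add_mset u (quad v) = add_mset u' (quad v')"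
    have q: "quad v \<in> xsets 2" "quad v' \<in> xsets 2" using that by (auto intro: quad_xsets)
    have "quad v = quad v'"
      using arg_cong[OF eq, of "filter_mset (\<lambda>x. x < n)"] that by (simp add: x_part[OF q(1)] x_part[OF q(2)])
    moreover have "u = u'"
      using arg_cong[OF eq, of "filter_mset (\<lambda>x. n \<le> x)"] that by (simp add: x_part[OF q(1)] x_part[OF q(2)])
    ultimately show "u = u' \<and> v = v'" using that by (simp add: quad_inj)
  qed simp
  have dual: "a i (p j) = of_bool (i = j)" if "i \<in> I" "j \<in> I" for i j
  proof -
    obtain v u v' u' where ij: "i = (v, u)" "j = (v', u')" by (cases i; cases j)
    with that have "n \<le> u" "u < v" "v < N" "n \<le> u'" "u' < v'" "v' < N" by (auto simp: I_def)
    then show ?thesis by (auto simp: ij a_def p_def kos bunit_def sep)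
  qed
  have "finite I" by (simp add: I_def)
  have "card (bv.span (a ` I)) = 2 ^ card I"
    by (rule card_bspan_of_dual_points(1)[where p = p, OF \<open>finite I\<close> dual])
  moreover have "bv.span (koszul ` kz 2 2) = bv.span (a ` I)"
  proof (rule bv.span_subspace[OF _ _ bv.subspace_span])
    show "koszul ` kz 2 2 \<subseteq> bv.span (a ` I)"
    proof (rule image_subsetI)
      fix M assume "M \<in> kz 2 2"
      then obtain u v where M: "M = {#u, v#}" "n \<le> u" "u < N" "n \<le> v" "v < N"
        using kz_2_iff[of M 0, folded numeral_2_eq_2] by (auto simp: xsets_def)
      consider "u = v" | "u < v" | "v < u"
        by linarith
      then show "koszul M \<in> bv.span (a ` I)"
      proof cases
        case 1
        then have "koszul M = 0" unfolding M(1) kos[OF M(2,4)] by simp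
        then show ?thesis by (simp only: bv.span_zero)
      next
        case 2
        then have "(v, u) \<in> I" "koszul M = a (v, u)" using M by (auto simp: I_def a_def)
        then show ?thesis by (metis bv.span_base imageI)
      next
        case 3
        then have "(u, v) \<in> I" "koszul M = a (u, v)" using M by (auto simp: I_def a_def add_mset_commute)
        then show ?thesis by (metis bv.span_base imageI)
      qed
    qed
    have "a ` I \<subseteq> koszul ` kz 2 2"
    proof (rule image_subsetI)
      fix i assume "i \<in> I"
      then obtain v u where i: "i = (v, u)" "n \<le> u" "u < v" "v < N" by (auto simp: I_def)
      then have "{#u, v#} \<in> kz 2 2"
        by (intro iffD2[OF kz_2_iff[of _ 0, folded numeral_2_eq_2]] exI[of _ u] exI[of _ v] exI[of _ "{#}"])
          (auto simp: xsets_def)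
      then show "a i \<in> koszul ` kz 2 2" by (auto simp: i(1) a_def)
    qed
    then show "bv.span (a ` I) \<subseteq> bv.span (koszul ` kz 2 2)" by (rule bv.span_mono)
  qed
  moreover have "card I = (\<Sum>i<N - n. i)"
  proof -
    have "card I = (\<Sum>v\<in>{n..<N}. v - n)" by (simp add: I_def)
    also have "\<dots> = (\<Sum>i<N - n. i)"
      by (rule sum.reindex_bij_witness[of _ "\<lambda>i. i + n" "\<lambda>v. v - n"]) auto
    finally show ?thesis .
  qed
  ultimately show ?thesis by simp
qed

text \<open>The letters below \<open>n\<close> are those of \<open>quad s\<close> and determine
  \<open>s\<close>; the other letters then determine \<open>M\<close>.\<close>

lemma koszul_point:
  assumes M: "M \<in> kz k k" "s \<in># M" "s' \<in># M'" and M': "M' \<in> kz k k"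
  shows "M - {#s#} + quad s = M' - {#s'#} + quad s' \<longleftrightarrow> M = M' \<and> s = s'"
proof
  assume eq: "M - {#s#} + quad s = M' - {#s'#} + quad s'"
  have s: "n \<le> s" "s < N"
    using M(1,2) z_part(1)[OF M(1)] by (auto simp: kz_def multisets_of_size_def filter_mset_eq_conv)
  have s': "n \<le> s'" "s' < N"
    using M(3) M' z_part(1)[OF M'] by (auto simp: kz_def multisets_of_size_def filter_mset_eq_conv)
  have q: "quad s \<in> xsets 2" "quad s' \<in> xsets 2" using s s' by (auto intro: quad_xsets)
  have "quad s = quad s'"
    using arg_cong[OF eq, of "filter_mset (\<lambda>x. x < n)"] s s'
    by (simp add: x_part[OF q(1)] x_part[OF q(2)] z_part[OF M(1)] z_part[OF M'])
  then have ss: "s = s'" using s s' by (simp add: quad_inj)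
  have "M - {#s#} = M' - {#s'#}"
    using arg_cong[OF eq, of "filter_mset (\<lambda>x. n \<le> x)"] s s'
    by (simp add: x_part[OF q(1)] x_part[OF q(2)] z_part[OF M(1)] z_part[OF M'])
  then show "M = M' \<and> s = s'" using ss M(2,3) by (metis insert_DiffM)
qed simp

text \<open>A multiset of odd size contains some \<open>s\<close> with odd multiplicity, so replacing \<open>z\<^sub>s\<close> cannot cancel.\<close>

lemma bspan_koszul_odd:
  assumes "odd k"
  shows "card (bv.span (koszul ` kz k k)) = 2 ^ card (kz k k)"
proof -
  have ex: "\<exists>s. odd (count M s)" if "M \<in> kz k k" for M
  proof (rule ccontr)
    assume "\<nexists>s. odd (count M s)"
    then have "even (\<Sum>s\<in>set_mset M. count M s)" by (intro dvd_sum) auto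
    moreover have "size M = k" using that by (simp add: kz_def multisets_of_size_def)
    ultimately show False using assms by (simp add: size_multiset_overloaded_eq)
  qed
  define s where "s M = (SOME s. odd (count M s))" for M :: "nat multiset"
  have s: "odd (count M (s M))" if "M \<in> kz k k" for M unfolding s_def by (rule someI_ex[OF ex[OF that]])
  have sM: "s M \<in># M" if "M \<in> kz k k" for M using s[OF that] by (metis count_eq_zero_iff even_zero)
  define p where "p M = M - {#s M#} + quad (s M)" for M
  have "koszul M (p M') = of_bool (M = M')" if M: "M \<in> kz k k" and M': "M' \<in> kz k k" for M M'
  proof -
    have ge: "n \<le> v" if "v \<in># M" for v using that z_part(1)[OF M] by (auto simp: filter_mset_eq_conv)
    have "koszul M (p M') = (\<Sum>v\<in>#M. if v = s M' then of_bool (M = M') else 0)"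
      unfolding koszul_def
    proof (intro arg_cong[of _ _ sum_mset] image_mset_cong)
      fix v assume v: "v \<in># M"
      show "of_bool (n \<le> v \<and> p M' = M - {#v#} + quad v) = (if v = s M' then of_bool (M = M') else (0 :: bit))"
        using koszul_point[OF M' sM[OF M'] v M] ge[OF v] by (auto simp: p_def)
    qed
    also have "\<dots> = of_bool (M = M') * of_nat (count M (s M'))" by (simp add: sum_mset_delta)
    also have "\<dots> = of_bool (M = M')"
    proof (cases "M = M'")
      case True
      then obtain j where "count M (s M') = Suc (2 * j)" using s[OF M] by (metis oddE Suc_eq_plus1)
      then show ?thesis using True by simp
    qed simp
    finally show ?thesis .
  qed
  then show ?thesis by (intro card_bspan_of_dual_points(1)[where p = p]) auto
qed

section \<open>Exactness of the Koszul complex at weight one in degree four\<close>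

lemma koszul_move:
  assumes "n \<le> u" "u < N" "n \<le> v" "v < N" "X \<in> xsets k"
  shows "bunit (add_mset v (X + quad u)) + bunit (add_mset u (X + quad v)) \<in>
    bv.span (koszul ` kz (Suc (Suc k)) 2)"
proof -
  have "add_mset u (add_mset v X) \<in> kz (Suc (Suc k)) 2" using assms kz_2_iff by blast
  then have "koszul (add_mset u (add_mset v X)) \<in> bv.span (koszul ` kz (Suc (Suc k)) 2)"
    by (intro bv.span_base imageI)
  then show ?thesis
    unfolding koszul_2[OF assms(1,3,5)] .
qed

text \<open>If the classes of z_v and z_v' have no common letter, then \<open>X\<close> contains
  \<open>quad v'\<close> and a single Koszul boundary suffices. If they share a letter, the two
  products differ by a linear syzygy times a quadratic monomial. Linear syzygies are no Koszul
  boundaries, but they become such after multiplication by a quadratic monomial, and degree three of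
  \<open>X\<close> leaves room for exactly one.\<close>

lemma koszul_connected:
  assumes v: "n \<le> v" "v < N" "X \<in> xsets 3" and v': "n \<le> v'" "v' < N" "X' \<in> xsets 3"
    and eq: "X + quad v = X' + quad v'"
  shows "bunit (add_mset v X) + bunit (add_mset v' X') \<in> bv.span (koszul ` kz 3 2)"
proof -
  note move = koszul_move[of _ _ _ 1, unfolded One_nat_def, folded numeral_3_eq_3]
  have size: "size X = 3" "size X' = 3" using v v' by (auto simp: xsets_def multisets_of_size_def)
  show ?thesis
  proof (cases "v = v'")
    case True
    then have "X = X'" using eq by simp
    then show ?thesis using True by (simp only: bit_fun_double bv.span_zero)
  next
    case False
    then have qne: "quad v \<noteq> quad v'" using v v' by (simp add: quad_inj)
    show ?thesis
    proof (cases "\<exists>s. s \<in># quad v \<and> s \<in># quad v'")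
      case False
      have "quad v' \<subseteq># X"
        unfolding subseteq_mset_def
      proof
        fix x
        have "count X x + count (quad v) x = count X' x + count (quad v') x"
          using arg_cong[OF eq, of "\<lambda>M. count M x"] by simp
        moreover have "count (quad v) x = 0 \<or> count (quad v') x = 0"
          using False by (auto simp: count_eq_zero_iff)
        ultimately show "count (quad v') x \<le> count X x" by auto
      qed
      then obtain Y where Y: "X = Y + quad v'" by (metis subset_mset.add_diff_inverse add.commute)
      then have "X' = Y + quad v" using eq by (simp add: ac_simps)
      moreover have "Y \<in> xsets (Suc 0)"
        using v(3) Y by (auto simp: xsets_def multisets_of_size_def quad_def)
      ultimately show ?thesis using move[of v' v Y] v v' by (simp only: Y)
    next
      case True
      then obtain s where "s \<in># quad v" "s \<in># quad v'" by auto
      then obtain b b' where b: "quad v = {#s, b#}" "quad v' = {#s, b'#}"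
        by (auto simp: quad_def add_mset_commute)
      have bb': "b \<noteq> b'" using qne b by auto
      have eq': "add_mset b X = add_mset b' X'" using eq b by simp
      then obtain Z where Z: "X = add_mset b' Z" "X' = add_mset b Z" using bb' by (auto simp: add_eq_conv_ex)
      then have "Z \<in> xsets 2" and bn: "b < n" "b' < n"
        using v(3) v'(3) by (auto simp: xsets_def multisets_of_size_def)
      obtain y Z1 where "Z = add_mset y Z1" "size Z1 = Suc 0"
        using \<open>Z \<in> xsets 2\<close> size_eq_Suc_imp_eq_union[of Z "Suc 0"]
        by (auto simp: xsets_def multisets_of_size_def numeral_2_eq_2)
      then obtain z where yz: "Z = {#y, z#}" using size_1_singleton_mset[of Z1] by auto
      then have "y < n" "z < n"
        using \<open>Z \<in> xsets 2\<close> by (auto simp: xsets_def multisets_of_size_def)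
      \<comment> \<open>With \<open>Z\<close> the class of z_w, both products move to z_w times the
        same monomial: z_v b' Z to z_w b' s b, and z_v' b Z to z_w b s b'.\<close>
      then obtain w where w: "n \<le> w" "w < N" "quad w = Z"
        using quad_surj[OF \<open>y < n\<close> \<open>z < n\<close>] yz by metis
      have "{#b'#} \<in> xsets (Suc 0)" "{#b#} \<in> xsets (Suc 0)"
        using bn by (auto simp: xsets_def multisets_of_size_def)
      then have "bunit (add_mset v ({#b'#} + quad w)) + bunit (add_mset w ({#b'#} + quad v)) \<in> bv.span (koszul ` kz 3 2)"
        "bunit (add_mset v' ({#b#} + quad w)) + bunit (add_mset w ({#b#} + quad v')) \<in> bv.span (koszul ` kz 3 2)"
        using move[of w v "{#b'#}"] move[of w v' "{#b#}"] v v' w by auto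
      from bv.span_add[OF this]
      have "bunit (add_mset v X) + bunit (add_mset w ({#b'#} + quad v)) +
          (bunit (add_mset v' X') + bunit (add_mset w ({#b#} + quad v'))) \<in> bv.span (koszul ` kz 3 2)"
        by (simp only: w(3) Z add_mset_add_single[symmetric] union_mset_add_mset_left add_0_left)
      moreover have "{#b#} + quad v' = {#b'#} + quad v" using b by (simp add: add_mset_commute)
      ultimately show ?thesis by (simp only: ac_simps bit_fun_double bit_fun_add_left add_0_right add_0_left)
    qed
  qed
qed

lemma kz_eq_image: "kz (Suc k) (Suc 0) = (\<lambda>(v, X). add_mset v X) ` ({n..<N} \<times> xsets k)"
  by (auto simp: set_eq_iff kz_1_iff image_iff) blast+

lemma add_mset_inj_on: "inj_on (\<lambda>(v, X). add_mset v X) ({n..<N} \<times> xsets k)"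
proof (rule inj_onI, clarsimp)
  fix v X v' X' assume *: "n \<le> v" "n \<le> v'" "X \<in> xsets k" "X' \<in> xsets k" "add_mset v X = add_mset v' X'"
  have "{#v#} = {#v'#}"
    using arg_cong[OF *(5), of "filter_mset (\<lambda>x. n \<le> x)"] *(1,2)
    by (simp add: x_part(2)[OF *(3)] x_part(2)[OF *(4)])
  then show "v = v' \<and> X = X'" using *(5) by simp
qed

text \<open>The next Koszul differential, from weight one in degree four to weight zero in degree
  five, as a linear map.\<close>

definition mult :: "(nat multiset \<Rightarrow> bit) \<Rightarrow> nat multiset \<Rightarrow> bit" where
  "mult f = (\<Sum>p\<in>{n..<N} \<times> xsets 3. bscale (f (add_mset (fst p) (snd p))) (bunit (snd p + quad (fst p))))"

lemma blinear_bscale_sum: "blinear (\<lambda>f. \<Sum>p\<in>P. bscale (f (a p)) (b p))"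
proof (rule blinearI)
  fix f g :: "'c \<Rightarrow> bit"
  have "(\<Sum>p\<in>P. bscale ((f + g) (a p)) (b p)) = (\<Sum>p\<in>P. bscale (f (a p)) (b p) + bscale (g (a p)) (b p))"
    by (rule sum.cong[OF HOL.refl]) (simp only: plus_fun_apply bv.scale_left_distrib)
  also have "\<dots> = (\<Sum>p\<in>P. bscale (f (a p)) (b p)) + (\<Sum>p\<in>P. bscale (g (a p)) (b p))"
    by (rule sum.distrib)
  finally show "(\<Sum>p\<in>P. bscale ((f + g) (a p)) (b p)) =
      (\<Sum>p\<in>P. bscale (f (a p)) (b p)) + (\<Sum>p\<in>P. bscale (g (a p)) (b p))" .
qed

lemma blinear_mult: "blinear mult"
  using blinear_bscale_sum[of "\<lambda>p. add_mset (fst p) (snd p)" "\<lambda>p. bunit (snd p + quad (fst p))" "{n..<N} \<times> xsets 3"]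
  by (simp only: mult_def[abs_def])

lemma mult_bunit:
  assumes "n \<le> v" "v < N" "X \<in> xsets 3"
  shows "mult (bunit (add_mset v X)) = bunit (X + quad v)"
proof -
  have "mult (bunit (add_mset v X)) = (\<Sum>p\<in>{n..<N} \<times> xsets 3. if p = (v, X) then bunit (X + quad v) else 0)"
    unfolding mult_def
  proof (rule sum.cong[OF HOL.refl])
    fix p assume p: "p \<in> {n..<N} \<times> xsets 3"
    have "add_mset (fst p) (snd p) = add_mset v X \<longleftrightarrow> p = (v, X)"
      using inj_onD[OF add_mset_inj_on, of p "(v, X)" 3] p assms by (auto simp: case_prod_unfold)
    then show "bscale (bunit (add_mset v X) (add_mset (fst p) (snd p))) (bunit (snd p + quad (fst p))) =
        (if p = (v, X) then bunit (X + quad v) else 0)"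
      by (auto simp: bunit_def[of "add_mset v X"])
  qed
  also have "\<dots> = bunit (X + quad v)" using assms by (subst sum.delta) auto
  finally show ?thesis .
qed

text \<open>Exactness of the Koszul complex: the image is the kernel of multiplication \<open>z\<^sub>v x \<mapsto> x\<^bsub>\<alpha> v\<^esub> x\<^bsub>\<beta> v\<^esub> x\<close>.\<close>

lemma bspan_koszul_3_2:
  "card (bv.span (koszul ` kz 3 2)) * 2 ^ card (xsets 5) = 2 ^ (card (xsets 3) * (N - n))"
proof -
  let ?Im = "bv.span (koszul ` kz 3 2)"
  let ?B = "kz 4 1"
  have B: "?B = (\<lambda>(v, X). add_mset v X) ` ({n..<N} \<times> xsets 3)"
    using kz_eq_image[of 3] by (simp add: numeral_eq_Suc)
  have cardB: "card ?B = card (xsets 3) * (N - n)"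
    unfolding B card_image[OF add_mset_inj_on] by (simp add: card_cartesian_product)
  have img: "mult ` bsupp ?B = bsupp (xsets 5)"
  proof -
    have "mult ` bunit ` ?B = bunit ` xsets 5"
    proof
      show "mult ` bunit ` ?B \<subseteq> bunit ` xsets 5"
      proof (intro image_subsetI, elim imageE)
        fix x M assume "x = bunit M" "M \<in> ?B"
        then obtain v X where v: "x = bunit (add_mset v X)" "n \<le> v" "v < N" "X \<in> xsets 3"
          unfolding B by auto
        then have "X + quad v \<in> xsets (3 + 2)" by (intro xsets_add quad_xsets)
        with v show "mult x \<in> bunit ` xsets 5" by (auto simp: mult_bunit)
      qed
      show "bunit ` xsets 5 \<subseteq> mult ` bunit ` ?B"
      proof (rule image_subsetI)
        fix Q assume "Q \<in> xsets 5"
        then obtain v X where v: "n \<le> v" "v < N" "X \<in> xsets 3" "Q = X + quad v"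
          using xsets_quad_split[of Q 3] by (auto simp: numeral_eq_Suc)
        then have "bunit Q = mult (bunit (add_mset v X))" "add_mset v X \<in> ?B"
          unfolding B by (auto simp: mult_bunit)
        then show "bunit Q \<in> mult ` bunit ` ?B" by blast
      qed
    qed
    then show ?thesis using blinear_span[OF blinear_mult, of "bunit ` ?B"] by (simp add: span_bunit)
  qed
  have "card (bsupp ?B) = card (mult ` bsupp ?B) * card {f \<in> bsupp ?B. mult f = 0}"
    by (intro card_blinear_image blinear_mult subspace_bsupp card_bsupp) simp
  moreover have "{f \<in> bsupp ?B. mult f = 0} = ?Im"
  proof (intro equalityI subsetI)
    fix f assume f: "f \<in> ?Im"
    have "koszul ` kz 3 2 \<subseteq> {f \<in> bsupp ?B. mult f = 0}"
    proof (rule image_subsetI)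
      fix M assume M: "M \<in> kz 3 2"
      then obtain u v X where u: "M = add_mset u (add_mset v X)" "n \<le> u" "u < N" "n \<le> v" "v < N" "X \<in> xsets 1"
        using kz_2_iff[of M 1] by (auto simp: numeral_3_eq_3)
      have X: "X + quad u \<in> xsets 3" "X + quad v \<in> xsets 3"
        using xsets_add[OF u(6) quad_xsets] u by (auto simp: numeral_3_eq_3)
      have "mult (koszul M) = bunit (X + quad u + quad v) + bunit (X + quad v + quad u)"
        unfolding u(1) koszul_2[OF u(2,4,6)] blinear_add[OF blinear_mult]
        using u X by (simp only: mult_bunit)
      also have "\<dots> = 0" by (simp only: ac_simps bit_fun_double)
      finally have "mult (koszul M) = 0" .
      moreover have "koszul M \<in> bsupp ?B"
        using koszul_outside[OF M] by (simp add: bsupp_def numeral_eq_Suc)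
      ultimately show "koszul M \<in> {f \<in> bsupp ?B. mult f = 0}" by blast
    qed
    moreover have "bv.subspace {f \<in> bsupp ?B. mult f = 0}"
      unfolding bv.subspace_def
      using subspace_bsupp[of ?B] bvp.linear_0[OF blinear_mult] blinear_add[OF blinear_mult]
        bvp.linear_scale[OF blinear_mult]
      by (auto simp: bv.subspace_def)
    ultimately show "f \<in> {f \<in> bsupp ?B. mult f = 0}" using f bv.span_minimal by blast
  next
    fix f assume f: "f \<in> {f \<in> bsupp ?B. mult f = 0}"
    \<comment> \<open>\<open>rep\<close> chooses one product z_v X for each monomial of degree five,
      and \<open>h\<close> is the resulting linear section of \<open>mult\<close>. By
      \<open>koszul_connected\<close>, applying \<open>mult\<close> and then \<open>h\<close>
      changes nothing modulo the image, so a kernel element of \<open>mult\<close> lies in the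
      image.\<close>
    define rep where "rep Q = (SOME p. p \<in> {n..<N} \<times> xsets 3 \<and> snd p + quad (fst p) = Q)" for Q
    have rep: "rep (X + quad v) \<in> {n..<N} \<times> xsets 3 \<and> snd (rep (X + quad v)) + quad (fst (rep (X + quad v))) = X + quad v"
      if "n \<le> v" "v < N" "X \<in> xsets 3" for v X
      unfolding rep_def by (rule someI[of _ "(v, X)"]) (use that in auto)
    define h where "h \<phi> = (\<Sum>Q\<in>xsets 5. bscale (\<phi> Q) (bunit (add_mset (fst (rep Q)) (snd (rep Q)))))" for \<phi>
    have h: "blinear h" unfolding h_def by (rule blinear_bscale_sum)
    have h_unit: "h (bunit Q) = bunit (add_mset (fst (rep Q)) (snd (rep Q)))" if Q: "Q \<in> xsets 5" for Q
    proof -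
      have "h (bunit Q) = (\<Sum>Q'\<in>xsets 5. if Q' = Q then bunit (add_mset (fst (rep Q)) (snd (rep Q))) else 0)"
        unfolding h_def by (rule sum.cong[OF HOL.refl]) (auto simp: bunit_def[of Q])
      then show ?thesis using Q by (simp add: sum.delta)
    qed
    let ?T = "{f. f + h (mult f) \<in> ?Im}"
    have "bv.span (bunit ` ?B) \<subseteq> ?T"
    proof (rule bv.span_minimal)
      show "bunit ` ?B \<subseteq> ?T"
      proof (intro image_subsetI CollectI)
        fix M assume "M \<in> ?B"
        then obtain v X where v: "M = add_mset v X" "n \<le> v" "v < N" "X \<in> xsets 3" unfolding B by auto
        have "X + quad v \<in> xsets (3 + 2)" using v by (intro xsets_add quad_xsets)
        then have "h (mult (bunit M)) = bunit (add_mset (fst (rep (X + quad v))) (snd (rep (X + quad v))))"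
          using v by (simp add: mult_bunit h_unit)
        then show "bunit M + h (mult (bunit M)) \<in> ?Im"
          using koszul_connected[OF v(2-4), of "fst (rep (X + quad v))" "snd (rep (X + quad v))"] rep[OF v(2-4)]
          unfolding v(1) by (auto simp only: mem_Times_iff atLeastLessThan_iff)
      qed
      show "bv.subspace ?T"
        unfolding bv.subspace_def
      proof (intro conjI ballI allI CollectI)
        show "0 + h (mult 0) \<in> ?Im"
          unfolding bvp.linear_0[OF blinear_mult] bvp.linear_0[OF h] by (simp only: add_0_right bv.span_zero)
        show "x + y + h (mult (x + y)) \<in> ?Im" if "x \<in> ?T" "y \<in> ?T" for x y
        proof -
          have "(x + h (mult x)) + (y + h (mult y)) \<in> ?Im"
            using bv.span_add[of "x + h (mult x)" _ "y + h (mult y)"] that by blast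
          then show ?thesis unfolding blinear_add[OF blinear_mult] blinear_add[OF h] by (simp only: ac_simps)
        qed
        show "bscale b x + h (mult (bscale b x)) \<in> ?Im" if "x \<in> ?T" for b x
        proof -
          have "bscale b (x + h (mult x)) \<in> ?Im" using bv.span_scale[of "x + h (mult x)"] that by blast
          then show ?thesis
            unfolding bvp.linear_scale[OF blinear_mult] bvp.linear_scale[OF h] bv.scale_right_distrib .
        qed
      qed
    qed
    then have "f + h (mult f) \<in> ?Im" using f by (simp only: span_bunit finite_kz) blast
    moreover have "mult f = 0" using f by blast
    ultimately show "f \<in> ?Im" by (simp only: bvp.linear_0[OF h] add_0_right)
  qed
  ultimately show ?thesis by (simp only: img card_bsupp cardB finite_xsets finite_kz mult.commute)
qed


section \<open>Cohomology in degrees at most three\<close>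

lemma card_bspan_dproj_0: "card (bv.span (dproj 0 ` msets 0)) = 2 ^ 0"
proof -
  have "{#} \<in> kz 0 0" by (simp add: kz_def)
  then have "dproj 0 ` msets 0 = {0}" using dproj_0 by auto
  then show ?thesis by simp
qed

lemma card_bspan_dproj_1: "card (bv.span (dproj 1 ` msets 1)) = 2 ^ card (xsets 2)"
  using im_1[of 0] unfolding im_all[OF order_refl] by (simp add: card_bsupp numeral_2_eq_2)

lemma card_bspan_dproj_2: "card (bv.span (dproj 2 ` msets 2)) = 2 ^ ((\<Sum>i<N - n. i) + card (xsets 3))"
  using card_im_2[of 1, folded numeral_2_eq_2 Suc_1] bspan_koszul_2_2
  unfolding im_all[OF order_refl] by (simp add: power_add numeral_3_eq_3 numeral_2_eq_2)

text \<open>The factor \<open>2 ^ card (xsets 5)\<close> comes from exactness: in weight two the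
  rank is the number of products z_v X minus the number of monomials of degree five, and moving the
  latter to the left avoids a subtraction.\<close>

lemma card_bspan_dproj_3:
  "card (bv.span (dproj 3 ` msets 3)) * 2 ^ card (xsets 5) =
    2 ^ (card (kz 3 3) + card (xsets 3) * (N - n) + card (xsets 4))"
proof -
  have "card (im 3 3) = 2 ^ card (kz 3 3) * card (im 3 2)" by (intro card_im_3 bspan_koszul_odd) simp
  moreover have "card (im 3 2) = card (bv.span (koszul ` kz 3 2)) * 2 ^ card (xsets 4)"
    using card_im_2[of 2] by (simp add: numeral_eq_Suc)
  moreover have "im 3 3 = bv.span (dproj 3 ` msets 3)" by (rule im_all[symmetric]) simp
  ultimately show ?thesis using bspan_koszul_3_2 by (simp add: power_add ac_simps)
qed

lemma card_kcells_Crit: "card (kcells N k Crit) = card (msets k)"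
  using bij_betw_same_card[OF kcell_bij] by metis

lemma cocycles_eq: "cocycles G k = {f \<in> cochains G k. d k f = 0}"
  by (simp add: cocycles_def zero_fun_def)

lemma card_cocycles:
  assumes "card (bv.span (dproj k ` msets k)) = 2 ^ b"
  shows "2 ^ (b + card (kcells N k Up)) * card (cocycles G k) = 2 ^ card (cells N k)"
proof -
  have "card (cochains G k) = card (d k ` cochains G k) * card (cocycles G k)"
    unfolding cocycles_eq
    by (rule card_blinear_image[OF blinear_coboundary subspace_cochains finite_cochains])
  then show ?thesis by (simp add: card_cochains card_image_d assms power_add ac_simps)
qed

lemma cohom_dim_unique:
  assumes "card (cocycles G k) = 2 ^ h * card (coboundaries G k)" "card (coboundaries G k) > 0"
  shows "cohom_dim G k = h"
  unfolding cohom_dim_def using assms by (intro the_equality) auto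

lemma cohom_dim_0: "cohom_dim G 0 = 1"
proof (rule cohom_dim_unique)
  show "card (cocycles G 0) = 2 ^ 1 * card (coboundaries G 0)"
    using card_cocycles[OF card_bspan_dproj_0] by (simp add: coboundaries_def kcells_0)
qed (simp add: coboundaries_def)

text \<open>The \<open>Up\<close> cells of the two adjacent degrees contribute equally to the cells
  and to the ranks and cancel, leaving the critical cells minus the reduced ranks on both
  sides.\<close>

lemma cohom_dim_Suc:
  assumes a: "card (bv.span (dproj k ` msets k)) = 2 ^ a"
    and b: "card (bv.span (dproj (Suc k) ` msets (Suc k))) = 2 ^ b"
  shows "cohom_dim G (Suc k) + a + b = card (msets (Suc k))"
proof -
  let ?u = "card (kcells N k Up)" and ?u' = "card (kcells N (Suc k) Up)"
  have cob: "card (coboundaries G (Suc k)) = 2 ^ (a + ?u)"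
    by (simp add: coboundaries_def card_image_d a power_add)
  have cells: "card (cells N (Suc k)) = card (msets (Suc k)) + ?u' + ?u"
    using card_cells_kinds[of N k] by (simp add: card_kcells_Crit)
  \<comment> \<open>This inclusion yields \<open>a + b \<le> card (msets (Suc k))\<close>, so the
    dimension is a true difference of natural numbers.\<close>
  have "coboundaries G (Suc k) \<subseteq> cocycles G (Suc k)"
    using dd coboundary_cochains unfolding coboundaries_def cocycles_eq by auto
  moreover have "finite (cocycles G (Suc k))" using finite_cochains unfolding cocycles_eq by simp
  ultimately have "2 ^ (a + ?u) \<le> card (cocycles G (Suc k))"
    unfolding cob[symmetric] by (rule card_mono[rotated])
  then have "2 ^ (b + ?u') * 2 ^ (a + ?u) \<le> (2::nat) ^ card (cells N (Suc k))"
    unfolding card_cocycles[OF b, symmetric] by (rule mult_left_mono) simp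
  then have "(b + ?u') + (a + ?u) \<le> card (cells N (Suc k))"
    by (simp only: power_add[symmetric]) (simp add: power_increasing_iff)
  then have "a + b \<le> card (msets (Suc k))" using cells by linarith
  then obtain h where h: "card (msets (Suc k)) = a + b + h" using le_Suc_ex by blast
  have "2 ^ (b + ?u') * card (cocycles G (Suc k)) = 2 ^ (b + ?u') * 2 ^ (h + (a + ?u))"
    unfolding card_cocycles[OF b] cells h power_add[symmetric] by (simp only: ac_simps)
  then have "card (cocycles G (Suc k)) = 2 ^ (h + (a + ?u))" by simp
  then have "cohom_dim G (Suc k) = h" by (intro cohom_dim_unique) (simp_all add: cob power_add)
  then show ?thesis by (simp add: h)
qed

lemma card_xsets: "card (xsets k) = (n + k - 1) choose k"
  by (simp add: xsets_def card_multisets_of_size)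

lemma card_msets: "card (msets k) = (N + k - 1) choose k"
  by (simp add: card_multisets_of_size)

lemma card_kz_diag: "card (kz k k) = (N - n + k - 1) choose k"
proof -
  have "kz k k = multisets_of_size {n..<N} k"
  proof (intro equalityI subsetI)
    fix M assume M: "M \<in> kz k k"
    have "set_mset M \<subseteq> {n..<N}"
      using z_part(1)[OF M] M by (auto simp: kz_def multisets_of_size_def filter_mset_eq_conv)
    with M show "M \<in> multisets_of_size {n..<N} k" by (simp add: kz_def multisets_of_size_def)
  next
    fix M assume M: "M \<in> multisets_of_size {n..<N} k"
    then have "filter_mset (\<lambda>v. n \<le> v) M = M"
      by (auto simp: multisets_of_size_def filter_mset_eq_conv)
    with M show "M \<in> kz k k" by (auto simp: kz_def multisets_of_size_def zcount_def)
  qed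
  then show ?thesis by (simp add: card_multisets_of_size)
qed

lemma card_z: "N - n = card (xsets 2)"
  using bij_betw_same_card[OF quad_bij] by (simp add: xsets_def)

lemma cohom_dim_1: "cohom_dim G 1 = n"
  using cohom_dim_Suc[OF card_bspan_dproj_0, of "card (xsets 2)"] card_bspan_dproj_1 card_z n_le_N
  by (simp add: card_msets)

lemma cohom_dim_2:
  "cohom_dim G 2 + card (xsets 2) + ((\<Sum>i<N - n. i) + card (xsets 3)) = card (msets 2)"
  using cohom_dim_Suc[OF card_bspan_dproj_1, of "(\<Sum>i<N - n. i) + card (xsets 3)"] card_bspan_dproj_2
  by (simp add: numeral_2_eq_2)

lemma cohom_dim_3:
  "cohom_dim G 3 + ((\<Sum>i<N - n. i) + card (xsets 3)) +
    (card (kz 3 3) + card (xsets 3) * (N - n) + card (xsets 4)) = card (msets 3) + card (xsets 5)"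
proof -
  let ?e = "card (kz 3 3) + card (xsets 3) * (N - n) + card (xsets 4)"
  \<comment> \<open>A span has at least one element, hence the exponent \<open>?e\<close> is at
    least \<open>card (xsets 5)\<close> and the rank can be solved for.\<close>
  have "0 \<in> bv.span (dproj 3 ` msets 3)" "finite (bv.span (dproj 3 ` msets 3))"
    by (rule bv.span_zero, rule finite_bspan) simp
  then have "card (bv.span (dproj 3 ` msets 3)) > 0" by (auto simp: card_gt_0_iff)
  then have "2 ^ card (xsets 5) \<le> card (bv.span (dproj 3 ` msets 3)) * 2 ^ card (xsets 5)" by simp
  also have "\<dots> = 2 ^ ?e" by (rule card_bspan_dproj_3)
  finally have "card (xsets 5) \<le> ?e"
    by (simp add: power_increasing_iff)
  then obtain b where b: "?e = b + card (xsets 5)" by (metis le_add_diff_inverse2)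
  then have "card (bv.span (dproj 3 ` msets 3)) = 2 ^ b" using card_bspan_dproj_3 by (simp add: power_add)
  then show ?thesis
    using cohom_dim_Suc[OF card_bspan_dproj_2, of b] b by (simp add: numeral_3_eq_3 numeral_2_eq_2)
qed

end

section \<open>Coordinates on W(n)\<close>

lemma bit_eqI: "(a = 1 \<longleftrightarrow> b = 1) \<Longrightarrow> a = (b :: bit)"
  by (cases a; cases b) auto

section \<open>Invariants of words\<close>

lemma wrel_lists: "wrel n u v \<Longrightarrow> u \<in> lists {..<n} \<and> v \<in> lists {..<n}"
  by (induction rule: wrel.induct) auto

definition xco :: "nat \<Rightarrow> nat list \<Rightarrow> bit" where
  "xco i w = of_nat (count_list w i)"

text \<open>The number, modulo 2, of pairs of positions with letter \<open>i\<close> before letter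
  \<open>j\<close>: a Magnus coefficient of degree two. Pairs that straddle a concatenation give the
  cross term of \<open>zco_append\<close>.\<close>

fun zco :: "nat \<Rightarrow> nat \<Rightarrow> nat list \<Rightarrow> bit" where
  "zco i j [] = 0"
| "zco i j (a # w) = (if a = i then xco j w else 0) + zco i j w"

lemma xco_simps [simp]: "xco i [] = 0" "xco i (a # w) = (if a = i then 1 else 0) + xco i w"
  "xco i (u @ v) = xco i u + xco i v"
  by (simp_all add: xco_def)

lemma zco_append [simp]: "zco i j (u @ v) = zco i j u + zco i j v + xco i u * xco j v"
  by (induction u) (auto simp: algebra_simps)

text \<open>On a fourth power the counts are multiplied by 4 and the cross terms occur 6 times, both
  even. On \<open>w @ w\<close> every \<open>xco\<close> vanishes, so moving a square past
  \<open>v\<close> creates no cross term.\<close>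

lemma wrel_co: "wrel n u v \<Longrightarrow> (\<forall>i. xco i u = xco i v) \<and> (\<forall>i j. zco i j u = zco i j v)"
  by (induction rule: wrel.induct) (simp_all add: algebra_simps)

text \<open>A numbering of the quadratic monomials by the indices from \<open>n\<close> on; order
  inside a pair is an arbitrary choice, as \<open>swap_cen\<close> and \<open>zco_cen\<close> allow
  for both.\<close>

locale quadratic =
  fixes n N :: nat and \<alpha> \<beta> :: "nat \<Rightarrow> nat"
  assumes n_le_N: "n \<le> N"
    and quad_bij: "bij_betw (\<lambda>v. {#\<alpha> v, \<beta> v#}) {n..<N} (multisets_of_size {..<n} 2)"
begin

abbreviation eqv :: "nat list \<Rightarrow> nat list \<Rightarrow> bool" (infix "\<approx>" 50) where
  "u \<approx> v \<equiv> wrel n u v"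

abbreviation ws :: "nat list set" where
  "ws \<equiv> lists {..<n}"

lemmas eqv_trans [trans] = wrel.trans[of n]

lemma eqv_append: "u \<approx> u' \<Longrightarrow> v \<approx> v' \<Longrightarrow> u @ v \<approx> u' @ v'"
proof -
  assume uv: "u \<approx> u'" "v \<approx> v'"
  then have mem: "u \<in> ws" "u' \<in> ws" "v \<in> ws" "v' \<in> ws" using wrel_lists by blast+
  have "[] @ u @ v \<approx> [] @ u' @ v" using uv(1) by (rule wrel.cong) (use mem in auto)
  also have "[] @ u' @ v = u' @ v @ []" by simp
  also have "u' @ v @ [] \<approx> u' @ v' @ []" using uv(2) by (rule wrel.cong) (use mem in auto)
  finally show ?thesis by simp
qed

section \<open>Central words and normal forms\<close>

definition central :: "nat list \<Rightarrow> bool" where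
  "central w \<longleftrightarrow> w \<in> ws \<and> (\<forall>v\<in>ws. w @ v \<approx> v @ w) \<and> w @ w \<approx> []"

lemma central_square: "w \<in> ws \<Longrightarrow> central (w @ w)"
  unfolding central_def using wrel.sqcomm[of w n] wrel.fourth[of w n] by auto

lemma central_append: "central u \<Longrightarrow> central v \<Longrightarrow> central (u @ v)"
  unfolding central_def
proof (intro conjI ballI; elim conjE)
  assume u: "u \<in> ws" "\<forall>w\<in>ws. u @ w \<approx> w @ u" "u @ u \<approx> []"
    and v: "v \<in> ws" "\<forall>w\<in>ws. v @ w \<approx> w @ v" "v @ v \<approx> []"
  show "u @ v \<in> ws" using u v by simp
  show "(u @ v) @ w \<approx> w @ u @ v" if w: "w \<in> ws" for w
  proof -
    have "u @ v @ w \<approx> u @ w @ v" using v w u by (intro eqv_append[of u] wrel.refl) auto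
    also have "u @ w @ v = (u @ w) @ v" by simp
    also have "(u @ w) @ v \<approx> (w @ u) @ v" using u w v by (intro eqv_append[of _ _ v] wrel.refl) auto
    finally show ?thesis by simp
  qed
  have "(u @ v) @ (u @ v) = u @ (v @ u) @ v" by simp
  also have "u @ (v @ u) @ v \<approx> u @ (u @ v) @ v"
    using u v by (intro eqv_append[of u] eqv_append[of _ _ v] wrel.refl) auto
  also have "u @ (u @ v) @ v = (u @ u) @ (v @ v)" by simp
  also have "(u @ u) @ (v @ v) \<approx> [] @ []" using u v by (intro eqv_append)
  finally show "(u @ v) @ u @ v \<approx> []" by simp
qed

lemma central_Nil: "central []"
  by (auto simp: central_def intro!: wrel.refl)

text \<open>
  For \<open>a \<noteq> b\<close> the word \<open>(ab)(ab)(aa)(bb)\<close> represents the commutator of \<open>a\<close> and \<open>b\<close>; being a product of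
  squares it is visibly central of order two.
\<close>

definition cen :: "nat \<Rightarrow> nat list" where
  "cen v = (if \<alpha> v = \<beta> v then [\<alpha> v, \<alpha> v] else [\<alpha> v, \<beta> v, \<alpha> v, \<beta> v, \<alpha> v, \<alpha> v, \<beta> v, \<beta> v])"

definition cens :: "nat list \<Rightarrow> nat list" where
  "cens vs = concat (map cen vs)"

lemma cens_simps [simp]: "cens [] = []" "cens (v # vs) = cen v @ cens vs" "cens (us @ vs) = cens us @ cens vs"
  by (simp_all add: cens_def)

lemma quad_less: "v \<in> {n..<N} \<Longrightarrow> \<alpha> v < n \<and> \<beta> v < n"
proof -
  assume "v \<in> {n..<N}"
  then have "{#\<alpha> v, \<beta> v#} \<in> multisets_of_size {..<n} 2" using bij_betwE[OF quad_bij] by blast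
  then show ?thesis by (auto simp: multisets_of_size_def)
qed

lemma central_cen:
  assumes "v \<in> {n..<N}"
  shows "central (cen v)"
proof -
  have mem: "\<alpha> v < n" "\<beta> v < n" using quad_less[OF assms] by auto
  have sq: "central [a, a]" if "a < n" for a using central_square[of "[a]"] that by simp
  have "central ([\<alpha> v, \<beta> v, \<alpha> v, \<beta> v] @ [\<alpha> v, \<alpha> v] @ [\<beta> v, \<beta> v])"
    using central_square[of "[\<alpha> v, \<beta> v]"] mem by (intro central_append sq) auto
  then show ?thesis using sq mem by (simp add: cen_def)
qed

lemma central_cens: "set vs \<subseteq> {n..<N} \<Longrightarrow> central (cens vs)"
  by (induction vs) (simp_all add: central_append central_cen central_Nil)

lemma central_ws: "central c \<Longrightarrow> c \<in> ws"
  by (simp add: central_def)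

text \<open>The words \<open>cen v\<close> are central of order two, so equal factors can be brought
  together and cancelled in pairs.\<close>

lemma cens_even: "set vs \<subseteq> {n..<N} \<Longrightarrow> (\<And>v. even (count_list vs v)) \<Longrightarrow> cens vs \<approx> []"
proof (induction "length vs" arbitrary: vs rule: less_induct)
  case less
  show ?case
  proof (cases vs)
    case Nil
    then show ?thesis by (auto intro: wrel.refl)
  next
    case (Cons v us)
    have "odd (count_list us v)" using less.prems(2)[of v] Cons by simp
    then have "v \<in> set us" by (metis count_notin even_zero)
    then obtain p s where us: "us = p @ v # s" by (auto simp: in_set_conv_decomp)
    have cen: "central (cen v)" and p: "central (cens p)" and s: "central (cens s)"
      using less.prems(1) Cons us by (auto intro!: central_cens central_cen)
    have mem: "cen v \<in> ws" "cens p \<in> ws" "cens s \<in> ws"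
      using cen p s by (simp_all only: central_ws)
    then have mem2: "cens p @ cens s \<in> ws" by simp
    have comm: "cens p @ cen v \<approx> cen v @ cens p" and cen2: "cen v @ cen v \<approx> []"
      using cen p mem unfolding central_def by blast+
    have 1: "cens vs \<approx> cen v @ (cen v @ cens p) @ cens s"
      using eqv_append[OF wrel.refl[OF mem(1)] eqv_append[OF comm wrel.refl[OF mem(3)]]]
      by (simp add: Cons us)
    have 2: "cen v @ (cen v @ cens p) @ cens s \<approx> cens (p @ s)"
      using eqv_append[OF cen2 wrel.refl[OF mem2]] by simp
    have 3: "cens (p @ s) \<approx> []"
    proof (rule less.hyps)
      show "length (p @ s) < length vs" by (simp add: Cons us)
      show "set (p @ s) \<subseteq> {n..<N}" using less.prems(1) Cons us by auto
      show "even (count_list (p @ s) w)" for w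
        using less.prems(2)[of w] by (auto simp: Cons us split: if_splits)
    qed
    show ?thesis by (rule wrel.trans[OF 1 wrel.trans[OF 2 3]])
  qed
qed

text \<open>Put (ab)^4 in front of ba and move the central square bb past the last a.\<close>

lemma swap_letters:
  assumes "a < n" "b < n"
  shows "[b, a] \<approx> [a, b, a, b, a, b, a, a, b, b]"
proof -
  have "[] @ [b, a] \<approx> ([a, b] @ [a, b] @ [a, b] @ [a, b]) @ [b, a]"
    using assms by (intro eqv_append wrel.refl wrel.sym[OF wrel.fourth]) auto
  also have "([a, b] @ [a, b] @ [a, b] @ [a, b]) @ [b, a] = [a, b, a, b, a, b, a] @ ([b] @ [b] @ [a])" by simp
  also have "\<dots> \<approx> [a, b, a, b, a, b, a] @ ([a] @ [b] @ [b])"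
    using assms by (intro eqv_append[of "[a, b, a, b, a, b, a]"] wrel.refl wrel.sqcomm) auto
  finally show ?thesis by simp
qed

text \<open>If the pair is listed in the opposite order, \<open>swap_letters\<close> gives the
  relation with the two sides exchanged; as \<open>cen v\<close> has order two it can be carried to
  the other side.\<close>

lemma swap_cen:
  assumes "v \<in> {n..<N}" "{#\<alpha> v, \<beta> v#} = {#a, b#}" "a \<noteq> b"
  shows "[b, a] \<approx> [a, b] @ cen v"
proof -
  have ab: "a < n" "b < n" using quad_less[OF assms(1)] assms(2) by (auto simp: add_eq_conv_ex)
  consider "\<alpha> v = a" "\<beta> v = b" | "\<alpha> v = b" "\<beta> v = a"
    using assms(2) by (auto simp: add_eq_conv_ex)
  then show ?thesis
  proof cases
    case 1
    then show ?thesis using swap_letters[OF ab] assms(3) by (simp add: cen_def)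
  next
    case 2
    have cen: "central (cen v)" by (rule central_cen[OF assms(1)])
    have "[a, b] \<approx> [b, a] @ cen v" using swap_letters[OF ab(2,1)] assms(3) 2 by (simp add: cen_def)
    then have "[a, b] @ cen v \<approx> ([b, a] @ cen v) @ cen v"
      using central_ws[OF cen] by (intro eqv_append wrel.refl)
    also have "([b, a] @ cen v) @ cen v = [b, a] @ (cen v @ cen v)" by simp
    also have "\<dots> \<approx> [b, a] @ []"
      using cen ab by (intro eqv_append wrel.refl) (auto simp: central_def)
    finally show ?thesis by (simp add: wrel.sym)
  qed
qed

lemma quad_ex:
  assumes "a < n" "b < n"
  obtains v where "v \<in> {n..<N}" "{#\<alpha> v, \<beta> v#} = {#a, b#}"
proof -
  have "{#a, b#} \<in> multisets_of_size {..<n} 2" using assms by (simp add: multisets_of_size_def)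
  then have "{#a, b#} \<in> (\<lambda>v. {#\<alpha> v, \<beta> v#}) ` {n..<N}"
    using quad_bij by (simp add: bij_betw_def)
  then show ?thesis using that by auto
qed

text \<open>Insertion sort: passing a smaller letter costs a commutator and meeting an equal one
  leaves a square. Both are of the form \<open>cen v\<close> and are collected on the right.\<close>

lemma insert_letter:
  assumes "a < n" "sorted_wrt (<) L" "L \<in> ws"
  shows "\<exists>L' vs. sorted_wrt (<) L' \<and> set L' \<subseteq> insert a (set L) \<and> set vs \<subseteq> {n..<N} \<and> a # L \<approx> L' @ cens vs"
  using assms
proof (induction L)
  case Nil
  then show ?case by (intro exI[of _ "[a]"] exI[of _ "[]"]) (auto intro: wrel.refl)
next
  case (Cons b L)
  have b: "b < n" "L \<in> ws" "sorted_wrt (<) L" "\<And>x. x \<in> set L \<Longrightarrow> b < x"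
    using Cons.prems by auto
  consider "a < b" | "a = b" | "b < a"
    by linarith
  then show ?case
  proof cases
    case 1
    then show ?thesis
      using Cons.prems by (intro exI[of _ "a # b # L"] exI[of _ "[]"]) (auto intro!: wrel.refl)
  next
    case 2
    obtain v where v: "v \<in> {n..<N}" "{#\<alpha> v, \<beta> v#} = {#a, a#}"
      using quad_ex[OF Cons.prems(1,1)] .
    have "a # b # L = [a] @ [a] @ L" by (simp add: 2)
    also have "\<dots> \<approx> L @ [a] @ [a]" using b Cons.prems by (intro wrel.sqcomm) auto
    also have "[a] @ [a] = cens [v]" using v(2) by (auto simp: cen_def add_eq_conv_ex)
    finally show ?thesis using b v(1) by (intro exI[of _ L] exI[of _ "[v]"]) auto
  next
    case 3
    obtain v where v: "v \<in> {n..<N}" "{#\<alpha> v, \<beta> v#} = {#b, a#}"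
      using quad_ex[OF b(1) Cons.prems(1)] .
    have cen: "central (cen v)" by (rule central_cen[OF v(1)])
    obtain L' vs where L': "sorted_wrt (<) L'" "set L' \<subseteq> insert a (set L)" "set vs \<subseteq> {n..<N}" "a # L \<approx> L' @ cens vs"
      using Cons.IH[OF Cons.prems(1) b(3,2)] by blast
    have "a # b # L = [a, b] @ L" by simp
    also have "\<dots> \<approx> ([b, a] @ cen v) @ L"
      using swap_cen[OF v] 3 b by (intro eqv_append wrel.refl) auto
    also have "([b, a] @ cen v) @ L = [b, a] @ (cen v @ L)" by simp
    also have "\<dots> \<approx> [b, a] @ (L @ cen v)"
      using cen b Cons.prems by (intro eqv_append[of "[b, a]"] wrel.refl) (auto simp: central_def)
    also have "[b, a] @ (L @ cen v) = [b] @ (a # L) @ cen v" by simp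
    also have "\<dots> \<approx> [b] @ (L' @ cens vs) @ cen v"
      using L'(4) b central_ws[OF cen] by (intro eqv_append[of "[b]"] eqv_append[of _ _ "cen v"] wrel.refl) auto
    also have "[b] @ (L' @ cens vs) @ cen v = (b # L') @ cens (vs @ [v])" by simp
    finally have "a # b # L \<approx> (b # L') @ cens (vs @ [v])" .
    moreover have "sorted_wrt (<) (b # L')" using L' b(4) 3 by auto
    ultimately show ?thesis using L' v(1) by (intro exI[of _ "b # L'"] exI[of _ "vs @ [v]"]) auto
  qed
qed

lemma normal_form:
  "w \<in> ws \<Longrightarrow> \<exists>L vs. sorted_wrt (<) L \<and> L \<in> ws \<and> set vs \<subseteq> {n..<N} \<and> w \<approx> L @ cens vs"
proof (induction w)
  case Nil
  then show ?case by (intro exI[of _ "[]"]) (auto intro: wrel.refl)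
next
  case (Cons a w)
  then obtain L vs where L: "sorted_wrt (<) L" "L \<in> ws" "set vs \<subseteq> {n..<N}" "w \<approx> L @ cens vs"
    by auto
  obtain L' us where L': "sorted_wrt (<) L'" "set L' \<subseteq> insert a (set L)" "set us \<subseteq> {n..<N}" "a # L \<approx> L' @ cens us"
    using insert_letter[of a L] Cons.prems L by auto
  have "a # w = [a] @ w" by simp
  also have "\<dots> \<approx> [a] @ (L @ cens vs)" using L Cons.prems by (intro eqv_append wrel.refl) auto
  also have "[a] @ (L @ cens vs) = (a # L) @ cens vs" by simp
  also have "\<dots> \<approx> (L' @ cens us) @ cens vs"
    using L' central_ws[OF central_cens[OF L(3)]] by (intro eqv_append wrel.refl)
  also have "(L' @ cens us) @ cens vs = L' @ cens (us @ vs)" by simp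
  finally show ?case using L L' Cons.prems by (intro exI[of _ L'] exI[of _ "us @ vs"]) auto
qed

section \<open>Coordinates of normal forms\<close>

definition cow :: "nat list \<Rightarrow> nat set" where
  "cow w = {i. i < n \<and> xco i w = 1} \<union> {v. n \<le> v \<and> v < N \<and> zco (\<alpha> v) (\<beta> v) w = 1}"

lemma cow_eqv: "u \<approx> v \<Longrightarrow> cow u = cow v"
  using wrel_co[of n u v] unfolding cow_def by simp

lemma xco_cen: "xco i (cen v) = 0"
  by (cases "\<alpha> v = i"; cases "\<beta> v = i") (simp_all add: cen_def)

lemma xco_cens: "xco i (cens vs) = 0"
  by (induction vs) (simp_all add: xco_cen)

lemma zco_double: "zco i j [a, a] = of_bool (i = a \<and> j = a)"
  by auto

text \<open>The value is symmetric in \<open>i\<close> and \<open>j\<close>, so the unordered pair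
  decides, and \<open>cen v\<close> has the z_v coordinate as its only nonzero one.\<close>

lemma zco_swap: "a \<noteq> b \<Longrightarrow> zco i j [a, b, a, b, a, a, b, b] = of_bool (i = a \<and> j = b \<or> i = b \<and> j = a)"
  by (cases "i = a"; cases "i = b"; cases "j = a"; cases "j = b") simp_all

lemma quad_eq_iff:
  assumes "u \<in> {n..<N}" "v \<in> {n..<N}"
  shows "u = v \<longleftrightarrow> (\<alpha> u = \<alpha> v \<and> \<beta> u = \<beta> v) \<or> (\<alpha> u = \<beta> v \<and> \<beta> u = \<alpha> v)"
proof -
  have "u = v \<longleftrightarrow> {#\<alpha> u, \<beta> u#} = {#\<alpha> v, \<beta> v#}"
    using quad_bij assms unfolding bij_betw_def inj_on_def by blast
  then show ?thesis by (auto simp: add_eq_conv_ex)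
qed

lemma zco_cen:
  assumes "u \<in> {n..<N}" "v \<in> {n..<N}"
  shows "zco (\<alpha> u) (\<beta> u) (cen v) = of_bool (u = v)"
  unfolding quad_eq_iff[OF assms]
  by (cases "\<alpha> v = \<beta> v") (simp_all only: cen_def zco_double zco_swap if_True if_False not_False_eq_True, auto)

lemma zco_cens:
  assumes "u \<in> {n..<N}" "set vs \<subseteq> {n..<N}"
  shows "zco (\<alpha> u) (\<beta> u) (cens vs) = of_nat (count_list vs u)"
  using assms(2)
proof (induction vs)
  case (Cons v vs)
  then show ?case using zco_cen[OF assms(1), of v] xco_cens[of "\<beta> u" vs] by auto
qed simp

lemma count_list_distinct: "distinct L \<Longrightarrow> count_list L i = of_bool (i \<in> set L)"
  by (induction L) auto

text \<open>In a normal form the coordinates below \<open>n\<close> give the increasing part; once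
  these parts agree, the remaining coordinates give the parities of the central factors, which is
  all that matters by \<open>cens_even\<close>.\<close>

lemma cow_inj:
  assumes "u \<in> ws" "v \<in> ws" "cow u = cow v"
  shows "u \<approx> v"
proof -
  obtain L us where L: "sorted_wrt (<) L" "L \<in> ws" "set us \<subseteq> {n..<N}" "u \<approx> L @ cens us"
    using normal_form[OF assms(1)] by blast
  obtain K vs where K: "sorted_wrt (<) K" "K \<in> ws" "set vs \<subseteq> {n..<N}" "v \<approx> K @ cens vs"
    using normal_form[OF assms(2)] by blast
  have eq: "cow (L @ cens us) = cow (K @ cens vs)" using cow_eqv[OF L(4)] cow_eqv[OF K(4)] assms(3) by simp
  have xset: "cow (M @ cens ws) \<inter> {..<n} = set M" if "sorted_wrt (<) M" "M \<in> lists {..<n}" for M ws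
    using that n_le_N by (auto simp: cow_def xco_cens xco_def[of _ M] count_list_distinct strict_sorted_iff split: if_splits)
  have "set L = set K" using xset[of L us] xset[of K vs] L K eq by simp
  then have LK: "L = K" using L(1) K(1) by (simp add: strict_sorted_equal)
  have "even (count_list (us @ vs) w)" for w
  proof (cases "w \<in> {n..<N}")
    case True
    have "zco (\<alpha> w) (\<beta> w) (L @ cens us) = 1 \<longleftrightarrow> zco (\<alpha> w) (\<beta> w) (L @ cens vs) = 1"
    proof -
      have "w \<in> cow (L @ cens us) \<longleftrightarrow> w \<in> cow (L @ cens vs)"
        using eq by (simp add: LK)
      then show ?thesis using True by (simp add: cow_def del: zco_append)
    qed
    then have "zco (\<alpha> w) (\<beta> w) (L @ cens us) = zco (\<alpha> w) (\<beta> w) (L @ cens vs)"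
      by (rule bit_eqI)
    then have "(of_nat (count_list us w) :: bit) = of_nat (count_list vs w)"
      using zco_cens[OF True] L(3) K(3) by (simp add: xco_cens)
    then have "(of_nat (count_list (us @ vs) w) :: bit) = 0" by simp
    then show ?thesis by (metis even_of_nat_iff even_zero)
  next
    case False
    then have "count_list (us @ vs) w = 0" using L(3) K(3) by (auto simp: count_list_0_iff)
    then show ?thesis by simp
  qed
  then have "cens (us @ vs) \<approx> []" using L(3) K(3) by (intro cens_even) auto
  have cu: "central (cens us)" and cv: "central (cens vs)" using central_cens L(3) K(3) by auto
  \<comment> \<open>\<open>cens vs\<close> squares to the identity, so it is inserted twice and one
    copy cancels with \<open>cens us\<close>.\<close>
  have "cens us @ [] \<approx> cens us @ (cens vs @ cens vs)"
    using cu cv by (intro eqv_append wrel.refl) (auto simp: central_def wrel.sym)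
  also have "cens us @ (cens vs @ cens vs) = cens (us @ vs) @ cens vs" by simp
  also have "\<dots> \<approx> [] @ cens vs"
    using \<open>cens (us @ vs) \<approx> []\<close> central_ws[OF cv] by (intro eqv_append wrel.refl)
  finally have "cens us \<approx> cens vs"
    by simp
  then have "L @ cens us \<approx> K @ cens vs" unfolding LK using K(2) by (intro eqv_append wrel.refl)
  then show ?thesis using L(4) K(4) by (meson wrel.sym wrel.trans)
qed

lemma cow_surj:
  assumes "S \<subseteq> {..<N}"
  shows "\<exists>w\<in>ws. cow w = S"
proof -
  define L where "L = sorted_list_of_set (S \<inter> {..<n})"
  \<comment> \<open>The increasing word \<open>L\<close> has coordinates from \<open>n\<close> on of
    its own; \<open>T\<close> lists those that still have to be flipped.\<close>
  define T where "T = {v \<in> {n..<N}. (v \<in> S) \<noteq> (v \<in> cow L)}"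
  define w where "w = L @ cens (sorted_list_of_set T)"
  have L: "set L = S \<inter> {..<n}" "distinct L" by (simp_all add: L_def)
  have T: "T \<subseteq> {n..<N}" "finite T" by (auto simp: T_def)
  have setT: "set (sorted_list_of_set T) \<subseteq> {n..<N}" using T by simp
  have "w \<in> ws" using L central_ws[OF central_cens[OF setT]] by (auto simp: w_def)
  moreover have "i \<in> cow w \<longleftrightarrow> i \<in> S" for i
  proof -
    consider "i < n" | "i \<in> {n..<N}" | "N \<le> i"
      by fastforce
    then show ?thesis
    proof cases
      case 1
      then show ?thesis using L by (auto simp: cow_def w_def xco_cens xco_def[of _ L] count_list_distinct)
    next
      case 2
      have "zco (\<alpha> i) (\<beta> i) w = zco (\<alpha> i) (\<beta> i) L + of_bool (i \<in> T)"
        using zco_cens[OF 2 setT] T by (simp add: w_def xco_cens count_list_distinct)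
      moreover have "i \<in> cow w \<longleftrightarrow> zco (\<alpha> i) (\<beta> i) w = 1" "i \<in> cow L \<longleftrightarrow> zco (\<alpha> i) (\<beta> i) L = 1"
        using 2 by (auto simp: cow_def)
      moreover have "i \<in> T \<longleftrightarrow> (i \<in> S) \<noteq> (i \<in> cow L)"
        using 2 by (simp add: T_def)
      ultimately show ?thesis by (cases "zco (\<alpha> i) (\<beta> i) L") auto
    next
      case 3
      then show ?thesis using assms n_le_N by (auto simp: cow_def)
    qed
  qed
  ultimately show ?thesis by blast
qed

section \<open>The group W(n) with these coordinates\<close>

lemma wclass_eq_iff: "u \<in> ws \<Longrightarrow> wclass n u = wclass n v \<longleftrightarrow> u \<approx> v"
proof
  assume u: "u \<in> ws" "wclass n u = wclass n v"
  have "u \<in> wclass n u" using u(1) by (simp add: wclass_def wrel.refl)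
  then show "u \<approx> v" unfolding u(2) by (simp add: wclass_def wrel.sym)
next
  assume "u \<approx> v"
  then show "wclass n u = wclass n v" unfolding wclass_def using wrel.sym wrel.trans by blast
qed

lemma W_mult:
  assumes "u \<in> ws" "v \<in> ws"
  shows "wclass n u \<otimes>\<^bsub>W n\<^esub> wclass n v = wclass n (u @ v)"
proof -
  have "(\<exists>a\<in>wclass n u. \<exists>b\<in>wclass n v. a @ b \<approx> w) \<longleftrightarrow> u @ v \<approx> w" for w
  proof
    assume "\<exists>a\<in>wclass n u. \<exists>b\<in>wclass n v. a @ b \<approx> w"
    then obtain a b where "u \<approx> a" "v \<approx> b" "a @ b \<approx> w" by (auto simp: wclass_def)
    then show "u @ v \<approx> w" using eqv_append wrel.trans by blast
  next
    assume "u @ v \<approx> w"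
    moreover have "u \<in> wclass n u" "v \<in> wclass n v"
      using assms by (simp_all add: wclass_def wrel.refl)
    ultimately show "\<exists>a\<in>wclass n u. \<exists>b\<in>wclass n v. a @ b \<approx> w" by blast
  qed
  then show ?thesis by (simp add: W_def wclass_def)
qed

text \<open>All words of a class have the same \<open>cow\<close>, so the union is that common value
  and no representative has to be chosen.\<close>

definition coc :: "nat list set \<Rightarrow> nat set" where
  "coc A = \<Union> (cow ` A)"

lemma coc_wclass: "w \<in> ws \<Longrightarrow> coc (wclass n w) = cow w"
proof -
  assume "w \<in> ws"
  then have "w \<in> wclass n w" by (simp add: wclass_def wrel.refl)
  moreover have "cow ` wclass n w = (\<lambda>_. cow w) ` wclass n w"
    using cow_eqv[of w] by (intro image_cong[OF HOL.refl]) (simp add: wclass_def)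
  ultimately show ?thesis unfolding coc_def by auto
qed

lemma carrier_W: "carrier (W n) = wclass n ` ws"
  by (simp add: W_def)

sublocale coordinates "W n" coc n N \<alpha> \<beta>
proof
  show "x \<otimes>\<^bsub>W n\<^esub> y \<in> carrier (W n)" if xy: "x \<in> carrier (W n)" "y \<in> carrier (W n)" for x y
  proof -
    obtain a b where "a \<in> ws" "b \<in> ws" "x = wclass n a" "y = wclass n b"
      using xy unfolding carrier_W by blast
    moreover from this have "a @ b \<in> ws"
      by simp
    ultimately show ?thesis unfolding carrier_W by (simp only: W_mult imageI)
  qed
  show "(x \<otimes>\<^bsub>W n\<^esub> y) \<otimes>\<^bsub>W n\<^esub> z = x \<otimes>\<^bsub>W n\<^esub> (y \<otimes>\<^bsub>W n\<^esub> z)"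
    if xyz: "x \<in> carrier (W n)" "y \<in> carrier (W n)" "z \<in> carrier (W n)" for x y z
  proof -
    obtain a b e where abe: "a \<in> ws" "b \<in> ws" "e \<in> ws" "x = wclass n a" "y = wclass n b" "z = wclass n e"
      using xyz unfolding carrier_W by blast
    have "a @ b \<in> ws" "b @ e \<in> ws" using abe by simp_all
    with abe show ?thesis by (simp only: W_mult append_assoc)
  qed
  show "bij_betw coc (carrier (W n)) (Pow {..<N})"
  proof (rule bij_betw_imageI)
    show "inj_on coc (carrier (W n))"
    proof (rule inj_onI)
      fix x y assume "x \<in> carrier (W n)" "y \<in> carrier (W n)" and eq: "coc x = coc y"
      then obtain u v where uv: "u \<in> ws" "v \<in> ws" "x = wclass n u" "y = wclass n v"
        unfolding carrier_W by blast
      then have "cow u = cow v" using eq by (simp only: coc_wclass)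
      then show "x = y" using cow_inj[OF uv(1,2)] wclass_eq_iff[OF uv(1), of v] uv(3,4) by simp
    qed
    have "coc ` carrier (W n) = cow ` ws"
      unfolding carrier_W image_image by (rule image_cong[OF HOL.refl]) (rule coc_wclass)
    also have "\<dots> = Pow {..<N}"
    proof
      show "cow ` ws \<subseteq> Pow {..<N}" using n_le_N by (auto simp: cow_def)
      show "Pow {..<N} \<subseteq> cow ` ws" using cow_surj by blast
    qed
    finally show "coc ` carrier (W n) = Pow {..<N}" .
  qed
  show "v \<in> coc (x \<otimes>\<^bsub>W n\<^esub> y) \<longleftrightarrow> ((v \<in> coc x) \<noteq> (v \<in> coc y))"
    if xy: "x \<in> carrier (W n)" "y \<in> carrier (W n)" and v: "v < n" for x y v
  proof -
    obtain a b where ab: "a \<in> ws" "b \<in> ws" "x = wclass n a" "y = wclass n b"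
      using xy unfolding carrier_W by blast
    have "v \<in> cow w \<longleftrightarrow> xco v w = 1" for w using v by (auto simp: cow_def)
    moreover have "a @ b \<in> ws" using ab by simp
    ultimately show ?thesis using ab by (cases "xco v a"; cases "xco v b") (simp_all add: W_mult coc_wclass)
  qed
  show "v \<in> coc (x \<otimes>\<^bsub>W n\<^esub> y) \<longleftrightarrow> (((v \<in> coc x) \<noteq> (v \<in> coc y)) \<noteq> (\<alpha> v \<in> coc x \<and> \<beta> v \<in> coc y))"
    if xy: "x \<in> carrier (W n)" "y \<in> carrier (W n)" and v: "n \<le> v" "v < N" for x y v
  proof -
    obtain a b where ab: "a \<in> ws" "b \<in> ws" "x = wclass n a" "y = wclass n b"
      using xy unfolding carrier_W by blast
    have "v \<in> cow w \<longleftrightarrow> zco (\<alpha> v) (\<beta> v) w = 1" for w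
      using v by (auto simp: cow_def)
    moreover have "\<alpha> v \<in> cow w \<longleftrightarrow> xco (\<alpha> v) w = 1" "\<beta> v \<in> cow w \<longleftrightarrow> xco (\<beta> v) w = 1" for w
      using quad_less[of v] v by (auto simp: cow_def)
    moreover have "a @ b \<in> ws" using ab by simp
    ultimately show ?thesis
      using ab by (cases "zco (\<alpha> v) (\<beta> v) a"; cases "zco (\<alpha> v) (\<beta> v) b"; cases "xco (\<alpha> v) a"; cases "xco (\<beta> v) b")
        (simp_all add: W_mult coc_wclass)
  qed
qed (use n_le_N quad_bij in auto)

end

section \<open>From the ranks to the two coefficients\<close>

lemma quadratic_exists:
  obtains \<alpha> \<beta> where "quadratic n (n + ((n + 1) choose 2)) \<alpha> \<beta>"
proof -
  let ?N = "n + ((n + 1) choose 2)" and ?Q = "multisets_of_size {..<n} 2"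
  have "card ?Q = (n + 1) choose 2" by (simp add: card_multisets_of_size)
  then have "card {n..<?N} = card ?Q" by simp
  then obtain e where e: "bij_betw e {n..<?N} ?Q" using finite_same_card_bij[of "{n..<?N}" ?Q] by auto
  have "\<exists>p. e v = {#fst p, snd p#}" if "v \<in> {n..<?N}" for v
  proof -
    have "size (e v) = 2" using bij_betwE[OF e] that by (auto simp: multisets_of_size_def)
    then obtain a M where M: "e v = add_mset a M" "size M = 1"
      using size_eq_Suc_imp_eq_union[of "e v" 1] by auto
    then obtain b where "M = {#b#}" using size_1_singleton_mset[of M] by auto
    with M have "e v = {#a, b#}" by simp
    then show ?thesis by (intro exI[of _ "(a, b)"]) simp
  qed
  then obtain p where p: "\<And>v. v \<in> {n..<?N} \<Longrightarrow> e v = {#fst (p v), snd (p v)#}" by metis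
  have "bij_betw (\<lambda>v. {#fst (p v), snd (p v)#}) {n..<?N} ?Q"
    using e p by (subst bij_betw_cong[of _ _ e]) auto
  then show ?thesis by (intro that[of "\<lambda>v. fst (p v)" "\<lambda>v. snd (p v)"]) (unfold_locales, auto)
qed

text \<open>This turns numbers of multisets into polynomials in \<open>m\<close>; it holds for
  \<open>m = 0\<close> too, where the subtraction truncates.\<close>

lemma of_nat_multichoose:
  "of_nat ((m + k - 1) choose k) = (pochhammer (of_nat m) k / fact k :: rat)"
proof (cases "m = 0")
  case True
  then show ?thesis by (cases k) (simp_all add: pochhammer_0_left)
next
  case False
  then have "of_nat (m + k - 1) - of_nat k + 1 = (of_nat m :: rat)" by (simp add: of_nat_diff)
  then show ?thesis by (simp add: binomial_gbinomial gbinomial_pochhammer')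
qed

lemma sum_lessThan_rat: "of_nat (\<Sum>i<r. i) = (of_nat r * (of_nat r - 1) / 2 :: rat)"
proof -
  have "2 * of_nat (\<Sum>i<r. i) = (of_nat r * (of_nat r - 1) :: rat)"
    by (induction r) (simp_all add: algebra_simps)
  then show ?thesis by simp
qed

lemma fps_nth_mult_one_minus_X2:
  "fps_nth (f * (1 - fps_X ^ 2)) k = fps_nth f k - (if k < 2 then 0 else fps_nth f (k - 2))" for f :: "rat fps"
  by (simp add: right_diff_distrib fps_X_power_mult_right_nth)

text \<open>Up to degree three \<open>(1 - t^2)^r\<close> is \<open>1 - r t^2\<close>.\<close>

lemma fps_nth_mult_one_minus_X2_power:
  fixes f :: "rat fps" and r :: nat
  defines "g \<equiv> f * (1 - fps_X ^ 2) ^ r"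
  shows "fps_nth g 0 = fps_nth f 0" "fps_nth g 1 = fps_nth f 1"
    "fps_nth g 2 = fps_nth f 2 - of_nat r * fps_nth f 0"
    "fps_nth g 3 = fps_nth f 3 - of_nat r * fps_nth f 1"
  unfolding g_def
  by (induction r)
    (simp_all only: power_0 mult_1_right power_Suc2 mult.assoc[symmetric] fps_nth_mult_one_minus_X2,
      simp_all add: algebra_simps)

theorem theorem6p14:
  fixes n :: nat
  assumes "n \<ge> 1"
  defines "r \<equiv> (n + 1) choose 2"
  defines "q \<equiv> poincare_series (W n) * (1 - fps_X ^ 2) ^ r"
  shows "fps_nth q 2 = of_int (int n * (int n + 1) * (int n - 1)) / 3 \<and>
         fps_nth q 3 = of_int (int n * (int n ^ 2 - 1) * (3 * int n - 4) * (int n + 3)) / 60"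
proof -
  obtain \<alpha> \<beta> where "quadratic n (n + r) \<alpha> \<beta>"
    unfolding r_def by (rule quadratic_exists)
  then interpret quadratic n "n + r" \<alpha> \<beta> .
  \<comment> \<open>The numbers of x_i, of z_v and of all coordinates. The dimensions are
    polynomials in them, and since \<open>s = x (x + 1) / 2\<close> the claims become identities in
    \<open>x\<close> alone.\<close>
  define x s N' :: rat where "x = of_nat n" and "s = of_nat r" and "N' = x + s"
  define h where "h k = (of_nat (cohom_dim (W n) k) :: rat)" for k
  have s: "s = x * (x + 1) / 2"
    using of_nat_multichoose[of n 2] by (simp add: s_def r_def x_def pochhammer_Suc numeral_2_eq_2)
  have xs: "of_nat (card (xsets k)) = pochhammer x k / fact k" for k
    by (simp only: card_xsets of_nat_multichoose x_def)
  have ms: "of_nat (card (msets k)) = pochhammer N' k / fact k" for k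
    by (simp only: card_msets of_nat_multichoose N'_def x_def s_def of_nat_add)
  have ks: "of_nat (card (kz k k)) = pochhammer s k / fact k" for k
    by (simp only: card_kz_diag of_nat_multichoose s_def diff_add_inverse)
  have S: "of_nat (\<Sum>i<r. i) = s * (s - 1) / 2" by (simp only: sum_lessThan_rat s_def)
  have h0: "h 0 = 1" and h1: "h 1 = x" by (simp_all only: h_def x_def cohom_dim_0 cohom_dim_1 of_nat_1)
  have "h 2 + pochhammer x 2 / fact 2 + (s * (s - 1) / 2 + pochhammer x 3 / fact 3) = pochhammer N' 2 / fact 2"
    using arg_cong[OF cohom_dim_2, of "of_nat :: nat \<Rightarrow> rat"]
    by (simp only: of_nat_add diff_add_inverse S xs ms h_def)
  then have h2: "h 2 - s = x * (x + 1) * (x - 1) / 3"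
    unfolding N'_def s by (simp add: pochhammer_Suc eval_nat_numeral fact_Suc field_simps)
  have "h 3 + (s * (s - 1) / 2 + pochhammer x 3 / fact 3) +
      (pochhammer s 3 / fact 3 + pochhammer x 3 / fact 3 * s + pochhammer x 4 / fact 4) =
      pochhammer N' 3 / fact 3 + pochhammer x 5 / fact 5"
    using arg_cong[OF cohom_dim_3, of "of_nat :: nat \<Rightarrow> rat"]
    by (simp only: of_nat_add of_nat_mult diff_add_inverse S xs ms ks h_def s_def[symmetric])
  then have h3_eq: "h 3 = N' * (N' + 1) * (N' + 2) / 6 + x * (x + 1) * (x + 2) * (x + 3) * (x + 4) / 120
      - s * (s - 1) / 2 - x * (x + 1) * (x + 2) / 6 - s * (s + 1) * (s + 2) / 6
      - x * (x + 1) * (x + 2) * s / 6 - x * (x + 1) * (x + 2) * (x + 3) / 24"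
    by (simp add: pochhammer_Suc eval_nat_numeral fact_Suc mult.commute[of s])
  have h3: "h 3 - s * x = x * (x ^ 2 - 1) * (3 * x - 4) * (x + 3) / 60"
    unfolding h3_eq N'_def s by (simp add: field_simps power2_eq_square)
  have q: "fps_nth q 2 = h 2 - s" "fps_nth q 3 = h 3 - s * x"
    unfolding q_def fps_nth_mult_one_minus_X2_power h1[symmetric]
    by (simp_all only: poincare_series_def fps_nth_Abs_fps h_def[symmetric] h0 s_def mult_1_right)
  show ?thesis unfolding q h2 h3 by (simp add: x_def)
qed

end
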